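(* Let $p$ be an odd prime and let $G$ be a finite $p$-group satisfying at least one of the following conditions: (i) $\gamma_m(G)\subset G^{p}$ for some $m$ with $2\le m\le p-1$; (ii) $\gamma_p(G)\subset G^{p^2}$. Then $\exp(G\wedge G)\mid \exp(G)$. In particular, $\exp(M(G))\mid \exp(G)$.
   Context: $\exp(X)$ denotes the exponent of a group $X$. $\gamma_i(G)$ is the $i$-th term of the lower central series ($\gamma_1(G)=G$, $\gamma_{i+1}(G)=[G,\gamma_i(G)]$), and $G^k$ is the subgroup of $G$ generated by all $k$-th powers of elements of $G$. Write ${}^g h=ghg^{-1}$. The nonabelian tensor square $G\otimes G$ is the group generated by symbols $g\otimes h$ ($g,h\in G$) subject to the relations $gg'\otimes h=({}^g g'\otimes {}^g h)(g\otimes h)$ and $g\otimes hh'=(g\otimes h)({}^h g\otimes {}^h h')$ for all $g,g',h,h'\in G$. The (nonabelian) exterior square is $G\wedge G=(G\otimes G)/\nabla(G)$, where $\nabla(G)$ is the subgroup generated by all $x\otimes x$, $x\in G$. The Schur multiplier is $M(G)=H_2(G,\mathbb{Z})$; it is isomorphic to the kernel of the homomorphism $G\wedge G\to [G,G]$, $g\wedge h\mapsto [g,h]=ghg^{-1}h^{-1}$. *)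

theory Defs
  imports "HOL-Algebra.Generated_Groups" "HOL-Algebra.Free_Abelian_Groups"
    "HOL-Computational_Algebra.Primes"
begin

section \<open>Exponent, lower central series, power subgroups\<close>

text \<open>The value 0 encodes an infinite exponent. Hence \<open>group_exponent X dvd group_exponent Y\<close> with
  \<open>group_exponent Y > 0\<close> includes the assertion that \<open>X\<close> has finite exponent.\<close>

definition group_exponent :: "('a, 'b) monoid_scheme \<Rightarrow> nat" where
  "group_exponent X =
     (if \<exists>n>0. \<forall>x\<in>carrier X. x [^]\<^bsub>X\<^esub> (n::nat) = \<one>\<^bsub>X\<^esub>
      then LEAST n::nat. n > 0 \<and> (\<forall>x\<in>carrier X. x [^]\<^bsub>X\<^esub> n = \<one>\<^bsub>X\<^esub>) else 0)"

definition commutator_subgroup :: "('a, 'b) monoid_scheme \<Rightarrow> 'a set \<Rightarrow> 'a set \<Rightarrow> 'a set" where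
  "commutator_subgroup G H K =
     generate G {h \<otimes>\<^bsub>G\<^esub> k \<otimes>\<^bsub>G\<^esub> inv\<^bsub>G\<^esub> h \<otimes>\<^bsub>G\<^esub> inv\<^bsub>G\<^esub> k | h k. h \<in> H \<and> k \<in> K}"

text \<open>Indexed from 1, so that \<open>lower_central G i\<close> is $\gamma_i(G)$; the value at 0 is a dummy.\<close>

fun lower_central :: "('a, 'b) monoid_scheme \<Rightarrow> nat \<Rightarrow> 'a set" where
  "lower_central G 0 = carrier G"
| "lower_central G (Suc 0) = carrier G"
| "lower_central G (Suc (Suc i)) = commutator_subgroup G (carrier G) (lower_central G (Suc i))"

definition power_subgroup :: "('a, 'b) monoid_scheme \<Rightarrow> nat \<Rightarrow> 'a set" where
  "power_subgroup G k = generate G {x [^]\<^bsub>G\<^esub> k | x. x \<in> carrier G}"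


section \<open>Groups given by generators and relations\<close>

text \<open>A word is a list of signed letters; \<open>(True, s)\<close> stands for $s$ and \<open>(False, s)\<close> for $s^{-1}$.
  A relation \<open>(u, v)\<close> imposes $u = v$.\<close>

type_synonym 's word = "(bool \<times> 's) list"

inductive word_eq :: "'s set \<Rightarrow> ('s word \<times> 's word) set \<Rightarrow> 's word \<Rightarrow> 's word \<Rightarrow> bool"
  for S :: "'s set" and R :: "('s word \<times> 's word) set" where
  refl: "w \<in> lists (UNIV \<times> S) \<Longrightarrow> word_eq S R w w"
| sym: "word_eq S R u v \<Longrightarrow> word_eq S R v u"
| trans: "word_eq S R u v \<Longrightarrow> word_eq S R v w \<Longrightarrow> word_eq S R u w"
| append: "word_eq S R u v \<Longrightarrow> word_eq S R u' v' \<Longrightarrow> word_eq S R (u @ u') (v @ v')"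
| cancel: "s \<in> S \<Longrightarrow> word_eq S R [(b, s), (\<not> b, s)] []"
| rel: "(u, v) \<in> R \<Longrightarrow> u \<in> lists (UNIV \<times> S) \<Longrightarrow> v \<in> lists (UNIV \<times> S) \<Longrightarrow> word_eq S R u v"

definition word_rel :: "'s set \<Rightarrow> ('s word \<times> 's word) set \<Rightarrow> ('s word \<times> 's word) set" where
  "word_rel S R = {(u, v). word_eq S R u v}"

definition presented_group :: "'s set \<Rightarrow> ('s word \<times> 's word) set \<Rightarrow> 's word set monoid" where
  "presented_group S R =
     \<lparr>carrier = lists (UNIV \<times> S) // word_rel S R,
      monoid.mult = (\<lambda>A B. \<Union>u\<in>A. \<Union>v\<in>B. word_rel S R `` {u @ v}),
      one = word_rel S R `` {[]}\<rparr>"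

lemma word_eq_lists:
  "word_eq S R u v \<Longrightarrow> u \<in> lists (UNIV \<times> S) \<and> v \<in> lists (UNIV \<times> S)"
  by (induction rule: word_eq.induct) auto

lemma equiv_word_rel: "equiv (lists (UNIV \<times> S)) (word_rel S R)"
proof (rule equivI)
  show "word_rel S R \<subseteq> lists (UNIV \<times> S) \<times> lists (UNIV \<times> S)"
    unfolding word_rel_def using word_eq_lists by blast
  show "refl_on (lists (UNIV \<times> S)) (word_rel S R)"
    unfolding word_rel_def by (rule refl_onI) (simp only: mem_Collect_eq prod.case word_eq.refl)
  show "sym_on UNIV (word_rel S R)"
    unfolding word_rel_def by (rule symI) (simp, rule word_eq.sym)
  show "trans_on UNIV (word_rel S R)"
    unfolding word_rel_def by (rule transI) (simp, rule word_eq.trans)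
qed

lemma word_class_eq_iff:
  assumes "u \<in> lists (UNIV \<times> S)" "v \<in> lists (UNIV \<times> S)"
  shows "word_rel S R `` {u} = word_rel S R `` {v} \<longleftrightarrow> word_eq S R u v"
  using eq_equiv_class_iff[OF equiv_word_rel assms] by (simp add: word_rel_def)

lemma presented_group_mult:
  assumes u: "u \<in> lists (UNIV \<times> S)" and v: "v \<in> lists (UNIV \<times> S)"
  shows "word_rel S R `` {u} \<otimes>\<^bsub>presented_group S R\<^esub> word_rel S R `` {v} = word_rel S R `` {u @ v}"
proof -
  have "word_rel S R `` {u' @ v'} = word_rel S R `` {u @ v}"
    if "u' \<in> word_rel S R `` {u}" "v' \<in> word_rel S R `` {v}" for u' v'
  proof -
    have "word_eq S R u u'" "word_eq S R v v'"
      using that by (auto simp: word_rel_def)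
    then have "word_eq S R (u' @ v') (u @ v)"
      by (intro word_eq.append word_eq.sym[of _ _ u] word_eq.sym[of _ _ v])
    then show ?thesis
      by (intro equiv_class_eq[OF equiv_word_rel]) (simp add: word_rel_def)
  qed
  moreover have "u \<in> word_rel S R `` {u}" "v \<in> word_rel S R `` {v}"
    using u v by (auto simp: word_rel_def intro: word_eq.refl)
  ultimately have "(\<Union>u'\<in>word_rel S R `` {u}. \<Union>v'\<in>word_rel S R `` {v}. word_rel S R `` {u' @ v'})
      = word_rel S R `` {u @ v}"
    by blast
  then show ?thesis
    by (simp add: presented_group_def)
qed

lemma carrier_presented_group:
  "carrier (presented_group S R) = (\<lambda>u. word_rel S R `` {u}) ` lists (UNIV \<times> S)"
  by (auto simp: presented_group_def quotient_def)

lemma one_presented_group: "\<one>\<^bsub>presented_group S R\<^esub> = word_rel S R `` {[]}"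
  by (simp add: presented_group_def)

lemma word_inverse_lists:
  "w \<in> lists (UNIV \<times> S) \<Longrightarrow> rev (map (apfst Not) w) \<in> lists (UNIV \<times> S)"
  by (induction w) auto

lemma word_eq_inverse:
  "w \<in> lists (UNIV \<times> S) \<Longrightarrow> word_eq S R (rev (map (apfst Not) w) @ w) []"
proof (induction w)
  case Nil
  then show ?case by (auto intro: word_eq.refl)
next
  case (Cons a w)
  obtain b s where a: "a = (b, s)" by force
  with Cons have s: "s \<in> S" and w: "w \<in> lists (UNIV \<times> S)" by auto
  note w' = word_inverse_lists[OF w]
  have "word_eq S R [(\<not> b, s), (b, s)] []"
    using word_eq.cancel[OF s, of R "\<not> b"] by simp
  from word_eq.append[OF word_eq.refl[OF w', of R] word_eq.append[OF this word_eq.refl[OF w]]]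
  have "word_eq S R (rev (map (apfst Not) (a # w)) @ (a # w)) (rev (map (apfst Not) w) @ w)"
    by (simp add: a)
  with Cons.IH[OF w] show ?case by (blast intro: word_eq.trans)
qed

lemma group_presented_group: "group (presented_group S R)"
proof -
  let ?P = "presented_group S R" and ?W = "lists (UNIV \<times> S)"
  let ?q = "\<lambda>w. word_rel S R `` {w}"
  have app: "u @ v \<in> ?W" if "u \<in> ?W" "v \<in> ?W" for u v
    using that by (simp only: append_in_lists_conv simp_thms)
  have cl: "?q w \<in> carrier ?P" if "w \<in> ?W" for w
    unfolding carrier_presented_group using that by (rule imageI)
  have ex: "\<exists>w\<in>?W. x = ?q w" if "x \<in> carrier ?P" for x
    using that unfolding carrier_presented_group by (simp only: image_iff)
  have nil: "[] \<in> ?W" by simp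
  show ?thesis
  proof (rule groupI)
    fix x y assume "x \<in> carrier ?P" "y \<in> carrier ?P"
    then obtain u v where uv: "u \<in> ?W" "x = ?q u" "v \<in> ?W" "y = ?q v"
      using ex by meson
    show "x \<otimes>\<^bsub>?P\<^esub> y \<in> carrier ?P"
      unfolding uv(2,4) presented_group_mult[OF uv(1,3)] by (rule cl[OF app[OF uv(1,3)]])
    fix z assume "z \<in> carrier ?P"
    then obtain w where w: "w \<in> ?W" "z = ?q w"
      using ex by meson
    show "x \<otimes>\<^bsub>?P\<^esub> y \<otimes>\<^bsub>?P\<^esub> z = x \<otimes>\<^bsub>?P\<^esub> (y \<otimes>\<^bsub>?P\<^esub> z)"
      unfolding uv(2,4) w(2) presented_group_mult[OF uv(1,3)] presented_group_mult[OF uv(3) w(1)]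
        presented_group_mult[OF app[OF uv(1,3)] w(1)] presented_group_mult[OF uv(1) app[OF uv(3) w(1)]]
      by (simp only: append_assoc)
  next
    fix x assume "x \<in> carrier ?P"
    then obtain u where u: "u \<in> ?W" "x = ?q u"
      using ex by meson
    let ?u' = "rev (map (apfst Not) u)"
    note u' = word_inverse_lists[OF u(1)]
    show "\<one>\<^bsub>?P\<^esub> \<otimes>\<^bsub>?P\<^esub> x = x"
      unfolding u(2) one_presented_group presented_group_mult[OF nil u(1)] append_Nil ..
    have "?q (?u' @ u) = ?q []"
      using word_class_eq_iff[OF app[OF u' u(1)] nil] word_eq_inverse[OF u(1)] by (rule iffD2)
    then have "?q ?u' \<otimes>\<^bsub>?P\<^esub> x = \<one>\<^bsub>?P\<^esub>"
      unfolding u(2) one_presented_group presented_group_mult[OF u' u(1)] .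
    with cl[OF u'] show "\<exists>y\<in>carrier ?P. y \<otimes>\<^bsub>?P\<^esub> x = \<one>\<^bsub>?P\<^esub>"
      by (rule rev_bexI)
  next
    show "\<one>\<^bsub>?P\<^esub> \<in> carrier ?P"
      unfolding one_presented_group by (rule cl[OF nil])
  qed
qed


section \<open>Nonabelian tensor square and exterior square\<close>

definition conj_act :: "('a, 'b) monoid_scheme \<Rightarrow> 'a \<Rightarrow> 'a \<Rightarrow> 'a" where
  "conj_act G g h = g \<otimes>\<^bsub>G\<^esub> h \<otimes>\<^bsub>G\<^esub> inv\<^bsub>G\<^esub> g"

definition tensor_relations :: "('a, 'b) monoid_scheme \<Rightarrow> (('a \<times> 'a) word \<times> ('a \<times> 'a) word) set" where
  "tensor_relations G =
     {([(True, (g \<otimes>\<^bsub>G\<^esub> g', h))],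
       [(True, (conj_act G g g', conj_act G g h)), (True, (g, h))]) | g g' h.
       g \<in> carrier G \<and> g' \<in> carrier G \<and> h \<in> carrier G} \<union>
     {([(True, (g, h \<otimes>\<^bsub>G\<^esub> h'))],
       [(True, (g, h)), (True, (conj_act G h g, conj_act G h h'))]) | g h h'.
       g \<in> carrier G \<and> h \<in> carrier G \<and> h' \<in> carrier G}"

definition tensor_square :: "('a, 'b) monoid_scheme \<Rightarrow> ('a \<times> 'a) word set monoid" where
  "tensor_square G = presented_group (carrier G \<times> carrier G) (tensor_relations G)"

definition tensor :: "('a, 'b) monoid_scheme \<Rightarrow> 'a \<Rightarrow> 'a \<Rightarrow> ('a \<times> 'a) word set" where
  "tensor G g h = word_rel (carrier G \<times> carrier G) (tensor_relations G) `` {[(True, (g, h))]}"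

definition nabla :: "('a, 'b) monoid_scheme \<Rightarrow> ('a \<times> 'a) word set set" where
  "nabla G = generate (tensor_square G) {tensor G x x | x. x \<in> carrier G}"

definition exterior_square :: "('a, 'b) monoid_scheme \<Rightarrow> ('a \<times> 'a) word set set monoid" where
  "exterior_square G = tensor_square G Mod nabla G"

lemma group_tensor_square: "group (tensor_square G)"
  by (simp add: tensor_square_def group_presented_group)

lemma tensor_closed:
  "\<lbrakk>g \<in> carrier G; h \<in> carrier G\<rbrakk> \<Longrightarrow> tensor G g h \<in> carrier (tensor_square G)"
  by (auto simp: tensor_def tensor_square_def carrier_presented_group)

lemma (in group) conj_act_closed [simp]:
  "\<lbrakk>g \<in> carrier G; h \<in> carrier G\<rbrakk> \<Longrightarrow> conj_act G g h \<in> carrier G"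
  by (simp add: conj_act_def)

lemma (in group) tensor_mult_left:
  assumes "g \<in> carrier G" "g' \<in> carrier G" "h \<in> carrier G"
  shows "tensor G (g \<otimes> g') h
    = tensor G (conj_act G g g') (conj_act G g h) \<otimes>\<^bsub>tensor_square G\<^esub> tensor G g h"
proof -
  have "word_eq (carrier G \<times> carrier G) (tensor_relations G) [(True, (g \<otimes> g', h))]
      [(True, (conj_act G g g', conj_act G g h)), (True, (g, h))]"
    using assms by (intro word_eq.rel) (auto simp: tensor_relations_def)
  moreover from word_eq_lists[OF this]
  have "tensor G (conj_act G g g') (conj_act G g h) \<otimes>\<^bsub>tensor_square G\<^esub> tensor G g h
    = word_rel (carrier G \<times> carrier G) (tensor_relations G) ``
        {[(True, (conj_act G g g', conj_act G g h)), (True, (g, h))]}"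
    unfolding tensor_def tensor_square_def by (subst presented_group_mult) auto
  moreover have "word_rel (carrier G \<times> carrier G) (tensor_relations G) `` {[(True, (g \<otimes> g', h))]}
    = word_rel (carrier G \<times> carrier G) (tensor_relations G) `` {[(True, (conj_act G g g', conj_act G g h)), (True, (g, h))]}"
    using calculation(1) by (intro equiv_class_eq[OF equiv_word_rel]) (simp add: word_rel_def)
  ultimately show ?thesis by (simp add: tensor_def)
qed

lemma (in group) tensor_mult_right:
  assumes "g \<in> carrier G" "h \<in> carrier G" "h' \<in> carrier G"
  shows "tensor G g (h \<otimes> h')
    = tensor G g h \<otimes>\<^bsub>tensor_square G\<^esub> tensor G (conj_act G h g) (conj_act G h h')"
proof -
  have "word_eq (carrier G \<times> carrier G) (tensor_relations G) [(True, (g, h \<otimes> h'))]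
      [(True, (g, h)), (True, (conj_act G h g, conj_act G h h'))]"
    using assms by (intro word_eq.rel) (auto simp: tensor_relations_def)
  moreover from word_eq_lists[OF this]
  have "tensor G g h \<otimes>\<^bsub>tensor_square G\<^esub> tensor G (conj_act G h g) (conj_act G h h')
    = word_rel (carrier G \<times> carrier G) (tensor_relations G) ``
        {[(True, (g, h)), (True, (conj_act G h g, conj_act G h h'))]}"
    unfolding tensor_def tensor_square_def by (subst presented_group_mult) auto
  moreover have "word_rel (carrier G \<times> carrier G) (tensor_relations G) `` {[(True, (g, h \<otimes> h'))]}
    = word_rel (carrier G \<times> carrier G) (tensor_relations G) `` {[(True, (g, h)), (True, (conj_act G h g, conj_act G h h'))]}"
    using calculation(1) by (intro equiv_class_eq[OF equiv_word_rel]) (simp add: word_rel_def)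
  ultimately show ?thesis by (simp add: tensor_def)
qed

lemma (in group) inv_mult_cancel: "\<lbrakk>g \<in> carrier G; x \<in> carrier G\<rbrakk> \<Longrightarrow> inv g \<otimes> (g \<otimes> x) = x"
  by (simp flip: m_assoc)

lemma (in group) conj_act_mult:
  "\<lbrakk>g \<in> carrier G; h \<in> carrier G; k \<in> carrier G\<rbrakk>
    \<Longrightarrow> conj_act G g (h \<otimes> k) = conj_act G g h \<otimes> conj_act G g k"
  by (simp add: conj_act_def m_assoc inv_mult_cancel)

lemma (in group) conj_act_conj_act:
  "\<lbrakk>g \<in> carrier G; h \<in> carrier G; k \<in> carrier G\<rbrakk>
    \<Longrightarrow> conj_act G g (conj_act G h k) = conj_act G (g \<otimes> h) k"
  by (simp add: conj_act_def m_assoc inv_mult_group)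

text \<open>Conjugation in the tensor square, obtained by expanding $gg' \otimes hh'$ in two ways.\<close>

lemma (in group) tensor_conj:
  assumes "g \<in> carrier G" "h \<in> carrier G" "x \<in> carrier G" "y \<in> carrier G"
  shows "tensor G (conj_act G (g \<otimes> h) x) (conj_act G (g \<otimes> h) y) \<otimes>\<^bsub>tensor_square G\<^esub> tensor G g h
    = tensor G g h \<otimes>\<^bsub>tensor_square G\<^esub> tensor G (conj_act G (h \<otimes> g) x) (conj_act G (h \<otimes> g) y)"
    (is "?A \<otimes>\<^bsub>?T\<^esub> ?t = ?t \<otimes>\<^bsub>?T\<^esub> ?B")
proof -
  interpret T: group ?T by (rule group_tensor_square)
  let ?C = "tensor G (conj_act G g x) (conj_act G g h)"
  let ?D = "tensor G (conj_act G h g) (conj_act G h y)"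
  have cl: "?A \<in> carrier ?T" "?B \<in> carrier ?T" "?C \<in> carrier ?T" "?D \<in> carrier ?T" "?t \<in> carrier ?T"
    using assms by (auto intro!: tensor_closed)
  have gh: "conj_act G g h \<otimes> g = g \<otimes> h" "conj_act G h g \<otimes> h = h \<otimes> g"
    using assms by (simp_all add: conj_act_def m_assoc)
  have "tensor G (g \<otimes> x) (h \<otimes> y)
    = tensor G (conj_act G g x) (conj_act G g h \<otimes> conj_act G g y) \<otimes>\<^bsub>?T\<^esub> tensor G g (h \<otimes> y)"
    using assms by (simp add: tensor_mult_left conj_act_mult)
  also have "\<dots> = (?C \<otimes>\<^bsub>?T\<^esub> ?A) \<otimes>\<^bsub>?T\<^esub> (?t \<otimes>\<^bsub>?T\<^esub> ?D)"
    using assms by (simp add: tensor_mult_right conj_act_conj_act gh)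
  finally have 1: "tensor G (g \<otimes> x) (h \<otimes> y) = (?C \<otimes>\<^bsub>?T\<^esub> ?A) \<otimes>\<^bsub>?T\<^esub> (?t \<otimes>\<^bsub>?T\<^esub> ?D)" .
  have "tensor G (g \<otimes> x) (h \<otimes> y)
    = tensor G (g \<otimes> x) h \<otimes>\<^bsub>?T\<^esub> tensor G (conj_act G h g \<otimes> conj_act G h x) (conj_act G h y)"
    using assms by (simp add: tensor_mult_right conj_act_mult)
  also have "\<dots> = (?C \<otimes>\<^bsub>?T\<^esub> ?t) \<otimes>\<^bsub>?T\<^esub> (?B \<otimes>\<^bsub>?T\<^esub> ?D)"
    using assms by (simp add: tensor_mult_left conj_act_conj_act gh)
  finally have 2: "tensor G (g \<otimes> x) (h \<otimes> y) = (?C \<otimes>\<^bsub>?T\<^esub> ?t) \<otimes>\<^bsub>?T\<^esub> (?B \<otimes>\<^bsub>?T\<^esub> ?D)" .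
  have "?C \<otimes>\<^bsub>?T\<^esub> ((?A \<otimes>\<^bsub>?T\<^esub> ?t) \<otimes>\<^bsub>?T\<^esub> ?D) = ?C \<otimes>\<^bsub>?T\<^esub> ((?t \<otimes>\<^bsub>?T\<^esub> ?B) \<otimes>\<^bsub>?T\<^esub> ?D)"
    using 1 2 cl by (simp add: T.m_assoc)
  then show ?thesis using cl by simp
qed

lemma (in group) nabla_normal: "nabla G \<lhd> tensor_square G"
proof -
  let ?T = "tensor_square G" and ?S = "carrier G \<times> carrier G"
  let ?q = "\<lambda>w. word_rel ?S (tensor_relations G) `` {w}"
  let ?X = "{tensor G x x | x. x \<in> carrier G}"
  interpret T: group ?T by (rule group_tensor_square)
  have X: "?X \<subseteq> carrier ?T" by (auto intro: tensor_closed)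
  have inv_letter: "?q [(False, (g, h))] = inv\<^bsub>?T\<^esub> tensor G g h"
    if "g \<in> carrier G" "h \<in> carrier G" for g h
  proof (rule T.inv_equality[symmetric])
    have "word_eq ?S (tensor_relations G) [(False, (g, h)), (True, (g, h))] []"
      using word_eq.cancel[of "(g, h)" ?S _ False] that by simp
    then have "?q ([(False, (g, h))] @ [(True, (g, h))]) = ?q []"
      by (intro equiv_class_eq[OF equiv_word_rel]) (simp add: word_rel_def)
    moreover have "[(False, (g, h))] \<in> lists (UNIV \<times> ?S)" "[(True, (g, h))] \<in> lists (UNIV \<times> ?S)"
      using that by simp_all
    ultimately show "?q [(False, (g, h))] \<otimes>\<^bsub>?T\<^esub> tensor G g h = \<one>\<^bsub>?T\<^esub>"
      by (simp only: tensor_def tensor_square_def one_presented_group presented_group_mult)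
    show "?q [(False, (g, h))] \<in> carrier ?T"
      using that by (auto simp: tensor_square_def carrier_presented_group)
  qed (use that in \<open>simp add: tensor_closed\<close>)
  have letter: "?q [a] \<otimes>\<^bsub>?T\<^esub> k \<otimes>\<^bsub>?T\<^esub> inv\<^bsub>?T\<^esub> ?q [a] \<in> ?X" if a: "a \<in> UNIV \<times> ?S" and k: "k \<in> ?X" for a k
  proof -
    obtain x where x: "x \<in> carrier G" "k = tensor G x x" using k by blast
    obtain b g h where bgh: "a = (b, (g, h))" "g \<in> carrier G" "h \<in> carrier G" using a by auto
    let ?t = "tensor G g h"
    have t: "?t \<in> carrier ?T" using bgh by (simp add: tensor_closed)
    have kc: "k \<in> carrier ?T" using k X by blast
    show ?thesis
    proof (cases b)
      case True
      define y where "y = conj_act G (inv (h \<otimes> g)) x"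
      have y: "y \<in> carrier G" "conj_act G (h \<otimes> g) y = x"
        using x bgh by (simp add: y_def) (use x bgh in \<open>simp add: y_def conj_act_conj_act, simp add: conj_act_def\<close>)
      let ?z = "conj_act G (g \<otimes> h) y"
      have z: "?z \<in> carrier G" using y bgh by simp
      have "tensor G ?z ?z \<otimes>\<^bsub>?T\<^esub> ?t = ?t \<otimes>\<^bsub>?T\<^esub> k"
        using tensor_conj[of g h y y] y bgh x by simp
      then have "?t \<otimes>\<^bsub>?T\<^esub> k \<otimes>\<^bsub>?T\<^esub> inv\<^bsub>?T\<^esub> ?t = tensor G ?z ?z"
        using t tensor_closed[OF z z] by (simp add: T.m_assoc flip: \<open>_ = ?t \<otimes>\<^bsub>?T\<^esub> k\<close>)
      moreover have "?q [a] = ?t" using True bgh(1) by (simp add: tensor_def)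
      ultimately have "?q [a] \<otimes>\<^bsub>?T\<^esub> k \<otimes>\<^bsub>?T\<^esub> inv\<^bsub>?T\<^esub> ?q [a] = tensor G ?z ?z" by (simp only:)
      with z show ?thesis by blast
    next
      case False
      define y where "y = conj_act G (inv (g \<otimes> h)) x"
      have y: "y \<in> carrier G" "conj_act G (g \<otimes> h) y = x"
        using x bgh by (simp add: y_def) (use x bgh in \<open>simp add: y_def conj_act_conj_act, simp add: conj_act_def\<close>)
      let ?z = "conj_act G (h \<otimes> g) y"
      have z: "?z \<in> carrier G" using y bgh by simp
      have "k \<otimes>\<^bsub>?T\<^esub> ?t = ?t \<otimes>\<^bsub>?T\<^esub> tensor G ?z ?z"
        using tensor_conj[of g h y y] y bgh x by simp
      then have "inv\<^bsub>?T\<^esub> ?t \<otimes>\<^bsub>?T\<^esub> k \<otimes>\<^bsub>?T\<^esub> ?t = tensor G ?z ?z"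
        using t tensor_closed[OF z z] kc by (simp add: T.m_assoc T.inv_mult_cancel)
      moreover have "?q [a] = inv\<^bsub>?T\<^esub> ?t" using False bgh inv_letter by simp
      ultimately have "?q [a] \<otimes>\<^bsub>?T\<^esub> k \<otimes>\<^bsub>?T\<^esub> inv\<^bsub>?T\<^esub> ?q [a] = tensor G ?z ?z"
        using t by (simp only: T.inv_inv)
      with z show ?thesis by blast
    qed
  qed
  have word: "\<forall>k\<in>?X. ?q w \<otimes>\<^bsub>?T\<^esub> k \<otimes>\<^bsub>?T\<^esub> inv\<^bsub>?T\<^esub> ?q w \<in> ?X" if "w \<in> lists (UNIV \<times> ?S)" for w
    using that
  proof (induction w)
    case Nil
    have "?q [] = \<one>\<^bsub>?T\<^esub>" by (simp add: tensor_square_def one_presented_group)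
    moreover have "\<one>\<^bsub>?T\<^esub> \<otimes>\<^bsub>?T\<^esub> k \<otimes>\<^bsub>?T\<^esub> inv\<^bsub>?T\<^esub> \<one>\<^bsub>?T\<^esub> = k" if "k \<in> ?X" for k
      using subsetD[OF X that] by simp
    ultimately show ?case by (intro ballI) (simp only:)
  next
    case (Cons a w)
    have a: "[a] \<in> lists (UNIV \<times> ?S)" using Cons.hyps(1) by simp
    have q: "?q [a] \<in> carrier ?T" "?q w \<in> carrier ?T"
      unfolding tensor_square_def carrier_presented_group by (rule imageI[OF a], rule imageI[OF Cons.hyps(2)])
    have e: "?q (a # w) = ?q [a] \<otimes>\<^bsub>?T\<^esub> ?q w"
      unfolding tensor_square_def presented_group_mult[OF a Cons.hyps(2)] by simp
    show ?case
    proof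
      fix k assume k: "k \<in> ?X"
      with X have kc: "k \<in> carrier ?T" by blast
      have "?q [a] \<otimes>\<^bsub>?T\<^esub> (?q w \<otimes>\<^bsub>?T\<^esub> k \<otimes>\<^bsub>?T\<^esub> inv\<^bsub>?T\<^esub> ?q w) \<otimes>\<^bsub>?T\<^esub> inv\<^bsub>?T\<^esub> ?q [a] \<in> ?X"
        using bspec[OF Cons.IH k] by (rule letter[OF Cons.hyps(1)])
      also have "?q [a] \<otimes>\<^bsub>?T\<^esub> (?q w \<otimes>\<^bsub>?T\<^esub> k \<otimes>\<^bsub>?T\<^esub> inv\<^bsub>?T\<^esub> ?q w) \<otimes>\<^bsub>?T\<^esub> inv\<^bsub>?T\<^esub> ?q [a]
        = ?q (a # w) \<otimes>\<^bsub>?T\<^esub> k \<otimes>\<^bsub>?T\<^esub> inv\<^bsub>?T\<^esub> ?q (a # w)"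
        unfolding e using q kc by (simp add: T.inv_mult_group T.m_assoc)
      finally show "?q (a # w) \<otimes>\<^bsub>?T\<^esub> k \<otimes>\<^bsub>?T\<^esub> inv\<^bsub>?T\<^esub> ?q (a # w) \<in> ?X" .
    qed
  qed
  have "g \<otimes>\<^bsub>?T\<^esub> k \<otimes>\<^bsub>?T\<^esub> inv\<^bsub>?T\<^esub> g \<in> ?X" if k: "k \<in> ?X" and g: "g \<in> carrier ?T" for g k
  proof -
    obtain w where "w \<in> lists (UNIV \<times> ?S)" "g = ?q w"
      using g unfolding tensor_square_def carrier_presented_group by (rule imageE)
    with bspec[OF word k] show ?thesis by (simp only:)
  qed
  with X show ?thesis
    unfolding nabla_def by (intro T.normal_generateI)
qed

lemma (in group) group_exterior_square: "group (exterior_square G)"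
  unfolding exterior_square_def by (rule normal.factorgroup_is_group[OF nabla_normal])


section \<open>Schur multiplier\<close>

text \<open>$H_2(G,\mathbb{Z})$ for the trivial module $\mathbb{Z}$, computed from the inhomogeneous
  (unnormalised) bar complex, whose group of $n$-chains is free abelian on $G^n$.\<close>

definition bar_boundary2 ::
    "('a, 'b) monoid_scheme \<Rightarrow> ('a \<times> 'a \<Rightarrow>\<^sub>0 int) \<Rightarrow> ('a \<Rightarrow>\<^sub>0 int)" where
  "bar_boundary2 G =
     frag_extend (\<lambda>(g, h). frag_of h - frag_of (g \<otimes>\<^bsub>G\<^esub> h) + frag_of g)"

definition bar_boundary3 ::
    "('a, 'b) monoid_scheme \<Rightarrow> ('a \<times> 'a \<times> 'a \<Rightarrow>\<^sub>0 int) \<Rightarrow> ('a \<times> 'a \<Rightarrow>\<^sub>0 int)" where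
  "bar_boundary3 G =
     frag_extend (\<lambda>(g, h, k). frag_of (h, k) - frag_of (g \<otimes>\<^bsub>G\<^esub> h, k)
                              + frag_of (g, h \<otimes>\<^bsub>G\<^esub> k) - frag_of (g, h))"

definition bar_cycles2 :: "('a, 'b) monoid_scheme \<Rightarrow> ('a \<times> 'a \<Rightarrow>\<^sub>0 int) set" where
  "bar_cycles2 G =
     {c \<in> carrier (free_Abelian_group (carrier G \<times> carrier G)). bar_boundary2 G c = 0}"

definition bar_boundaries2 :: "('a, 'b) monoid_scheme \<Rightarrow> ('a \<times> 'a \<Rightarrow>\<^sub>0 int) set" where
  "bar_boundaries2 G =
     bar_boundary3 G ` carrier (free_Abelian_group (carrier G \<times> carrier G \<times> carrier G))"

definition schur_multiplier :: "('a, 'b) monoid_scheme \<Rightarrow> ('a \<times> 'a \<Rightarrow>\<^sub>0 int) set monoid" where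
  "schur_multiplier G =
     subgroup_generated (free_Abelian_group (carrier G \<times> carrier G)) (bar_cycles2 G)
       Mod bar_boundaries2 G"

lemma subgroup_bar_cycles2:
  "subgroup (bar_cycles2 G) (free_Abelian_group (carrier G \<times> carrier G))"
proof (rule group.subgroupI[OF group_free_Abelian_group])
  show "bar_cycles2 G \<noteq> {}"
  proof -
    have "0 \<in> bar_cycles2 G" by (simp add: bar_cycles2_def bar_boundary2_def)
    then show ?thesis by blast
  qed
qed (auto simp: bar_cycles2_def bar_boundary2_def frag_extend_minus frag_extend_add
       dest: subsetD[OF keys_add])

lemma carrier_bar_cycles2:
  "carrier (subgroup_generated (free_Abelian_group (carrier G \<times> carrier G)) (bar_cycles2 G))
    = bar_cycles2 G"
  using subgroup_bar_cycles2 by (rule subgroup.carrier_subgroup_generated_subgroup)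

lemma (in group) bar_boundary2_boundary3:
  assumes "Poly_Mapping.keys c \<subseteq> carrier G \<times> carrier G \<times> carrier G"
  shows "bar_boundary2 G (bar_boundary3 G c) = 0"
proof (rule free_Abelian_group_induct[OF assms])
  fix a assume "a \<in> carrier G \<times> carrier G \<times> carrier G"
  then show "bar_boundary2 G (bar_boundary3 G (frag_of a)) = 0"
    by (auto simp: bar_boundary2_def bar_boundary3_def frag_extend_add frag_extend_diff m_assoc)
qed (simp_all add: bar_boundary2_def bar_boundary3_def frag_extend_diff)

lemma (in group) bar_boundaries2_subset: "bar_boundaries2 G \<subseteq> bar_cycles2 G"
proof
  fix z assume "z \<in> bar_boundaries2 G"
  then obtain c where c: "z = bar_boundary3 G c"
    "Poly_Mapping.keys c \<subseteq> carrier G \<times> carrier G \<times> carrier G"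
    by (auto simp: bar_boundaries2_def)
  have "Poly_Mapping.keys (bar_boundary3 G c) \<subseteq> carrier G \<times> carrier G"
  proof (rule free_Abelian_group_induct[OF c(2)])
    fix x y
    assume "Poly_Mapping.keys (bar_boundary3 G x) \<subseteq> carrier G \<times> carrier G"
      "Poly_Mapping.keys (bar_boundary3 G y) \<subseteq> carrier G \<times> carrier G"
    then show "Poly_Mapping.keys (bar_boundary3 G (x - y)) \<subseteq> carrier G \<times> carrier G"
      using keys_diff[of "bar_boundary3 G x" "bar_boundary3 G y"]
      by (auto simp: bar_boundary3_def frag_extend_diff)
  next
    fix a assume *: "a \<in> carrier G \<times> carrier G \<times> carrier G"
    obtain g h k where a: "a = (g, h, k)" by (cases a)
    show "Poly_Mapping.keys (bar_boundary3 G (frag_of a)) \<subseteq> carrier G \<times> carrier G"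
      using * unfolding a bar_boundary3_def
      by (auto simp: keys_frag_of dest!: subsetD[OF keys_add] subsetD[OF keys_diff])
  qed (simp add: bar_boundary3_def)
  then show "z \<in> bar_cycles2 G"
    using c bar_boundary2_boundary3 by (simp add: bar_cycles2_def)
qed

lemma (in group) comm_group_schur_multiplier: "comm_group (schur_multiplier G)"
proof -
  let ?F = "free_Abelian_group (carrier G \<times> carrier G)"
  let ?Z = "subgroup_generated ?F (bar_cycles2 G)"
  have Z: "comm_group ?Z"
    by (rule group.abelian_subgroup_generated[OF group_free_Abelian_group abelian_free_Abelian_group])
  have "subgroup (bar_boundaries2 G) ?F"
  proof (rule group.subgroupI[OF group_free_Abelian_group])
    show sub: "bar_boundaries2 G \<subseteq> carrier ?F"
      using bar_boundaries2_subset by (auto simp: bar_cycles2_def)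
    have "bar_boundary3 G 0 \<in> bar_boundaries2 G"
      unfolding bar_boundaries2_def by (rule imageI) simp
    then show "bar_boundaries2 G \<noteq> {}" by blast
    let ?C = "carrier (free_Abelian_group (carrier G \<times> carrier G \<times> carrier G))"
    fix a assume a: "a \<in> bar_boundaries2 G"
    then obtain c where c: "c \<in> ?C" "a = bar_boundary3 G c"
      unfolding bar_boundaries2_def by blast
    have "inv\<^bsub>?F\<^esub> a = bar_boundary3 G (- c)"
      using subsetD[OF sub a] c(2) by (simp add: bar_boundary3_def frag_extend_minus)
    moreover have "- c \<in> ?C" using c(1) by simp
    ultimately show "inv\<^bsub>?F\<^esub> a \<in> bar_boundaries2 G"
      unfolding bar_boundaries2_def by blast
    fix b assume "b \<in> bar_boundaries2 G"
    then obtain d where d: "d \<in> ?C" "b = bar_boundary3 G d"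
      unfolding bar_boundaries2_def by blast
    have "a \<otimes>\<^bsub>?F\<^esub> b = bar_boundary3 G (c + d)"
      using c d by (simp add: bar_boundary3_def frag_extend_add)
    moreover have "c + d \<in> ?C"
      using c(1) d(1) keys_add[of c d] by auto
    ultimately show "a \<otimes>\<^bsub>?F\<^esub> b \<in> bar_boundaries2 G"
      unfolding bar_boundaries2_def by blast
  qed
  then have "subgroup (bar_boundaries2 G) ?Z"
    using bar_boundaries2_subset subgroup_bar_cycles2
    by (simp add: group.subgroup_subgroup_generated_iff carrier_bar_cycles2)
  with Z show ?thesis
    unfolding schur_multiplier_def by (rule comm_group.abelian_FactGroup)
qed

end

theory Submission
  imports Defs "HOL-Algebra.Zassenhaus" "HOL-Algebra.Multiplicative_Group"
begin

text \<open>
  The bound already holds for the tensor square \<open>T = G \<otimes> G\<close>. Inside the semidirect product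
  \<open>S = T \<rtimes> G\<close> one has \<open>[t, g] = \<partial>t \<otimes> g\<close> and
  \<open>x\<^sup>n \<otimes> y = x\<^sup>n (x\<^sup>-\<^sup>1 (x \<otimes> y))\<^sup>n\<close>, so that the symbols \<open>x \<otimes> y\<close> behave like commutators.
  Let \<open>H\<^sub>k\<close> be generated by all \<open>x \<otimes> y\<close> with \<open>x\<close> a \<open>p\<^sup>k\<close>-th power. The Hall--Petrescu formula
  for the exponent \<open>p\<close> compares \<open>H\<^sub>k\<^sub>+\<^sub>1\<close> with \<open>H\<^sub>k\<^sup>p\<close> up to \<open>[H\<^sub>k, S, \<dots>, S]\<close> with \<open>p - 1\<close> entries \<open>S\<close>.
  Both hypotheses imply that this error lies in \<open>K\<^sup>p [K, S]\<close>, where \<open>K = H\<^sub>k\<^sup>p\<close>: for \<open>k = 0\<close>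
  because \<open>[T, S, \<dots>, S] \<subseteq> \<gamma>\<^sub>i(G) \<otimes> G\<close>, and from \<open>k\<close> to \<open>k + 1\<close> by a Frattini argument. Hence
  \<open>H\<^sub>k\<^sub>+\<^sub>1 = H\<^sub>k\<^sup>p\<close> for all \<open>k\<close>, and \<open>G\<close> having exponent \<open>p\<^sup>n\<close> gives \<open>H\<^sub>n = 1\<close>, so that \<open>T\<close> has exponent
  dividing \<open>p\<^sup>n\<close>.

  The universal 2-cocycle, with values in the 2-chains modulo boundaries, defines a central
  extension \<open>E\<close> of \<open>G\<close>. Its commutator pairing factors through \<open>T\<close>, and \<open>[E, E]\<close> contains the
  Schur multiplier.
\<close>

section \<open>Polynomial sequences in filtered groups\<close>

text \<open>Powers are raised one factor \<open>p\<close> at a time because \<open>p\<close> divides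
  every \<open>p choose m\<close> with \<open>0 < m < p\<close>, while \<open>p^k choose p\<close>
  is divisible only by \<open>p^(k-1)\<close>, too little for a direct comparison at
  \<open>p^k\<close>. The price is that commutation and \<open>p\<close>-th powers must be exchanged
  again and again, each exchange leaving an error. The number \<open>p - 1\<close> of entries has a
  specific source. A symbol with first entry \<open>g\<close> is not literally a commutator with
  \<open>g\<close>; only the product \<open>g^p (g^-1 t)^p\<close> is available, with
  \<open>t\<close> in \<open>H\<close> and \<open>g\<close> outside. It lives in the subgroup
  generated by \<open>g\<close> and \<open>H\<close>. As \<open>g\<close> commutes with itself, all
  commutators of that subgroup lie in \<open>[H, S]\<close>, so a term of weight \<open>m\<close> is
  already an \<open>(m - 1)\<close>-fold commutator of \<open>H\<close>. Condition (i) puts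
  \<open>p - 2\<close> commutations of \<open>T\<close> into \<open>H_1\<close>, and (ii) puts
  \<open>p - 1\<close> of them into \<open>H_2\<close>. Neither is a statement about
  \<open>K^p [K, S]\<close>, since \<open>H_1\<close> and \<open>H_2\<close> are known only up to
  the very error to be bounded. The circle is broken by nilpotency: an error that reappears inside
  its own \<open>A^p [A, S]\<close> can be discarded.\<close>

definition (in group) commutator :: "'a \<Rightarrow> 'a \<Rightarrow> 'a" where
  "commutator x y = x \<otimes> y \<otimes> inv x \<otimes> inv y"

lemma (in group) commutator_closed [simp, intro]:
  "\<lbrakk>x \<in> carrier G; y \<in> carrier G\<rbrakk> \<Longrightarrow> commutator x y \<in> carrier G"
  by (simp add: commutator_def)

lemma (in group) mult_inv_cancel: "\<lbrakk>g \<in> carrier G; x \<in> carrier G\<rbrakk> \<Longrightarrow> g \<otimes> (inv g \<otimes> x) = x"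
  by (simp flip: m_assoc)

lemmas (in group) group_word_simps = m_assoc inv_mult_group inv_mult_cancel mult_inv_cancel

locale group_filtration = group G for G (structure) +
  fixes F :: "nat \<Rightarrow> 'a set"
  assumes subgroup_filtration: "subgroup (F i) G"
    and filtration_Suc: "F (Suc i) \<subseteq> F i"
    and filtration_commutator: "\<lbrakk>x \<in> F i; y \<in> F j\<rbrakk> \<Longrightarrow> commutator x y \<in> F (i + j)"
begin

lemma filtration_carrier: "x \<in> F i \<Longrightarrow> x \<in> carrier G"
  by (meson subgroup.mem_carrier subgroup_filtration)

lemmas filtration_mult = subgroup.m_closed[OF subgroup_filtration]
lemmas filtration_inv = subgroup.m_inv_closed[OF subgroup_filtration]
lemmas filtration_one = subgroup.one_closed[OF subgroup_filtration]

definition diff_seq :: "(nat \<Rightarrow> 'a) \<Rightarrow> nat \<Rightarrow> 'a" where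
  "diff_seq f n = f (Suc n) \<otimes> inv (f n)"

text \<open>\<open>poly_seq k d f\<close>: for all \<open>j \<le> k\<close>, the \<open>j\<close>-th difference of \<open>f\<close> has values in \<open>F (d + j)\<close>.\<close>

primrec poly_seq :: "nat \<Rightarrow> nat \<Rightarrow> (nat \<Rightarrow> 'a) \<Rightarrow> bool" where
  "poly_seq 0 d f = (\<forall>n. f n \<in> F d)"
| "poly_seq (Suc k) d f = ((\<forall>n. f n \<in> F d) \<and> poly_seq k (Suc d) (diff_seq f))"

lemma poly_seq_value: "poly_seq k d f \<Longrightarrow> f n \<in> F d"
  by (cases k) auto

lemma poly_seq_carrier: "poly_seq k d f \<Longrightarrow> f n \<in> carrier G"
  using poly_seq_value filtration_carrier by blast

lemma poly_seq_Suc_weaken: "poly_seq (Suc k) d f \<Longrightarrow> poly_seq k d f"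
  by (induction k arbitrary: d f) auto

lemma poly_seq_shift: "poly_seq k (Suc d) f \<Longrightarrow> poly_seq k d f"
proof (induction k arbitrary: d f)
  case (Suc k)
  then show ?case using subsetD[OF filtration_Suc[of d]] by auto
qed (use filtration_Suc in auto)

lemma poly_seq_shift_add: "poly_seq k (d + m) f \<Longrightarrow> poly_seq k d f"
  by (induction m) (auto intro: poly_seq_shift)

text \<open>The Lazard--Leibman theorem. The three closure properties have to be proved together:
  the \<open>k\<close>-th level of each enters the next level of all of them.\<close>

lemma poly_seq_closed:
  "(\<forall>d f h. poly_seq k d f \<longrightarrow> poly_seq k d h \<longrightarrow> poly_seq k d (\<lambda>n. f n \<otimes> h n)) \<and>
   (\<forall>d f. poly_seq k d f \<longrightarrow> poly_seq k d (\<lambda>n. inv f n)) \<and>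
   (\<forall>d e f h. poly_seq k d f \<longrightarrow> poly_seq k e h \<longrightarrow> poly_seq k (d + e) (\<lambda>n. commutator (f n) (h n)))"
proof (induction k)
  case 0
  then show ?case by (auto intro: filtration_mult filtration_inv filtration_commutator)
next
  case (Suc k)
  have mul: "poly_seq k d (\<lambda>n. f n \<otimes> h n)" if "poly_seq k d f" "poly_seq k d h" for d f h
    using Suc that by blast
  have inve: "poly_seq k d (\<lambda>n. inv f n)" if "poly_seq k d f" for d f
    using Suc that by blast
  have comm: "poly_seq k (d + e) (\<lambda>n. commutator (f n) (h n))"
    if "poly_seq k d f" "poly_seq k e h" for d e f h
    using Suc that by blast
  \<comment> \<open>A conjugate is \<open>[f, h] h\<close>, and the commutator lies \<open>e\<close>
    levels deeper than required, whatever \<open>e\<close> is.\<close>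
  have conj: "poly_seq k d (\<lambda>n. f n \<otimes> h n \<otimes> inv (f n))" if f: "poly_seq k e f" and h: "poly_seq k d h" for d e f h
  proof -
    have "poly_seq k d (\<lambda>n. commutator (f n) (h n))"
      using comm[OF f h] by (metis add.commute poly_seq_shift_add)
    from mul[OF this h] show ?thesis
      using poly_seq_carrier[OF f] poly_seq_carrier[OF h]
      by (simp add: commutator_def group_word_simps)
  qed
  show ?case
  proof (intro conjI allI impI)
    fix d f h assume fh: "poly_seq (Suc k) d f" "poly_seq (Suc k) d h"
    then have c: "f n \<in> carrier G" "h n \<in> carrier G" for n by (simp_all only: poly_seq_carrier)
    have "poly_seq k (Suc d) (\<lambda>n. diff_seq f n \<otimes> (f n \<otimes> diff_seq h n \<otimes> inv (f n)))"
      using fh poly_seq_Suc_weaken[OF fh(1)] by (intro mul conj) auto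
    moreover have "(\<lambda>n. diff_seq f n \<otimes> (f n \<otimes> diff_seq h n \<otimes> inv (f n))) = diff_seq (\<lambda>n. f n \<otimes> h n)"
      using c by (simp add: fun_eq_iff diff_seq_def group_word_simps)
    ultimately show "poly_seq (Suc k) d (\<lambda>n. f n \<otimes> h n)"
      using fh by (auto intro: filtration_mult)
  next
    fix d f assume f: "poly_seq (Suc k) d f"
    then have c: "f n \<in> carrier G" for n by (rule poly_seq_carrier)
    have "poly_seq k (Suc d) (\<lambda>n. inv (f n) \<otimes> inv (diff_seq f n) \<otimes> inv (inv (f n)))"
      using f by (intro conj[OF inve[OF poly_seq_Suc_weaken[OF f]]] inve) auto
    moreover have "(\<lambda>n. inv (f n) \<otimes> inv (diff_seq f n) \<otimes> inv (inv (f n))) = diff_seq (\<lambda>n. inv f n)"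
      using c by (simp add: fun_eq_iff diff_seq_def group_word_simps)
    ultimately show "poly_seq (Suc k) d (\<lambda>n. inv f n)"
      using f by (auto intro: filtration_inv)
  next
    fix d e f h assume f: "poly_seq (Suc k) d f" and h: "poly_seq (Suc k) e h"
    note f' = poly_seq_Suc_weaken[OF f] and h' = poly_seq_Suc_weaken[OF h]
    have c: "f n \<in> carrier G" "h n \<in> carrier G" for n
      using f h by (simp_all only: poly_seq_carrier)
    let ?a = "diff_seq f" and ?b = "diff_seq h"
    have a: "poly_seq k (Suc d) ?a" and b: "poly_seq k (Suc e) ?b"
      using f h by auto
    have ac: "?a n \<in> carrier G" "?b n \<in> carrier G" for n
      using c by (simp_all add: diff_seq_def)
    have ab: "poly_seq k 1 (\<lambda>n. ?a n \<otimes> ?b n)"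
      using a b poly_seq_shift_add[of k 1 d] poly_seq_shift_add[of k 1 e] by (intro mul) auto
    let ?c = "\<lambda>n. commutator (f n) (h n)"
    have cc: "poly_seq k (d + e) ?c" using comm[OF f' h'] .
    have 1: "poly_seq k (Suc (d + e)) (\<lambda>n. commutator (f n) (?b n))" using comm[OF f' b] by simp
    have 2: "poly_seq k (Suc (d + e)) (\<lambda>n. commutator (?a n \<otimes> ?b n) (?c n))" using comm[OF ab cc] by simp
    have 3: "poly_seq k (Suc (d + e)) (\<lambda>n. commutator (?a n) (?b n))"
      using comm[OF a b] by (auto intro: poly_seq_shift)
    have 4: "poly_seq k (Suc (d + e)) (\<lambda>n. commutator (?a n) (h n))" using comm[OF a h'] by simp
    \<comment> \<open>The expansion of \<open>[a f, b h] [f, h]^-1\<close>. Every basic commutator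
      in it has a difference \<open>a\<close> or \<open>b\<close> as an entry, so all lie one level
      deeper than \<open>d + e\<close>.\<close>
    let ?p = "\<lambda>n. (?a n \<otimes> commutator (f n) (?b n) \<otimes> inv (?a n)) \<otimes> (commutator (?a n \<otimes> ?b n) (?c n)
      \<otimes> (?c n \<otimes> (commutator (?a n) (?b n) \<otimes> (?b n \<otimes> commutator (?a n) (h n) \<otimes> inv (?b n))) \<otimes> inv (?c n)))"
    have "poly_seq k (Suc (d + e)) ?p"
      by (intro mul conj[OF a] conj[OF b] conj[OF cc] 1 2 3 4)
    moreover have "?p = diff_seq ?c"
    proof
      fix n
      have e: "f (Suc n) = ?a n \<otimes> f n" "h (Suc n) = ?b n \<otimes> h n"
        using c by (simp_all add: diff_seq_def m_assoc)
      have "diff_seq ?c n = commutator (?a n \<otimes> f n) (?b n \<otimes> h n) \<otimes> inv (?c n)"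
        unfolding diff_seq_def[of ?c] e ..
      then show "?p n = diff_seq ?c n"
        using c[of n] ac[of n] by (simp add: commutator_def group_word_simps)
    qed
    ultimately show "poly_seq (Suc k) (d + e) ?c"
      using f h by (auto intro: filtration_commutator)
  qed
qed

lemma poly_seq_mult: "\<lbrakk>poly_seq k d f; poly_seq k d h\<rbrakk> \<Longrightarrow> poly_seq k d (\<lambda>n. f n \<otimes> h n)"
  using poly_seq_closed by blast

lemma poly_seq_inv: "poly_seq k d f \<Longrightarrow> poly_seq k d (\<lambda>n. inv f n)"
  using poly_seq_closed by blast

lemma poly_seq_one: "poly_seq k d (\<lambda>n. \<one>)"
proof (induction k arbitrary: d)
  case (Suc k)
  moreover have "diff_seq (\<lambda>n. \<one>) = (\<lambda>n. \<one>)" by (simp add: fun_eq_iff diff_seq_def)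
  ultimately show ?case by (simp add: filtration_one)
qed (simp add: filtration_one)

lemma filtration_pow: "x \<in> F i \<Longrightarrow> x [^] (n::nat) \<in> F i"
  by (induction n) (auto intro: filtration_one filtration_mult)

lemma filtration_antimono: "i \<le> j \<Longrightarrow> F j \<subseteq> F i"
  by (rule lift_Suc_antimono_le[of F]) (use filtration_Suc in auto)

text \<open>By Pascal's rule a difference lowers \<open>i\<close> by one while the required level
  \<open>d\<close> rises by one, so the condition \<open>i + d \<le> m\<close> is invariant.\<close>

lemma poly_seq_binomial:
  "\<lbrakk>a \<in> F m; i + d \<le> m\<rbrakk> \<Longrightarrow> poly_seq k d (\<lambda>n. a [^] (n choose i))"
proof (induction k arbitrary: i d)
  case 0
  then have "a \<in> F d" using filtration_antimono[of d m] by auto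
  then show ?case by (simp add: filtration_pow)
next
  case (Suc k)
  then have a: "a \<in> F d" "a \<in> carrier G"
    using filtration_antimono[of d m] filtration_carrier by auto
  have "poly_seq k (Suc d) (diff_seq (\<lambda>n. a [^] (n choose i)))"
  proof (cases i)
    case 0
    have "diff_seq (\<lambda>n. a [^] (n choose i)) = (\<lambda>n. \<one>)"
      using a 0 by (simp add: fun_eq_iff diff_seq_def)
    then show ?thesis by (simp add: poly_seq_one)
  next
    case i: (Suc j)
    have "diff_seq (\<lambda>n. a [^] (n choose i)) = (\<lambda>n. a [^] (n choose j))"
      using a by (simp add: i fun_eq_iff diff_seq_def m_assoc flip: nat_pow_mult)
    with Suc.IH[of j "Suc d"] Suc.prems i show ?thesis by simp
  qed
  with a show ?case by (simp add: filtration_pow)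
qed

text \<open>Reads \<open>a [^] n\<close> as \<open>a [^] (n choose 1)\<close>. Degree one asks for a
  base in \<open>F 1\<close>, which is why the filtrations used later repeat their top term.\<close>

lemma poly_seq_power: "\<lbrakk>F 0 = F 1; a \<in> F 0\<rbrakk> \<Longrightarrow> poly_seq k 0 (\<lambda>n. a [^] n)"
  using poly_seq_binomial[of a 1 1 0 k] by simp

text \<open>If all earlier values are trivial, the \<open>m\<close>-th difference at 0 collapses to
  \<open>f m\<close>, the leading Taylor coefficient.\<close>

lemma poly_seq_first_value:
  "\<lbrakk>poly_seq k d f; m \<le> k; \<And>n. n < m \<Longrightarrow> f n = \<one>\<rbrakk> \<Longrightarrow> f m \<in> F (d + m)"
proof (induction m arbitrary: k d f)
  case 0
  then show ?case using poly_seq_value by auto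
next
  case (Suc m)
  then obtain k' where k: "k = Suc k'" "m \<le> k'" by (cases k) auto
  have c: "f n \<in> carrier G" for n using Suc.prems(1) by (rule poly_seq_carrier)
  have "diff_seq f m \<in> F (Suc d + m)"
  proof (rule Suc.IH[of k'])
    show "diff_seq f n = \<one>" if "n < m" for n
      using that Suc.prems(3) by (simp add: diff_seq_def)
  qed (use Suc.prems k in auto)
  moreover have "diff_seq f m = f (Suc m)"
    using Suc.prems(3) c by (simp add: diff_seq_def)
  ultimately show ?case by simp
qed

text \<open>A form of the Hall--Petrescu formula: the discrete Taylor coefficients of \<open>f\<close> are split off
  one at a time, and \<open>p\<close> divides \<open>p choose m\<close> for \<open>0 < m < p\<close>.\<close>

lemma poly_seq_prime_value:
  assumes p: "Factorial_Ring.prime (p::nat)" and R: "subgroup R G" and Fp: "F p \<subseteq> R"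
    and F2: "\<And>x. x \<in> F 2 \<Longrightarrow> x [^] p \<in> R"
  shows "\<lbrakk>2 \<le> m; m \<le> p; poly_seq p 0 f; \<And>n. n < m \<Longrightarrow> f n = \<one>\<rbrakk> \<Longrightarrow> f p \<in> R"
proof (induction "p - m" arbitrary: m f)
  case 0
  then have "f p \<in> F (0 + p)" by (intro poly_seq_first_value) auto
  with Fp show ?case by auto
next
  case (Suc k)
  then have m: "m < p" by simp
  have am: "f m \<in> F m"
    using poly_seq_first_value[OF Suc.prems(3), of m] Suc.prems m by simp
  have a: "f m \<in> carrier G" using am by (rule filtration_carrier)
  have c: "f n \<in> carrier G" for n using Suc.prems(3) by (rule poly_seq_carrier)
  let ?h = "\<lambda>n. inv (f m [^] (n choose m)) \<otimes> f n"
  have "poly_seq p 0 ?h"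
    using am Suc.prems(3) by (intro poly_seq_mult poly_seq_inv poly_seq_binomial[of _ m]) auto
  moreover have "?h n = \<one>" if "n < Suc m" for n
    using that Suc.prems(4) c by (cases "n = m") (auto simp: binomial_eq_0)
  ultimately have h: "?h p \<in> R"
    using Suc.hyps m Suc.prems(1) by (intro Suc.hyps(1)[of "Suc m"]) auto
  have "p dvd (p choose m)"
    using p m Suc.prems(1) by (intro dvd_choose_prime) auto
  then obtain q where q: "p choose m = q * p" by (metis dvd_def mult.commute)
  \<comment> \<open>Here \<open>2 \<le> m\<close> is used: \<open>p\<close>-th powers are known to
    fall into \<open>R\<close> only on \<open>F 2\<close>.\<close>
  have "f m \<in> F 2" using am filtration_antimono[OF Suc.prems(1)] by auto
  then have "(f m [^] q) [^] p \<in> R" by (intro F2 filtration_pow)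
  then have "f m [^] (p choose m) \<in> R"
    using a by (simp add: q nat_pow_pow)
  from subgroup.m_closed[OF R this h] show ?case
    using c by (simp add: mult_inv_cancel)
qed

end

section \<open>Calculus of normal subgroups\<close>

context group
begin

section \<open>Commutation with the whole group\<close>

abbreviation gcomm :: "'a set \<Rightarrow> 'a set" where
  "gcomm \<equiv> commutator_subgroup G (carrier G)"

definition agemo :: "nat \<Rightarrow> 'a set \<Rightarrow> 'a set" where
  "agemo q H = generate G {x [^] q | x. x \<in> H}"

lemma normal_carrier: "N \<lhd> G \<Longrightarrow> N \<subseteq> carrier G"
  by (simp add: normal_imp_subgroup subgroup.subset)

lemma normal_conj: "\<lbrakk>N \<lhd> G; x \<in> carrier G; h \<in> N\<rbrakk> \<Longrightarrow> x \<otimes> h \<otimes> inv x \<in> N"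
  by (simp add: normal.inv_op_closed2)

lemmas normal_mult = subgroup.m_closed[OF normal_imp_subgroup]
lemmas normal_inv = subgroup.m_inv_closed[OF normal_imp_subgroup]
lemmas normal_one = subgroup.one_closed[OF normal_imp_subgroup]

lemma inv_commutator:
  "\<lbrakk>x \<in> carrier G; y \<in> carrier G\<rbrakk> \<Longrightarrow> inv (commutator x y) = commutator y x"
  by (simp add: commutator_def group_word_simps)

lemma conj_commutator:
  "\<lbrakk>g \<in> carrier G; x \<in> carrier G; y \<in> carrier G\<rbrakk> \<Longrightarrow>
    g \<otimes> commutator x y \<otimes> inv g = commutator (g \<otimes> x \<otimes> inv g) (g \<otimes> y \<otimes> inv g)"
  by (simp add: commutator_def group_word_simps)

lemma conj_pow:
  "\<lbrakk>g \<in> carrier G; x \<in> carrier G\<rbrakk> \<Longrightarrow> (g \<otimes> x \<otimes> inv g) [^] (n::nat) = g \<otimes> x [^] n \<otimes> inv g"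
  by (induction n) (simp_all add: group_word_simps)

lemma commutator_sym_mem:
  assumes "subgroup R G" "x \<in> carrier G" "y \<in> carrier G" "commutator x y \<in> R"
  shows "commutator y x \<in> R"
  using subgroup.m_inv_closed[OF assms(1,4)] assms by (simp add: inv_commutator)

text \<open>Modulo the normal subgroup \<open>R\<close> the centraliser of \<open>x\<close> is a
  subgroup, so generators suffice.\<close>

lemma generate_commutator_right:
  assumes R: "R \<lhd> G" and Y: "Y \<subseteq> carrier G" and x: "x \<in> carrier G"
    and XY: "\<And>y. y \<in> Y \<Longrightarrow> commutator x y \<in> R"
    and y: "y \<in> generate G Y"
  shows "commutator x y \<in> R"
  using y
proof (induction rule: generate.induct)
  case one
  then show ?case using x normal_one[OF R] by (simp add: commutator_def)
next
  case (incl h)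
  then show ?case by (rule XY)
next
  case (inv h)
  then have h: "h \<in> carrier G" using Y by auto
  have "inv h \<otimes> inv (commutator x h) \<otimes> inv (inv h) \<in> R"
    using h XY[OF inv] by (intro normal_conj[OF R] normal_inv[OF R]) auto
  also have "inv h \<otimes> inv (commutator x h) \<otimes> inv (inv h) = commutator x (inv h)"
    using h x by (simp add: commutator_def group_word_simps)
  finally show ?case .
next
  case (eng h1 h2)
  then have h: "h1 \<in> carrier G" "h2 \<in> carrier G" using generate_in_carrier[OF Y] by auto
  have "commutator x h1 \<otimes> (h1 \<otimes> commutator x h2 \<otimes> inv h1) \<in> R"
    using h eng.IH by (intro normal_mult[OF R] normal_conj[OF R]) auto
  also have "commutator x h1 \<otimes> (h1 \<otimes> commutator x h2 \<otimes> inv h1) = commutator x (h1 \<otimes> h2)"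
    using h x by (simp add: commutator_def group_word_simps)
  finally show ?case .
qed

lemma generate_commutator:
  assumes R: "R \<lhd> G" and X: "X \<subseteq> carrier G" and Y: "Y \<subseteq> carrier G"
    and XY: "\<And>x y. \<lbrakk>x \<in> X; y \<in> Y\<rbrakk> \<Longrightarrow> commutator x y \<in> R"
    and x: "x \<in> generate G X" and y: "y \<in> generate G Y"
  shows "commutator x y \<in> R"
proof -
  note R' = normal_imp_subgroup[OF R]
  have yc: "y \<in> carrier G" using generate_in_carrier[OF Y y] .
  have "commutator z y \<in> R" if "z \<in> X" for z
    using that X Y by (intro generate_commutator_right[OF R Y _ _ y] XY) auto
  then have "commutator y z \<in> R" if "z \<in> X" for z
    using that X yc commutator_sym_mem[OF R'] by blast
  then have "commutator y x \<in> R"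
    by (intro generate_commutator_right[OF R X yc _ x])
  then show ?thesis
    by (rule commutator_sym_mem[OF R' yc generate_in_carrier[OF X x]])
qed

lemma gcomm_eq: "gcomm H = generate G {commutator y x | x y. x \<in> H \<and> y \<in> carrier G}"
  unfolding commutator_subgroup_def commutator_def
  by (rule arg_cong[where f = "generate G"]) blast

lemma gcommI:
  assumes "H \<subseteq> carrier G" "x \<in> H" "y \<in> carrier G"
  shows "commutator y x \<in> gcomm H" "commutator x y \<in> gcomm H"
proof -
  show 1: "commutator y x \<in> gcomm H"
    unfolding gcomm_eq using assms by (intro generate.incl) blast
  have "subgroup (gcomm H) G"
    unfolding gcomm_eq using assms by (intro generate_is_subgroup) auto
  then show "commutator x y \<in> gcomm H"
    by (rule commutator_sym_mem) (use 1 assms in auto)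
qed

lemma gcomm_subsetI:
  assumes "subgroup R G" "H \<subseteq> carrier G"
    and "\<And>x y. \<lbrakk>x \<in> H; y \<in> carrier G\<rbrakk> \<Longrightarrow> commutator x y \<in> R"
  shows "gcomm H \<subseteq> R"
  unfolding gcomm_eq
proof (rule generate_subgroup_incl[OF _ assms(1)])
  show "{commutator y x |x y. x \<in> H \<and> y \<in> carrier G} \<subseteq> R"
    using assms commutator_sym_mem[OF assms(1)] by blast
qed

lemma gcomm_generate_subsetI:
  assumes "R \<lhd> G" "B \<subseteq> carrier G"
    and "\<And>x y. \<lbrakk>x \<in> B; y \<in> carrier G\<rbrakk> \<Longrightarrow> commutator x y \<in> R"
  shows "gcomm (generate G B) \<subseteq> R"
proof (rule gcomm_subsetI)
  fix x y assume x: "x \<in> generate G B" and y: "y \<in> carrier G"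
  show "commutator x y \<in> R"
    by (rule generate_commutator[OF assms(1,2) subset_refl assms(3) x]) (use y in \<open>auto intro: generate.incl\<close>)
qed (use assms generate_in_carrier[OF assms(2)] in \<open>auto intro: normal_imp_subgroup\<close>)

lemma gcomm_mono: "H \<subseteq> K \<Longrightarrow> gcomm H \<subseteq> gcomm K"
  unfolding gcomm_eq by (intro mono_generate) auto

lemma gcomm_normal:
  assumes "H \<lhd> G" shows "gcomm H \<lhd> G"
  unfolding gcomm_eq
proof (rule normal_generateI)
  note H = normal_carrier[OF assms]
  show "{commutator y x |x y. x \<in> H \<and> y \<in> carrier G} \<subseteq> carrier G"
    using H by auto
  fix c g assume "c \<in> {commutator y x |x y. x \<in> H \<and> y \<in> carrier G}" and g: "g \<in> carrier G"
  then obtain x y where xy: "x \<in> H" "y \<in> carrier G" "c = commutator y x" by auto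
  then have "g \<otimes> c \<otimes> inv g = commutator (g \<otimes> y \<otimes> inv g) (g \<otimes> x \<otimes> inv g)"
    using g H by (simp add: conj_commutator subset_iff)
  with xy g show "g \<otimes> c \<otimes> inv g \<in> {commutator y x |x y. x \<in> H \<and> y \<in> carrier G}"
    using normal_conj[OF assms g] by auto
qed

lemma gcomm_subset: "H \<lhd> G \<Longrightarrow> gcomm H \<subseteq> H"
proof (rule gcomm_subsetI)
  fix x y assume H: "H \<lhd> G" and xy: "x \<in> H" "y \<in> carrier G"
  have "x \<otimes> (y \<otimes> inv x \<otimes> inv y) \<in> H"
    using xy by (intro normal_mult[OF H] normal_conj[OF H] normal_inv[OF H])
  then show "commutator x y \<in> H"
    using xy normal_carrier[OF H] by (simp add: commutator_def m_assoc subset_iff)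
qed (auto dest: normal_imp_subgroup normal_carrier)

lemma gcomm_iter_normal: "H \<lhd> G \<Longrightarrow> (gcomm ^^ j) H \<lhd> G"
  by (induction j) (auto intro: gcomm_normal)

lemma gcomm_iter_mono: "H \<subseteq> K \<Longrightarrow> (gcomm ^^ j) H \<subseteq> (gcomm ^^ j) K"
  by (induction j) (auto dest: gcomm_mono)

lemma gcomm_iter_antimono: "\<lbrakk>H \<lhd> G; i \<le> j\<rbrakk> \<Longrightarrow> (gcomm ^^ j) H \<subseteq> (gcomm ^^ i) H"
  by (rule lift_Suc_antimono_le[of "\<lambda>j. (gcomm ^^ j) H"]) (simp_all add: gcomm_subset gcomm_iter_normal)

lemma gcomm_iter_subset: "H \<lhd> G \<Longrightarrow> (gcomm ^^ j) H \<subseteq> H"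
  using gcomm_iter_antimono[of H 0 j] by simp

lemma gcomm_iter_add: "(gcomm ^^ i) ((gcomm ^^ j) H) = (gcomm ^^ (i + j)) H"
  by (simp add: funpow_add)

text \<open>Stands in for the Hall--Witt identity. Every commutator on the right has
  \<open>c\<close> or \<open>d\<close> as an entry: one with \<open>c\<close> is a step beyond the
  level known for \<open>[x, v]\<close>, and in \<open>[d, w]\<close> the entry
  \<open>d = [x, y]\<close> has already gained a step over \<open>x\<close>.\<close>

lemma commutator_commutator_right:
  assumes "x \<in> carrier G" "y \<in> carrier G" "v \<in> carrier G"
    and "d = commutator x y" "c = commutator x v" "w = y \<otimes> v \<otimes> inv y"
  shows "commutator x (commutator y v) = (d \<otimes> commutator y c \<otimes> inv d) \<otimes> commutator d c
    \<otimes> (c \<otimes> commutator d w \<otimes> inv c) \<otimes> commutator c (w \<otimes> inv v)"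
  using assms(1-3) unfolding assms(4-6) by (simp add: commutator_def group_word_simps)

text \<open>A three subgroups argument, based on the previous identity.\<close>

lemma gcomm_iter_commutator:
  assumes H: "H \<lhd> G"
  shows "\<lbrakk>x \<in> (gcomm ^^ a) H; z \<in> (gcomm ^^ b) H\<rbrakk> \<Longrightarrow> commutator x z \<in> (gcomm ^^ Suc (a + b)) H"
proof (induction b arbitrary: a x z)
  case 0
  then show ?case
    using normal_carrier[OF gcomm_iter_normal[OF H]] normal_carrier[OF H] by (auto intro: gcommI)
next
  case (Suc b)
  let ?R = "(gcomm ^^ Suc (a + Suc b)) H"
  note N = gcomm_iter_normal[OF H] and c = normal_carrier[OF gcomm_iter_normal[OF H]]
  note R = N[of "Suc (a + Suc b)"]
  let ?Y = "{commutator y v | v y. v \<in> (gcomm ^^ b) H \<and> y \<in> carrier G}"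
  have x: "x \<in> carrier G" using Suc.prems c by blast
  have "z \<in> generate G ?Y" using Suc.prems gcomm_eq[of "(gcomm ^^ b) H"] by simp
  then show ?case
  proof (rule generate_commutator_right[OF R _ x, rotated 2])
    show "?Y \<subseteq> carrier G" using c[of b] by auto
    fix y' assume "y' \<in> ?Y"
    then obtain y v where yv: "v \<in> (gcomm ^^ b) H" "y \<in> carrier G" "y' = commutator y v" by auto
    then have v: "v \<in> carrier G" using c by blast
    let ?d = "commutator x y" and ?c = "commutator x v" and ?w = "y \<otimes> v \<otimes> inv y"
    have d: "?d \<in> (gcomm ^^ Suc a) H"
      using gcommI(2)[OF c[of a] _ yv(2)] Suc.prems by simp
    have cc: "?c \<in> (gcomm ^^ Suc (a + b)) H"
      using Suc.prems yv by (intro Suc.IH)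
    have w: "?w \<in> (gcomm ^^ b) H"
      using yv by (intro normal_conj[OF N])
    have r1: "commutator y' ?c \<in> ?R" "commutator ?c y' \<in> ?R" if "y' \<in> carrier G" for y'
      using gcommI[OF c cc that] by simp_all
    \<comment> \<open>The induction hypothesis at \<open>Suc a\<close>; for this the induction on
      \<open>b\<close> leaves \<open>a\<close> arbitrary.\<close>
    have r2: "commutator ?d ?w \<in> ?R"
      using Suc.IH[OF d w] by simp
    have "(?d \<otimes> commutator y ?c \<otimes> inv ?d) \<otimes> commutator ?d ?c
        \<otimes> (?c \<otimes> commutator ?d ?w \<otimes> inv ?c) \<otimes> commutator ?c (?w \<otimes> inv v) \<in> ?R"
      using x v yv by (intro normal_mult[OF R] normal_conj[OF R] r1 r2) auto
    then show "commutator x y' \<in> ?R"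
      using commutator_commutator_right[OF x yv(2) v HOL.refl HOL.refl HOL.refl] yv(3) by simp
  qed
qed

section \<open>Subgroups generated by powers\<close>

lemma agemoI: "x \<in> H \<Longrightarrow> x [^] q \<in> agemo q H"
  unfolding agemo_def by (intro generate.incl) auto

lemma agemo_subsetI:
  "\<lbrakk>subgroup R G; \<And>x. x \<in> H \<Longrightarrow> x [^] q \<in> R\<rbrakk> \<Longrightarrow> agemo q H \<subseteq> R"
  unfolding agemo_def by (rule generate_subgroup_incl) auto

lemma agemo_mono: "H \<subseteq> K \<Longrightarrow> agemo q H \<subseteq> agemo q K"
  unfolding agemo_def by (intro mono_generate) auto

lemma agemo_normal:
  assumes "H \<lhd> G" shows "agemo q H \<lhd> G"
  unfolding agemo_def
proof (rule normal_generateI)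
  note H = normal_carrier[OF assms]
  show "{x [^] q |x. x \<in> H} \<subseteq> carrier G" using H by auto
  fix c g assume "c \<in> {x [^] q |x. x \<in> H}" and g: "g \<in> carrier G"
  then obtain x where x: "x \<in> H" "c = x [^] q" by auto
  then have "g \<otimes> c \<otimes> inv g = (g \<otimes> x \<otimes> inv g) [^] q"
    using g H by (simp add: conj_pow subset_iff)
  with x g show "g \<otimes> c \<otimes> inv g \<in> {x [^] q |x. x \<in> H}"
    using normal_conj[OF assms g] by auto
qed

lemma normal_pow: "\<lbrakk>H \<lhd> G; x \<in> H\<rbrakk> \<Longrightarrow> x [^] (n::nat) \<in> H"
  by (induction n) (auto intro: normal_one normal_mult)

lemma agemo_subset: "H \<lhd> G \<Longrightarrow> agemo q H \<subseteq> H"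
  by (rule agemo_subsetI) (auto intro: normal_imp_subgroup normal_pow)

lemma agemo_iter_normal: "H \<lhd> G \<Longrightarrow> (agemo q ^^ j) H \<lhd> G"
  by (induction j) (auto intro: agemo_normal)

lemma agemo_iter_mono: "H \<subseteq> K \<Longrightarrow> (agemo q ^^ j) H \<subseteq> (agemo q ^^ j) K"
  by (induction j) (auto dest: agemo_mono)

lemma agemo_iter_pow:
  "x \<in> H \<Longrightarrow> H \<subseteq> carrier G \<Longrightarrow> x [^] (q ^ j) \<in> (agemo q ^^ j) H"
proof (induction j)
  case (Suc j)
  then have "(x [^] (q ^ j)) [^] q \<in> agemo q ((agemo q ^^ j) H)" by (intro agemoI) simp
  with Suc show ?case by (simp add: nat_pow_pow subset_iff mult.commute)
qed auto

section \<open>Products of normal subgroups\<close>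

lemma join_normal:
  assumes A: "A \<lhd> G" and B: "B \<lhd> G" shows "A <#> B \<lhd> G"
proof (rule normal_invI)
  show "subgroup (A <#> B) G"
    by (rule mult_norm_subgroup[OF A normal_imp_subgroup[OF B]])
  fix x h assume x: "x \<in> carrier G" and "h \<in> A <#> B"
  then obtain a b where ab: "a \<in> A" "b \<in> B" "h = a \<otimes> b" by (auto simp: set_mult_def)
  then have c: "a \<in> carrier G" "b \<in> carrier G" using normal_carrier A B by blast+
  have "x \<otimes> h \<otimes> inv x = (x \<otimes> a \<otimes> inv x) \<otimes> (x \<otimes> b \<otimes> inv x)"
    using x c ab by (simp add: group_word_simps)
  then show "x \<otimes> h \<otimes> inv x \<in> A <#> B"
    using normal_conj[OF A x] normal_conj[OF B x] ab by (auto simp: set_mult_def)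
qed

lemma join_subsetI: "\<lbrakk>subgroup R G; A \<subseteq> R; B \<subseteq> R\<rbrakk> \<Longrightarrow> A <#> B \<subseteq> R"
  by (auto simp: set_mult_def intro!: subgroup.m_closed)

lemma join_ge1:
  assumes "A \<lhd> G" "B \<lhd> G" shows "A \<subseteq> A <#> B"
proof
  fix a assume "a \<in> A"
  then show "a \<in> A <#> B"
    using normal_one[OF assms(2)] normal_carrier[OF assms(1)] r_one[of a, symmetric]
    unfolding set_mult_def by blast
qed

lemma join_ge2:
  assumes "A \<lhd> G" "B \<lhd> G" shows "B \<subseteq> A <#> B"
proof
  fix b assume "b \<in> B"
  then show "b \<in> A <#> B"
    using normal_one[OF assms(1)] normal_carrier[OF assms(2)] l_one[of b, symmetric]
    unfolding set_mult_def by blast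
qed

lemma gcomm_join_subsetI:
  assumes A: "A \<lhd> G" and B: "B \<lhd> G" and R: "R \<lhd> G"
    and AR: "gcomm A \<subseteq> R" and BR: "gcomm B \<subseteq> R"
  shows "gcomm (A <#> B) \<subseteq> R"
proof (rule gcomm_subsetI)
  show "subgroup R G" "A <#> B \<subseteq> carrier G"
    using R join_normal[OF A B] by (auto dest: normal_imp_subgroup normal_carrier)
  fix x y assume "x \<in> A <#> B" and y: "y \<in> carrier G"
  then obtain a b where ab: "a \<in> A" "b \<in> B" "x = a \<otimes> b" by (auto simp: set_mult_def)
  then have c: "a \<in> carrier G" "b \<in> carrier G" using normal_carrier A B by blast+
  have "commutator a y \<in> R" "commutator b y \<in> R"
    using gcommI(2)[OF normal_carrier[OF A] ab(1) y] gcommI(2)[OF normal_carrier[OF B] ab(2) y] AR BR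
    by auto
  then have "(a \<otimes> commutator b y \<otimes> inv a) \<otimes> commutator a y \<in> R"
    using c by (intro normal_mult[OF R] normal_conj[OF R])
  then show "commutator x y \<in> R"
    using c y ab(3) by (simp add: commutator_def group_word_simps)
qed

text \<open>Modulo \<open>R\<close> the elements of \<open>A\<close> are central, so
  \<open>(a b)^q\<close> becomes \<open>a^q b^q\<close>. One central factor is enough, hence the
  asymmetric hypothesis.\<close>

lemma agemo_join_subsetI:
  assumes A: "A \<lhd> G" and B: "B \<lhd> G" and R: "R \<lhd> G"
    and AR: "agemo q A \<subseteq> R" and BR: "agemo q B \<subseteq> R" and CR: "gcomm A \<subseteq> R"
  shows "agemo q (A <#> B) \<subseteq> R"
proof (rule agemo_subsetI[OF normal_imp_subgroup[OF R]])
  fix x assume "x \<in> A <#> B"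
  then obtain a b where ab: "a \<in> A" "b \<in> B" "x = a \<otimes> b" by (auto simp: set_mult_def)
  then have c: "a \<in> carrier G" "b \<in> carrier G" using normal_carrier A B by blast+
  have pow: "(a \<otimes> b) [^] n \<otimes> inv (b [^] n) \<otimes> inv (a [^] n) \<in> R" for n :: nat
  proof (induction n)
    case 0
    then show ?case using normal_one[OF R] by simp
  next
    case (Suc n)
    let ?r = "(a \<otimes> b) [^] n \<otimes> inv (b [^] n) \<otimes> inv (a [^] n)"
    have "commutator (b [^] n) a \<in> R"
      using gcommI(1)[OF normal_carrier[OF A] ab(1), of "b [^] n"] c CR by auto
    then have "?r \<otimes> (a [^] n \<otimes> commutator (b [^] n) a \<otimes> inv (a [^] n)) \<in> R"
      using c by (intro normal_mult[OF R Suc] normal_conj[OF R]) auto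
    also have "?r \<otimes> (a [^] n \<otimes> commutator (b [^] n) a \<otimes> inv (a [^] n))
        = (a \<otimes> b) [^] Suc n \<otimes> inv (b [^] Suc n) \<otimes> inv (a [^] Suc n)"
      using c by (simp add: commutator_def group_word_simps)
    finally show ?case .
  qed
  have "a [^] q \<in> R" "b [^] q \<in> R" using agemoI ab AR BR by blast+
  then have "(a \<otimes> b) [^] q \<otimes> inv (b [^] q) \<otimes> inv (a [^] q) \<otimes> (a [^] q \<otimes> b [^] q) \<in> R"
    using pow normal_mult[OF R] by blast
  then show "x [^] q \<in> R"
    using c ab by (simp add: group_word_simps)
qed

lemma gcomm_iter_join:
  assumes A: "A \<lhd> G" and B: "B \<lhd> G"
  shows "(gcomm ^^ j) (A <#> B) \<subseteq> (gcomm ^^ j) A <#> (gcomm ^^ j) B"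
proof (induction j)
  case (Suc j)
  note N = gcomm_iter_normal[OF A] gcomm_iter_normal[OF B]
  have "gcomm ((gcomm ^^ j) (A <#> B)) \<subseteq> gcomm ((gcomm ^^ j) A <#> (gcomm ^^ j) B)"
    by (rule gcomm_mono[OF Suc])
  also have "\<dots> \<subseteq> (gcomm ^^ Suc j) A <#> (gcomm ^^ Suc j) B"
    using join_ge1[OF N[of "Suc j"]] join_ge2[OF N[of "Suc j"]]
    by (intro gcomm_join_subsetI N join_normal) auto
  finally show ?case by simp
qed auto

text \<open>\<open>gcomm\<close> is defined with the element of the whole group in the first entry;
  twisted powers call for generators \<open>[v, y]\<close> with \<open>v\<close> first.\<close>

lemma gcomm_eq_generate:
  assumes L: "L \<lhd> G"
  shows "gcomm L = generate G {commutator v y | v y. v \<in> L \<and> y \<in> carrier G}" (is "_ = generate G ?B")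
proof
  note Lc = normal_carrier[OF L]
  have "?B \<subseteq> gcomm L" using gcommI(2)[OF Lc] by auto
  then show "generate G ?B \<subseteq> gcomm L"
    by (rule generate_subgroup_incl[OF _ normal_imp_subgroup[OF gcomm_normal[OF L]]])
  have "?B \<subseteq> carrier G" using Lc by auto
  then show "gcomm L \<subseteq> generate G ?B"
    by (intro gcomm_subsetI Lc generate_is_subgroup generate.incl) auto
qed

text \<open>\<open>inv v\<close> times \<open>[v, y]\<close> is the conjugate of
  \<open>inv v\<close> by \<open>y\<close>, so its powers are conjugates of powers. This is the
  model for \<open>twisted_pow_tensor\<close>.\<close>

lemma twisted_pow_commutator:
  assumes "v \<in> carrier G" "y \<in> carrier G"
  shows "v [^] n \<otimes> (inv v \<otimes> commutator v y) [^] n = commutator (v [^] (n::nat)) y"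
proof -
  have "inv v \<otimes> commutator v y = y \<otimes> inv v \<otimes> inv y"
    using assms by (simp add: commutator_def group_word_simps)
  then have "(inv v \<otimes> commutator v y) [^] n = y \<otimes> inv (v [^] n) \<otimes> inv y"
    using assms conj_pow[of y "inv v" n] by (simp add: nat_pow_inv)
  then show ?thesis
    using assms by (simp add: commutator_def group_word_simps)
qed

end

section \<open>Power subgroups and commutators with the whole group\<close>

locale group_prime = group G for G (structure) +
  fixes p :: nat
  assumes prime_p: "Factorial_Ring.prime p"
begin

lemma p_ge_2: "2 \<le> p"
  using prime_p by (rule prime_ge_2_nat)

text \<open>Adjoining one element \<open>g\<close> to the top of the lower central \<open>G\<close>-series of \<open>H\<close> keeps it a
  filtration, because \<open>g\<close> commutes with itself.\<close>

lemma group_filtration_insert: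
  assumes H: "H \<lhd> G" and g: "g \<in> carrier G"
  shows "group_filtration G (\<lambda>i. if i \<le> 1 then generate G (insert g H) else (gcomm ^^ (i - 1)) H)"
    (is "group_filtration G ?F")
proof -
  note Hc = normal_carrier[OF H] and N = gcomm_iter_normal[OF H]
  let ?L = "generate G (insert g H)"
  have Lc: "insert g H \<subseteq> carrier G" using g Hc by auto
  have L: "subgroup ?L G" by (rule generate_is_subgroup[OF Lc])
  have HL: "H \<subseteq> ?L" by (auto intro: generate.incl)
  have L_carrier: "x \<in> carrier G" if "x \<in> ?L" for x using that generate_in_carrier[OF Lc] by blast
  have LL: "commutator x y \<in> gcomm H" if "x \<in> ?L" "y \<in> ?L" for x y
  proof (rule generate_commutator[OF gcomm_normal[OF H] Lc Lc _ that])
    fix x y assume "x \<in> insert g H" "y \<in> insert g H"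
    then show "commutator x y \<in> gcomm H"
      using g Hc gcommI[OF Hc] normal_one[OF gcomm_normal[OF H]]
      by (auto simp: commutator_def[of g g] group_word_simps)
  qed
  show ?thesis
  proof (rule group_filtration.intro[OF is_group], rule group_filtration_axioms.intro)
    show "subgroup (?F i) G" for i
      using L normal_imp_subgroup[OF N] by simp
    show "?F (Suc i) \<subseteq> ?F i" for i
      using gcomm_subset[OF H] HL gcomm_iter_antimono[OF H, of "i - 1" i] by (cases i) auto
    fix x y i j assume x: "x \<in> ?F i" and y: "y \<in> ?F j"
    show "commutator x y \<in> ?F (i + j)"
    proof -
      consider "i \<le> 1" "j \<le> 1" | "1 < i" "j \<le> 1" | "i \<le> 1" "1 < j" | "1 < i" "1 < j" by linarith
      then show ?thesis
      proof cases
        case 1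
        then have "commutator x y \<in> gcomm H" using x y LL by simp
        moreover have "gcomm H \<subseteq> ?F (i + j)"
          using 1 gcomm_subset[OF H] HL by (auto simp: le_Suc_eq numeral_2_eq_2)
        ultimately show ?thesis by auto
      next
        case 2
        then have "commutator x y \<in> gcomm ((gcomm ^^ (i - 1)) H)"
          using x y L_carrier gcommI(2)[OF normal_carrier[OF N]] by simp
        then have "commutator x y \<in> (gcomm ^^ Suc (i - 1)) H" by simp
        moreover have "i + j - 1 \<le> Suc (i - 1)" using 2 by simp
        ultimately show ?thesis
          using 2 subsetD[OF gcomm_iter_antimono[OF H, of "i + j - 1" "Suc (i - 1)"]] by simp
      next
        case 3
        then have "commutator x y \<in> gcomm ((gcomm ^^ (j - 1)) H)"
          using x y L_carrier gcommI(1)[OF normal_carrier[OF N]] by simp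
        then have "commutator x y \<in> (gcomm ^^ Suc (j - 1)) H" by simp
        moreover have "i + j - 1 \<le> Suc (j - 1)" using 3 by simp
        ultimately show ?thesis
          using 3 subsetD[OF gcomm_iter_antimono[OF H, of "i + j - 1" "Suc (j - 1)"]] by simp
      next
        case 4
        then have "commutator x y \<in> (gcomm ^^ Suc ((i - 1) + (j - 1))) H"
          using x y by (intro gcomm_iter_commutator[OF H]) auto
        \<comment> \<open>Level \<open>i\<close> sits at the iterate \<open>i - 1\<close>; the extra
          step gained in \<open>gcomm_iter_commutator\<close> restores the additive
          indexing.\<close>
        moreover have "Suc ((i - 1) + (j - 1)) = i + j - 1" using 4 by simp
        ultimately have "commutator x y \<in> (gcomm ^^ (i + j - 1)) H" by (simp only:)
        then show ?thesis using 4 by simp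
      qed
    qed
  qed
qed

section \<open>\<open>p\<close>-th powers modulo a normal subgroup that contains the error
  terms\<close>

context
  fixes H R
  assumes H: "H \<lhd> G" and R: "R \<lhd> G" and top: "(gcomm ^^ (p - 1)) H \<subseteq> R"
    and gcomm_pow: "\<And>x. x \<in> gcomm H \<Longrightarrow> x [^] p \<in> R"
begin

text \<open>The sequence \<open>(z w)^n w^-n z^-n\<close> is polynomial and trivial at 0 and 1, so
  \<open>poly_seq_prime_value\<close> applies from \<open>m = 2\<close>. Everything happens inside
  \<open>H\<close>, so the element adjoined to the filtration is the identity.\<close>

lemma pow_mult_mod:
  assumes z: "z \<in> H" and w: "w \<in> H"
  shows "(z \<otimes> w) [^] p \<otimes> inv (w [^] p) \<otimes> inv (z [^] p) \<in> R"
proof -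
  define F where "F = (\<lambda>i. if i \<le> 1 then generate G (insert \<one> H) else (gcomm ^^ (i - 1)) H)"
  interpret group_filtration G F
    unfolding F_def by (rule group_filtration_insert[OF H one_closed])
  have c: "z \<in> carrier G" "w \<in> carrier G" using z w normal_carrier[OF H] by auto
  have F0: "F 0 = F 1" "z \<in> F 0" "w \<in> F 0" "z \<otimes> w \<in> F 0"
    using z w normal_mult[OF H] by (auto simp: F_def intro: generate.incl)
  show ?thesis
  proof (rule poly_seq_prime_value[OF prime_p normal_imp_subgroup[OF R], of 2])
    show "F p \<subseteq> R" "\<And>x. x \<in> F 2 \<Longrightarrow> x [^] p \<in> R"
      using top gcomm_pow p_ge_2 by (auto simp: F_def)
    show "poly_seq p 0 (\<lambda>n. (z \<otimes> w) [^] n \<otimes> inv (w [^] n) \<otimes> inv (z [^] n))"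
      using F0 by (intro poly_seq_mult poly_seq_inv poly_seq_power)
    fix n :: nat assume "n < 2"
    then have "n = 0 \<or> n = 1" by auto
    then show "(z \<otimes> w) [^] n \<otimes> inv (w [^] n) \<otimes> inv (z [^] n) = \<one>"
      using c by (auto simp: group_word_simps)
  qed (use p_ge_2 in auto)
qed

text \<open>The same argument with a \<open>g\<close> that may lie outside \<open>H\<close>. If
  \<open>t = [g, y]\<close>, the first two factors multiply to \<open>[g^p, y]\<close>, which is
  thus compared with \<open>[g, y]^p\<close>.\<close>

lemma twisted_pow_mod:
  assumes t: "t \<in> H" and g: "g \<in> carrier G"
  shows "g [^] p \<otimes> (inv g \<otimes> t) [^] p \<otimes> inv (t [^] p) \<in> R"
proof -
  define F where "F = (\<lambda>i. if i \<le> 1 then generate G (insert g H) else (gcomm ^^ (i - 1)) H)"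
  interpret group_filtration G F
    unfolding F_def by (rule group_filtration_insert[OF H g])
  have c: "t \<in> carrier G" using t normal_carrier[OF H] by auto
  have gt: "g \<in> F 0" "t \<in> F 0" using t by (auto simp: F_def intro: generate.incl)
  have F0: "F 0 = F 1" "inv g \<otimes> t \<in> F 0"
    using gt by (simp add: F_def, intro filtration_mult filtration_inv)
  show ?thesis
  proof (rule poly_seq_prime_value[OF prime_p normal_imp_subgroup[OF R], of 2])
    show "F p \<subseteq> R" "\<And>x. x \<in> F 2 \<Longrightarrow> x [^] p \<in> R"
      using top gcomm_pow p_ge_2 by (auto simp: F_def)
    show "poly_seq p 0 (\<lambda>n. g [^] n \<otimes> (inv g \<otimes> t) [^] n \<otimes> inv (t [^] n))"
      using F0 gt by (intro poly_seq_mult poly_seq_inv poly_seq_power)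
    fix n :: nat assume "n < 2"
    then have "n = 0 \<or> n = 1" by auto
    then show "g [^] n \<otimes> (inv g \<otimes> t) [^] n \<otimes> inv (t [^] n) = \<one>"
      using c g by (auto simp: group_word_simps)
  qed (use p_ge_2 in auto)
qed

lemma twisted_pow_iff:
  assumes t: "t \<in> H" and g: "g \<in> carrier G"
  shows "g [^] p \<otimes> (inv g \<otimes> t) [^] p \<in> R \<longleftrightarrow> t [^] p \<in> R"
proof
  have c: "t \<in> carrier G" using t normal_carrier[OF H] by auto
  let ?u = "g [^] p \<otimes> (inv g \<otimes> t) [^] p"
  note R' = twisted_pow_mod[OF t g]
  show "t [^] p \<in> R" if "?u \<in> R"
    using normal_mult[OF R normal_inv[OF R R'] that] c g by (simp add: group_word_simps)
  show "?u \<in> R" if "t [^] p \<in> R"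
    using normal_mult[OF R R' that] c g by (simp add: group_word_simps)
qed

text \<open>By \<open>pow_mult_mod\<close> the \<open>p\<close>-th power map is multiplicative on
  \<open>H\<close> modulo \<open>R\<close>, so the elements sent into \<open>R\<close> form a
  subgroup.\<close>

lemma pow_mem_if_generators:
  assumes B: "H = generate G B" and "\<And>b. b \<in> B \<Longrightarrow> b [^] p \<in> R" and x: "x \<in> H"
  shows "x [^] p \<in> R"
proof -
  have "x \<in> generate G B" using B x by simp
  then show ?thesis
  proof (induction rule: generate.induct)
    case one
    then show ?case using normal_one[OF R] by simp
  next
    case (incl h)
    then show ?case by (rule assms(2))
  next
    case (inv h)
    then have "h \<in> carrier G" using B normal_carrier[OF H] by (auto intro: generate.incl)
    with inv assms(2) show ?case by (simp add: nat_pow_inv normal_inv[OF R])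
  next
    case (eng h1 h2)
    then have h: "h1 \<in> H" "h2 \<in> H" using B by auto
    then have c: "h1 \<in> carrier G" "h2 \<in> carrier G" using normal_carrier[OF H] by auto
    from pow_mult_mod[OF h]
    have "(h1 \<otimes> h2) [^] p \<otimes> inv (h2 [^] p) \<otimes> inv (h1 [^] p) \<otimes> (h1 [^] p \<otimes> h2 [^] p) \<in> R"
      using eng.IH normal_mult[OF R] by blast
    then show ?case using c by (simp add: group_word_simps)
  qed
qed

end

text \<open>Discharges the assumption \<open>gcomm_pow\<close> by a descent along the iterates of
  \<open>gcomm\<close>. At level \<open>p - 1\<close> everything is in \<open>R\<close>, and the
  power statement for one iterate is the \<open>gcomm_pow\<close> of the preceding one. Generators
  \<open>[v, y]\<close> pass because \<open>[v^p, y]\<close> lies in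
  \<open>gcomm (agemo p H)\<close>.\<close>

lemma agemo_subset_if_generators:
  assumes H: "H \<lhd> G" and R: "R \<lhd> G" and B: "H = generate G B"
    and top: "(gcomm ^^ (p - 1)) H \<subseteq> R" and comm: "gcomm (agemo p H) \<subseteq> R"
    and gen: "\<And>b. b \<in> B \<Longrightarrow> \<exists>g\<in>carrier G. g [^] p \<otimes> (inv g \<otimes> b) [^] p \<in> R"
  shows "agemo p H \<subseteq> R"
proof -
  note N = gcomm_iter_normal[OF H] and Hc = normal_carrier[OF H]
  have iter: "(gcomm ^^ (p - 1)) ((gcomm ^^ j) H) \<subseteq> R" for j
    using gcomm_iter_antimono[OF H, of "p - 1" "p - 1 + j"] top by (auto simp: gcomm_iter_add)
  have step: "\<forall>x\<in>(gcomm ^^ j) H. x [^] p \<in> R" if "1 \<le> j" "j \<le> p - 1" for j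
    using that(2,1)
  proof (induction j rule: inc_induct)
    case base
    then show ?case using top normal_pow[OF R] by blast
  next
    case (step j)
    then have IH: "x [^] p \<in> R" if "x \<in> gcomm ((gcomm ^^ j) H)" for x using that by simp
    obtain i where j: "j = Suc i" using step.prems by (cases j) auto
    let ?B = "{commutator v y | v y. v \<in> (gcomm ^^ i) H \<and> y \<in> carrier G}"
    have B: "(gcomm ^^ j) H = generate G ?B"
      using gcomm_eq_generate[OF N[of i]] j by simp
    have "x [^] p \<in> R" if "x \<in> (gcomm ^^ j) H" for x
    proof (rule pow_mem_if_generators[OF N R iter IH B _ that])
      fix b assume "b \<in> ?B"
      then obtain v y where b: "v \<in> (gcomm ^^ i) H" "y \<in> carrier G" "b = commutator v y" by auto
      then have v: "v \<in> H" using gcomm_iter_subset[OF H] by blast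
      then have vc: "v \<in> carrier G" using Hc by auto
      have "commutator (v [^] p) y \<in> R"
        using gcommI(2)[OF normal_carrier[OF agemo_normal[OF H]] agemoI[OF v] b(2)] comm by blast
      moreover have "b \<in> (gcomm ^^ j) H"
        using b gcommI(2)[OF normal_carrier[OF N]] j by simp
      ultimately show "b [^] p \<in> R"
        using twisted_pow_iff[OF N R iter IH, where t = b and g = v] vc twisted_pow_commutator[OF vc b(2)] b(3) by simp
    qed
    then show ?case by blast
  qed
  have pow: "x [^] p \<in> R" if "x \<in> gcomm H" for x
    using that step[of 1] p_ge_2 by simp
  have "x [^] p \<in> R" if "x \<in> H" for x
  proof (rule pow_mem_if_generators[OF H R top pow B _ that])
    fix b assume b: "b \<in> B"
    then have "b \<in> H" using B by (auto intro: generate.incl)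
    with gen[OF b] show "b [^] p \<in> R" using twisted_pow_iff[OF H R top pow] by blast
  qed
  then show ?thesis by (intro agemo_subsetI normal_imp_subgroup[OF R])
qed

text \<open>A generator \<open>[v, y]\<close> has the twisted power \<open>[v^p, y]\<close>, which
  is in \<open>R\<close> by \<open>comm\<close>. The iterate is \<open>p\<close> because
  \<open>p - 1\<close> commutations are applied to \<open>gcomm L\<close>.\<close>

lemma agemo_gcomm_subset:
  assumes L: "L \<lhd> G" and R: "R \<lhd> G" and comm: "gcomm (agemo p L) \<subseteq> R" and top: "(gcomm ^^ p) L \<subseteq> R"
  shows "agemo p (gcomm L) \<subseteq> R"
proof (rule agemo_subset_if_generators[OF gcomm_normal[OF L] R gcomm_eq_generate[OF L]])
  have "Suc (p - 1) = p" using p_ge_2 by simp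
  then show "(gcomm ^^ (p - 1)) (gcomm L) \<subseteq> R"
    using top by (metis funpow_Suc_right comp_apply)
  show "gcomm (agemo p (gcomm L)) \<subseteq> R"
    using gcomm_mono[OF agemo_mono[OF gcomm_subset[OF L]]] comm by blast
  fix b assume "b \<in> {commutator v y | v y. v \<in> L \<and> y \<in> carrier G}"
  then obtain v y where b: "v \<in> L" "y \<in> carrier G" "b = commutator v y" by auto
  then have "v \<in> carrier G" using normal_carrier[OF L] by auto
  then have "v [^] p \<otimes> (inv v \<otimes> b) [^] p = commutator (v [^] p) y" "v \<in> carrier G"
    using b twisted_pow_commutator by simp_all
  moreover have "commutator (v [^] p) y \<in> R"
    using gcommI(2)[OF normal_carrier[OF agemo_normal[OF L]] agemoI[OF b(1)] b(2)] comm by blast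
  ultimately show "\<exists>g\<in>carrier G. g [^] p \<otimes> (inv g \<otimes> b) [^] p \<in> R" by (auto intro!: bexI[of _ v])
qed

lemma generate_twisted_pow_subset:
  assumes H: "H \<lhd> G" and R: "R \<lhd> G" and pow: "agemo p H \<subseteq> R" and top: "(gcomm ^^ (p - 1)) H \<subseteq> R"
    and B: "\<And>b. b \<in> B \<Longrightarrow> \<exists>t\<in>H. \<exists>g\<in>carrier G. b = g [^] p \<otimes> (inv g \<otimes> t) [^] p"
  shows "generate G B \<subseteq> R"
proof (rule generate_subgroup_incl[OF _ normal_imp_subgroup[OF R]])
  have H_pow: "x [^] p \<in> R" if "x \<in> H" for x using agemoI[OF that] pow by auto
  have *: "x [^] p \<in> R" if "x \<in> gcomm H" for x using that gcomm_subset[OF H] H_pow by blast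
  show "B \<subseteq> R" using B twisted_pow_iff[OF H R top *] H_pow by blast
qed

text \<open>Converse of \<open>agemo_gcomm_subset\<close>: now \<open>[v^p, y]\<close> is read as a
  twisted power of \<open>[v, y]\<close>, whose \<open>p\<close>-th power is under control. Together
  they say that \<open>[L^p, G]\<close> and \<open>[L, G]^p\<close> agree up to
  \<open>p\<close>-fold commutators of \<open>L\<close>.\<close>

lemma gcomm_agemo_subset:
  assumes L: "L \<lhd> G" and R: "R \<lhd> G" and pow: "agemo p (gcomm L) \<subseteq> R" and top: "(gcomm ^^ p) L \<subseteq> R"
  shows "gcomm (agemo p L) \<subseteq> R"
  unfolding agemo_def
proof (rule gcomm_generate_subsetI[OF R])
  note Lc = normal_carrier[OF L]
  show "{x [^] p |x. x \<in> L} \<subseteq> carrier G" using Lc by auto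
  fix b y assume "b \<in> {x [^] p |x. x \<in> L}" and y: "y \<in> carrier G"
  then obtain v where v: "v \<in> L" "b = v [^] p" by auto
  then have vc: "v \<in> carrier G" using Lc by auto
  have "Suc (p - 1) = p" using p_ge_2 by simp
  then have top': "(gcomm ^^ (p - 1)) (gcomm L) \<subseteq> R"
    using top by (metis funpow_Suc_right comp_apply)
  have "generate G {commutator b y} \<subseteq> R"
  proof (rule generate_twisted_pow_subset[OF gcomm_normal[OF L] R pow top'])
    show "\<exists>t\<in>gcomm L. \<exists>g\<in>carrier G. b' = g [^] p \<otimes> (inv g \<otimes> t) [^] p" if "b' \<in> {commutator b y}" for b'
      using that v(2) vc gcommI(2)[OF Lc v(1) y] twisted_pow_commutator[OF vc y, of p, symmetric] by blast
  qed
  then show "commutator b y \<in> R" by (auto intro: generate.incl)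
qed

text \<open>The commutations pass the \<open>p\<close>-th power one at a time. Stage
  \<open>j\<close> costs \<open>p\<close> commutations of \<open>(gcomm ^^ j) L\<close>, that is,
  the iterate \<open>p - 1 + Suc j\<close>.\<close>

lemma gcomm_iter_agemo_subset:
  assumes L: "L \<lhd> G"
  shows "(gcomm ^^ j) (agemo p L) \<subseteq> agemo p ((gcomm ^^ j) L) <#> (gcomm ^^ (p - 1 + j)) L"
proof (induction j)
  case 0
  then show ?case using join_ge1[OF agemo_normal[OF L] gcomm_iter_normal[OF L]] by simp
next
  case (Suc j)
  note N = gcomm_iter_normal[OF L]
  let ?A = "agemo p ((gcomm ^^ j) L)" and ?B = "(gcomm ^^ (p - 1 + j)) L"
  let ?A' = "agemo p ((gcomm ^^ Suc j) L)" and ?B' = "(gcomm ^^ (p - 1 + Suc j)) L"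
  have N': "?A \<lhd> G" "?B \<lhd> G" "?A' \<lhd> G" "?B' \<lhd> G" by (intro agemo_normal N)+
  have R: "?A' <#> ?B' \<lhd> G" by (intro join_normal N')
  have sub: "?A' \<subseteq> ?A' <#> ?B'" "?B' \<subseteq> ?A' <#> ?B'"
    by (rule join_ge1[OF N'(3,4)], rule join_ge2[OF N'(3,4)])
  have B': "gcomm ?B = ?B'" by simp
  have "(gcomm ^^ p) ((gcomm ^^ j) L) = ?B'" using p_ge_2 by (simp add: gcomm_iter_add)
  then have "gcomm ?A \<subseteq> ?A' <#> ?B'"
    using sub by (intro gcomm_agemo_subset N R) simp_all
  moreover have "gcomm ((gcomm ^^ j) (agemo p L)) \<subseteq> gcomm (?A <#> ?B)"
    by (rule gcomm_mono[OF Suc])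
  ultimately show ?case
    using gcomm_join_subsetI[OF N'(1,2) R] sub(2) B' by auto
qed

end

section \<open>Exponents along a chain of twisted powers\<close>

text \<open>The model is \<open>B k\<close>, the set of commutators \<open>[x\<^bsup>p^k\<^esup>, y]\<close>: with \<open>v = x\<^bsup>p^k\<^esup>\<close> and
  \<open>b = [v, y]\<close> one has \<open>[v\<^sup>p, y] = v\<^sup>p (v\<^sup>-\<^sup>1 b)\<^sup>p\<close>.\<close>

locale twisted_power_chain = group_prime +
  fixes B :: "nat \<Rightarrow> 'a set" and n c :: nat
  assumes chain_normal: "generate G (B k) \<lhd> G"
    and twisted_pow_mem:
      "b \<in> B k \<Longrightarrow> \<exists>g\<in>carrier G. g [^] p \<otimes> (inv g \<otimes> b) [^] p \<in> B (Suc k)"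
    and twisted_pow_exhaust:
      "b \<in> B (Suc k) \<Longrightarrow> \<exists>t\<in>B k. \<exists>g\<in>carrier G. b = g [^] p \<otimes> (inv g \<otimes> t) [^] p"
    and nilpotent: "(gcomm ^^ c) (generate G (B 0)) = {\<one>}"
    and chain_trivial: "generate G (B n) = {\<one>}"
    and potent: "(gcomm ^^ (p - 2)) (generate G (B 0)) \<subseteq> generate G (B 1) \<or>
      (gcomm ^^ (p - 1)) (generate G (B 0)) \<subseteq> generate G (B 2)"
begin

abbreviation H :: "nat \<Rightarrow> 'a set" where "H k \<equiv> generate G (B k)"
abbreviation T :: "'a set" where "T \<equiv> H 0"
abbreviation agemo_p :: "'a set \<Rightarrow> 'a set" where "agemo_p \<equiv> agemo p"

lemma chain_Suc_subset:
  assumes "R \<lhd> G" "agemo_p (H k) \<subseteq> R" "(gcomm ^^ (p - 1)) (H k) \<subseteq> R"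
  shows "H (Suc k) \<subseteq> R"
proof (rule generate_twisted_pow_subset[OF chain_normal assms])
  fix b assume "b \<in> B (Suc k)"
  from twisted_pow_exhaust[OF this] obtain t where t: "t \<in> B k"
    "\<exists>g\<in>carrier G. b = g [^] p \<otimes> (inv g \<otimes> t) [^] p" ..
  from t(2) show "\<exists>t\<in>H k. \<exists>g\<in>carrier G. b = g [^] p \<otimes> (inv g \<otimes> t) [^] p"
    by (rule bexI[of _ t]) (rule generate.incl[OF t(1)])
qed

lemma chain_subset: "H k \<subseteq> T"
proof (induction k)
  case (Suc k)
  then have "agemo_p (H k) \<subseteq> T" "(gcomm ^^ (p - 1)) (H k) \<subseteq> T"
    using agemo_subset[OF chain_normal] gcomm_iter_subset[OF chain_normal] by blast+
  then show ?case by (rule chain_Suc_subset[OF chain_normal])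
qed auto

lemma agemo_chain_subset:
  assumes R: "R \<lhd> G" and "H (Suc k) \<subseteq> R" "(gcomm ^^ (p - 1)) (H k) \<subseteq> R" "gcomm (agemo_p (H k)) \<subseteq> R"
  shows "agemo_p (H k) \<subseteq> R"
proof (rule agemo_subset_if_generators[OF chain_normal R HOL.refl assms(3,4)])
  fix b assume "b \<in> B k"
  then obtain g where "g \<in> carrier G" "g [^] p \<otimes> (inv g \<otimes> b) [^] p \<in> B (Suc k)"
    using twisted_pow_mem by blast
  then show "\<exists>g\<in>carrier G. g [^] p \<otimes> (inv g \<otimes> b) [^] p \<in> R"
    using assms(2) generate.incl[of _ "B (Suc k)"] by blast
qed

text \<open>Modulo \<open>gcomm T\<close> the subgroup \<open>T\<close> is central and all error
  terms vanish, so each \<open>p\<close>-th power leads from \<open>H k\<close> into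
  \<open>H (Suc k)\<close>, and the chain ends in the trivial group.\<close>

lemma agemo_iter_subset_gcomm: "(agemo_p ^^ n) T \<subseteq> gcomm T"
proof -
  note CT = gcomm_normal[OF chain_normal[of 0]]
  have J: "H k <#> gcomm T \<lhd> G" for k by (rule join_normal[OF chain_normal CT])
  have step: "agemo_p (H k) \<subseteq> H (Suc k) <#> gcomm T" for k
  proof (rule agemo_chain_subset[OF J])
    have "gcomm (H k) \<subseteq> gcomm T" by (rule gcomm_mono[OF chain_subset])
    moreover have "(gcomm ^^ (p - 1)) (H k) \<subseteq> gcomm (H k)"
      using gcomm_iter_antimono[OF chain_normal, of 1 "p - 1"] p_ge_2 by simp
    moreover have "gcomm (agemo_p (H k)) \<subseteq> gcomm (H k)"
      by (rule gcomm_mono[OF agemo_subset[OF chain_normal]])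
    ultimately show "(gcomm ^^ (p - 1)) (H k) \<subseteq> H (Suc k) <#> gcomm T"
        "gcomm (agemo_p (H k)) \<subseteq> H (Suc k) <#> gcomm T"
      using join_ge2[OF chain_normal CT] by blast+
  qed (rule join_ge1[OF chain_normal CT])
  have "(agemo_p ^^ k) T \<subseteq> H k <#> gcomm T" for k
  proof (induction k)
    case 0
    then show ?case using join_ge1[OF chain_normal CT] by simp
  next
    case (Suc k)
    have "agemo_p (H k <#> gcomm T) \<subseteq> H (Suc k) <#> gcomm T"
      using agemo_subset[OF CT] gcomm_mono[OF chain_subset, of k] join_ge2[OF chain_normal CT]
      by (intro agemo_join_subsetI chain_normal CT J step) blast+
    with agemo_mono[OF Suc] show ?case by auto
  qed
  from this[of n] show ?thesis
    using chain_trivial join_subsetI[OF normal_imp_subgroup[OF CT], of "{\<one>}" "gcomm T"] normal_one[OF CT]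
    by auto
qed

text \<open>Modulo \<open>gcomm (gcomm L)\<close> the error of \<open>agemo_gcomm_subset\<close>, a
  \<open>p\<close>-fold commutator with \<open>p \<ge> 2\<close>, vanishes. So powers of
  \<open>gcomm L\<close> can be traded one by one for powers of \<open>L\<close>.\<close>

lemma agemo_iter_gcomm_subset:
  assumes L: "L \<lhd> G"
  shows "(agemo_p ^^ k) (gcomm L) \<subseteq> gcomm ((agemo_p ^^ k) L) <#> gcomm (gcomm L)"
proof (induction k)
  case 0
  then show ?case using join_ge1[OF gcomm_normal[OF L] gcomm_normal[OF gcomm_normal[OF L]]] by simp
next
  case (Suc k)
  let ?L = "(agemo_p ^^ k) L" and ?L' = "(agemo_p ^^ Suc k) L"
  note C2 = gcomm_normal[OF gcomm_normal[OF L]]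
  have N: "?L \<lhd> G" "gcomm ?L \<lhd> G" "gcomm ?L' \<lhd> G"
    by (intro gcomm_normal agemo_iter_normal L)+
  let ?R = "gcomm ?L' <#> gcomm (gcomm L)"
  have R: "?R \<lhd> G" by (rule join_normal[OF N(3) C2])
  note sub = join_ge1[OF N(3) C2] join_ge2[OF N(3) C2]
  have LL: "?L \<subseteq> L"
    by (induction k) (auto dest: subsetD[OF agemo_subset[OF agemo_iter_normal[OF L]]])
  have CC: "gcomm (gcomm ?L) \<subseteq> gcomm (gcomm L)" by (intro gcomm_mono LL)
  have "(gcomm ^^ p) ?L \<subseteq> gcomm (gcomm L)"
    using gcomm_iter_antimono[OF N(1) p_ge_2] CC by (auto simp: numeral_2_eq_2)
  then have "agemo_p (gcomm ?L) \<subseteq> ?R"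
    using sub by (intro agemo_gcomm_subset N R) auto
  then have "agemo_p (gcomm ?L <#> gcomm (gcomm L)) \<subseteq> ?R"
    using agemo_subset[OF C2, of p] CC sub by (intro agemo_join_subsetI N C2 R) auto
  with agemo_mono[OF Suc] show ?case by auto
qed

text \<open>A block of \<open>n\<close> power steps moves each iterated commutator subgroup of
  \<open>T\<close> into the next, and \<open>c\<close> blocks exhaust the series. The count is
  crude, but the Frattini argument only asks that some iterate be trivial.\<close>

lemma agemo_iter_trivial: "(agemo_p ^^ (c * n)) T = {\<one>}"
proof -
  note N = gcomm_iter_normal[OF chain_normal[of 0]]
  have step: "(agemo_p ^^ n) ((gcomm ^^ j) T) \<subseteq> (gcomm ^^ Suc j) T" for j
  proof (induction j)
    case 0
    then show ?case using agemo_iter_subset_gcomm by simp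
  next
    case (Suc j)
    let ?L = "(gcomm ^^ j) T"
    have "(agemo_p ^^ n) (gcomm ?L) \<subseteq> gcomm ((agemo_p ^^ n) ?L) <#> gcomm (gcomm ?L)"
      by (rule agemo_iter_gcomm_subset[OF N])
    also have "\<dots> \<subseteq> gcomm (gcomm ?L)"
      using gcomm_mono[OF Suc] normal_imp_subgroup[OF N[of "Suc (Suc j)"]]
      by (intro join_subsetI) auto
    finally show ?case by simp
  qed
  have "(agemo_p ^^ (j * n)) T \<subseteq> (gcomm ^^ j) T" for j
  proof (induction j)
    case (Suc j)
    have "(agemo_p ^^ (Suc j * n)) T = (agemo_p ^^ n) ((agemo_p ^^ (j * n)) T)"
      by (simp add: funpow_add)
    also have "\<dots> \<subseteq> (agemo_p ^^ n) ((gcomm ^^ j) T)" by (rule agemo_iter_mono[OF Suc])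
    finally show ?case using step[of j] by simp
  qed auto
  from this[of c] show ?thesis
    using nilpotent normal_one[OF agemo_iter_normal[OF chain_normal[of 0]]] by auto
qed

text \<open>A Frattini argument, valid since \<open>T\<close> is killed both by iterated commutation and by iterated
  \<open>p\<close>-th powers.\<close>

lemma subset_if_subset_frattini:
  assumes A: "A \<lhd> G" and W: "W \<lhd> G" and AT: "A \<subseteq> T"
    and sub: "A \<subseteq> W <#> (agemo_p A <#> gcomm A)"
  shows "A \<subseteq> W"
proof -
  note P = agemo_normal[OF A, of p] and C = gcomm_normal[OF A]
  \<comment> \<open>Two rounds: with \<open>agemo_p A\<close> parked in \<open>W1\<close>, iterated
    commutation gets rid of \<open>gcomm A\<close>; then iterated \<open>p\<close>-th powers get rid
    of \<open>agemo_p A\<close>.\<close>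
  define W1 where "W1 = W <#> agemo_p A"
  have W1: "W1 \<lhd> G" unfolding W1_def by (rule join_normal[OF W P])
  have J: "W1 <#> (gcomm ^^ j) A \<lhd> G" for j by (intro join_normal W1 gcomm_iter_normal A)
  note ge1 = join_ge1[OF W1 gcomm_iter_normal[OF A]] and ge2 = join_ge2[OF W1 gcomm_iter_normal[OF A]]
  have "W <#> (agemo_p A <#> gcomm A) \<subseteq> W1 <#> gcomm A"
    using join_ge1[OF W P] join_ge2[OF W P] ge1[of 1] ge2[of 1]
    by (intro join_subsetI normal_imp_subgroup J[of 1, simplified]) (auto simp: W1_def)
  with sub have A1: "A \<subseteq> W1 <#> gcomm A" by auto
  have "A \<subseteq> W1 <#> (gcomm ^^ j) A" for j
  proof (induction j)
    case 0
    then show ?case using ge2[of 0] by simp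
  next
    case (Suc j)
    have "gcomm (W1 <#> (gcomm ^^ j) A) \<subseteq> W1 <#> (gcomm ^^ Suc j) A"
      using order_trans[OF gcomm_subset[OF W1] ge1[of "Suc j"]] ge2[of "Suc j"]
      by (intro gcomm_join_subsetI W1 gcomm_iter_normal A J) auto
    with gcomm_mono[OF Suc] have "gcomm A \<subseteq> W1 <#> (gcomm ^^ Suc j) A" by blast
    then have "W1 <#> gcomm A \<subseteq> W1 <#> (gcomm ^^ Suc j) A"
      using ge1 by (intro join_subsetI normal_imp_subgroup J)
    with A1 show ?case by blast
  qed
  from this[of c] have "A \<subseteq> W1 <#> {\<one>}"
    using gcomm_iter_mono[OF AT, of c] nilpotent normal_one[OF gcomm_iter_normal[OF A, of c]]
    by (metis subset_singletonD empty_iff)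
  then have A2: "A \<subseteq> W1"
    using join_subsetI[OF normal_imp_subgroup[OF W1], of W1 "{\<one>}"] normal_one[OF W1] by auto
  have J': "W <#> (agemo_p ^^ j) A \<lhd> G" for j by (intro join_normal W agemo_iter_normal A)
  note ge1' = join_ge1[OF W agemo_iter_normal[OF A]] and ge2' = join_ge2[OF W agemo_iter_normal[OF A]]
  have "A \<subseteq> W <#> (agemo_p ^^ j) A" for j
  proof (induction j)
    case 0
    then show ?case using ge2'[of 0 p] by simp
  next
    case (Suc j)
    have "agemo_p (W <#> (agemo_p ^^ j) A) \<subseteq> W <#> (agemo_p ^^ Suc j) A"
      using gcomm_subset[OF W] agemo_subset[OF W, of p] ge1'[of "Suc j" p] ge2'[of "Suc j" p]
      by (intro agemo_join_subsetI W agemo_iter_normal A J') auto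
    with agemo_mono[OF Suc] have "agemo_p A \<subseteq> W <#> (agemo_p ^^ Suc j) A" by blast
    then have "W1 \<subseteq> W <#> (agemo_p ^^ Suc j) A"
      unfolding W1_def using ge1' by (intro join_subsetI normal_imp_subgroup J')
    with A2 show ?case by blast
  qed
  from this[of "c * n"] have "A \<subseteq> W <#> {\<one>}"
    using agemo_iter_mono[OF AT, of "c * n" p] agemo_iter_trivial
      normal_one[OF agemo_iter_normal[OF A, of "c * n" p]]
    by (metis subset_singletonD empty_iff)
  then show ?thesis
    using join_subsetI[OF normal_imp_subgroup[OF W], of W "{\<one>}"] normal_one[OF W] by auto
qed

definition frattini :: "'a set \<Rightarrow> 'a set" where
  "frattini K = agemo_p K <#> gcomm K"

lemma frattini_normal: "K \<lhd> G \<Longrightarrow> frattini K \<lhd> G"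
  unfolding frattini_def by (intro join_normal agemo_normal gcomm_normal)

lemma frattini_ge:
  assumes "K \<lhd> G" shows "agemo_p K \<subseteq> frattini K" "gcomm K \<subseteq> frattini K"
  unfolding frattini_def
  by (intro join_ge1 join_ge2 agemo_normal gcomm_normal assms)+

lemma frattini_subset: "K \<lhd> G \<Longrightarrow> frattini K \<subseteq> K"
  unfolding frattini_def by (intro join_subsetI normal_imp_subgroup agemo_subset gcomm_subset)

text \<open>Membership in \<open>frattini K\<close> with \<open>K = agemo_p (H k)\<close>, rather
  than in \<open>K\<close>, keeps the error inside \<open>K\<close> and also makes it removable by
  the Frattini argument for \<open>K\<close>.\<close>

definition potent_stage :: "nat \<Rightarrow> bool" where
  "potent_stage k \<longleftrightarrow> (gcomm ^^ (p - 1)) (H k) \<subseteq> frattini (agemo_p (H k))"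

text \<open>One inclusion is immediate since the error lies in \<open>K\<close>; in the other
  \<open>K\<close> is bounded by \<open>H (Suc k)\<close> times \<open>frattini K\<close>, and the
  second factor is removed.\<close>

lemma chain_Suc_eq:
  assumes "potent_stage k" shows "H (Suc k) = agemo_p (H k)"
proof
  define K where "K = agemo_p (H k)"
  have K: "K \<lhd> G" unfolding K_def by (rule agemo_normal[OF chain_normal])
  have top: "(gcomm ^^ (p - 1)) (H k) \<subseteq> frattini K"
    using assms by (simp add: potent_stage_def K_def)
  show "H (Suc k) \<subseteq> agemo_p (H k)"
    using top frattini_subset[OF K] K by (intro chain_Suc_subset) (auto simp: K_def)
  note F = frattini_normal[OF K]
  have R: "H (Suc k) <#> frattini K \<lhd> G" by (rule join_normal[OF chain_normal F])
  note ge = join_ge1[OF chain_normal[of "Suc k"] F] join_ge2[OF chain_normal[of "Suc k"] F]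
  have "K \<subseteq> H (Suc k) <#> frattini K"
    unfolding K_def
    using top ge frattini_ge[OF K] by (intro agemo_chain_subset R[unfolded K_def]) (auto simp: K_def)
  moreover have "K \<subseteq> T"
    using agemo_subset[OF chain_normal] chain_subset unfolding K_def by blast
  ultimately show "agemo_p (H k) \<subseteq> H (Suc k)"
    using subset_if_subset_frattini[OF K chain_normal] unfolding frattini_def K_def by blast
qed

text \<open>As \<open>K\<close> is the next \<open>H (Suc k)\<close>, the task is to place
  \<open>A\<close> in \<open>R0\<close>. Moving \<open>p - 1\<close> commutations through
  \<open>agemo_p (H k)\<close> bounds \<open>A\<close> by two terms. The old stage places both in
  \<open>R0\<close> up to \<open>gcomm A\<close>, which a Frattini argument for \<open>A\<close>
  removes.\<close>

lemma potent_stage_Suc: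
  assumes "potent_stage k" shows "potent_stage (Suc k)"
proof -
  define K where "K = agemo_p (H k)"
  have K: "K \<lhd> G" unfolding K_def by (rule agemo_normal[OF chain_normal])
  have PK: "agemo_p K \<lhd> G" by (rule agemo_normal[OF K])
  have top: "(gcomm ^^ (p - 1)) (H k) \<subseteq> frattini K"
    using assms by (simp add: potent_stage_def K_def)
  define A where "A = (gcomm ^^ (p - 1)) K"
  have A: "A \<lhd> G" unfolding A_def by (rule gcomm_iter_normal[OF K])
  define R0 where "R0 = frattini (agemo_p K)"
  have R0: "R0 \<lhd> G" unfolding R0_def by (rule frattini_normal[OF PK])
  \<comment> \<open>\<open>gcomm A\<close> is the \<open>p\<close>-fold commutator of
    \<open>K\<close>, the error of exchanging powers and commutators in \<open>K\<close>.\<close>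
  define R where "R = R0 <#> gcomm A"
  note CA = gcomm_normal[OF A]
  have R: "R \<lhd> G" unfolding R_def by (rule join_normal[OF R0 CA])
  have ge: "R0 \<subseteq> R" "gcomm A \<subseteq> R"
    unfolding R_def by (rule join_ge1[OF R0 CA], rule join_ge2[OF R0 CA])
  have ppK: "agemo_p (agemo_p K) \<subseteq> R" "gcomm (agemo_p K) \<subseteq> R"
    using frattini_ge[OF PK] ge unfolding R0_def by auto
  have Kp: "(gcomm ^^ p) K = gcomm A"
  proof -
    have "p = Suc (p - 1)" using p_ge_2 by simp
    then show ?thesis unfolding A_def by (metis comp_apply funpow.simps(2))
  qed
  have "agemo_p (gcomm K) \<subseteq> R"
    using ppK ge Kp by (intro agemo_gcomm_subset K R) auto
  then have "agemo_p (frattini K) \<subseteq> R"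
    unfolding frattini_def using ppK by (intro agemo_join_subsetI agemo_normal gcomm_normal K R) auto
  then have 1: "agemo_p ((gcomm ^^ (p - 1)) (H k)) \<subseteq> R"
    using agemo_mono[OF top] by blast
  have "(gcomm ^^ (p - 1)) (frattini K)
      \<subseteq> (gcomm ^^ (p - 1)) (agemo_p K) <#> (gcomm ^^ (p - 1)) (gcomm K)"
    unfolding frattini_def by (rule gcomm_iter_join[OF PK gcomm_normal[OF K]])
  also have "\<dots> \<subseteq> R"
  proof (rule join_subsetI[OF normal_imp_subgroup[OF R]])
    show "(gcomm ^^ (p - 1)) (agemo_p K) \<subseteq> R"
    proof -
      have "1 \<le> p - 1" using p_ge_2 by simp
      from gcomm_iter_antimono[OF PK this] ppK(2) show ?thesis by simp
    qed
    have "(gcomm ^^ (p - 1)) (gcomm K) = gcomm A"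
      unfolding A_def by (simp add: funpow_swap1)
    then show "(gcomm ^^ (p - 1)) (gcomm K) \<subseteq> R" using ge by simp
  qed
  finally have "(gcomm ^^ (p - 1)) (frattini K) \<subseteq> R" .
  then have 2: "(gcomm ^^ (p - 1 + (p - 1))) (H k) \<subseteq> R"
    using gcomm_iter_mono[OF top, of "p - 1"] by (auto simp: gcomm_iter_add)
  have "A \<subseteq> agemo_p ((gcomm ^^ (p - 1)) (H k)) <#> (gcomm ^^ (p - 1 + (p - 1))) (H k)"
    unfolding A_def K_def by (rule gcomm_iter_agemo_subset[OF chain_normal])
  also have "\<dots> \<subseteq> R" by (rule join_subsetI[OF normal_imp_subgroup[OF R] 1 2])
  finally have AR: "A \<subseteq> R" .
  have "R \<subseteq> R0 <#> (agemo_p A <#> gcomm A)"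
    using join_ge1[OF R0 frattini_normal[OF A]] join_ge2[OF R0 frattini_normal[OF A]] frattini_ge[OF A]
    unfolding R_def frattini_def[symmetric]
    by (intro join_subsetI normal_imp_subgroup join_normal R0 frattini_normal A) auto
  moreover have "A \<subseteq> T"
    unfolding A_def using gcomm_iter_subset[OF K] agemo_subset[OF chain_normal] chain_subset
    unfolding K_def by blast
  ultimately have "A \<subseteq> R0"
    using AR subset_if_subset_frattini[OF A R0] by blast
  then show ?thesis
    unfolding potent_stage_def chain_Suc_eq[OF assms] A_def R0_def K_def .
qed

text \<open>In the first case \<open>A\<close> lies in \<open>H 1\<close>, hence in \<open>K\<close>
  times \<open>gcomm A\<close>; the Frattini argument yields \<open>A \<subseteq> K\<close>, and one
  more commutation gives \<open>X \<subseteq> gcomm K\<close>. In the second, \<open>H 2\<close> is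
  bounded by powers and commutators of \<open>H 1 \<subseteq> K <#> X\<close>, hence by
  \<open>frattini K\<close> and \<open>frattini X\<close>, and the latter is removed.\<close>

lemma potent_stage_0: "potent_stage 0"
  using potent
proof
  define K where "K = agemo_p T"
  have K: "K \<lhd> G" unfolding K_def by (rule agemo_normal[OF chain_normal])
  define X where "X = (gcomm ^^ (p - 1)) T"
  have X: "X \<lhd> G" unfolding X_def by (rule gcomm_iter_normal[OF chain_normal])
  have J: "K <#> X \<lhd> G" by (rule join_normal[OF K X])
  have H1: "H 1 \<subseteq> K <#> X"
    using chain_Suc_subset[OF J, of 0] join_ge1[OF K X] join_ge2[OF K X]
    by (simp add: K_def X_def)
  {
    assume sub: "(gcomm ^^ (p - 2)) T \<subseteq> H 1"
    define A where "A = (gcomm ^^ (p - 2)) T"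
    have A: "A \<lhd> G" unfolding A_def by (rule gcomm_iter_normal[OF chain_normal])
    have "p - 1 = Suc (p - 2)" using p_ge_2 by simp
    then have XA: "X = gcomm A" unfolding X_def A_def by (metis comp_apply funpow.simps(2))
    have "K <#> X \<subseteq> K <#> frattini A"
      unfolding XA using join_ge1[OF K frattini_normal[OF A]] join_ge2[OF K frattini_normal[OF A]]
        frattini_ge[OF A]
      by (intro join_subsetI normal_imp_subgroup join_normal K frattini_normal A) auto
    moreover have "A \<subseteq> K <#> X" using sub H1 unfolding A_def by blast
    moreover have "A \<subseteq> T" unfolding A_def by (rule gcomm_iter_subset[OF chain_normal])
    ultimately have "A \<subseteq> K"
      using subset_if_subset_frattini[OF A K] unfolding frattini_def by blast
    then have "X \<subseteq> gcomm K" unfolding XA by (rule gcomm_mono)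
    then show ?thesis
      unfolding potent_stage_def using frattini_ge[OF K] unfolding X_def K_def by blast
  }
  {
    assume sub: "(gcomm ^^ (p - 1)) T \<subseteq> H 2"
    note FK = frattini_normal[OF K] and FX = frattini_normal[OF X]
    define R where "R = frattini K <#> frattini X"
    have R: "R \<lhd> G" unfolding R_def by (rule join_normal[OF FK FX])
    have ge: "frattini K \<subseteq> R" "frattini X \<subseteq> R"
      unfolding R_def by (rule join_ge1[OF FK FX], rule join_ge2[OF FK FX])
    have "agemo_p (K <#> X) \<subseteq> R"
      using ge frattini_ge[OF K] frattini_ge[OF X] by (intro agemo_join_subsetI K X R) auto
    then have 1: "agemo_p (H 1) \<subseteq> R" using agemo_mono[OF H1] by blast
    have "gcomm (K <#> X) \<subseteq> R"
      using ge frattini_ge[OF K] frattini_ge[OF X] by (intro gcomm_join_subsetI K X R) auto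
    moreover have "(gcomm ^^ (p - 1)) (H 1) \<subseteq> gcomm (H 1)"
      using gcomm_iter_antimono[OF chain_normal, of 1 "p - 1"] p_ge_2 by simp
    ultimately have 2: "(gcomm ^^ (p - 1)) (H 1) \<subseteq> R" using gcomm_mono[OF H1] by blast
    have "H 2 \<subseteq> R" using chain_Suc_subset[OF R 1 2] by (simp add: numeral_2_eq_2)
    then have "X \<subseteq> R" using sub unfolding X_def by blast
    moreover have "X \<subseteq> T" unfolding X_def by (rule gcomm_iter_subset[OF chain_normal])
    ultimately have "X \<subseteq> frattini K"
      using subset_if_subset_frattini[OF X FK] unfolding R_def frattini_def[of X] by blast
    then show ?thesis unfolding potent_stage_def X_def K_def .
  }
qed

theorem chain_pow_eq_one:
  assumes "t \<in> T" shows "t [^] (p ^ n) = \<one>"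
proof -
  have stage: "potent_stage k" for k
    by (induction k) (auto intro: potent_stage_0 potent_stage_Suc)
  have "H k = (agemo_p ^^ k) T" for k
    by (induction k) (simp_all add: chain_Suc_eq[OF stage])
  then have "(agemo_p ^^ n) T = {\<one>}" using chain_trivial by metis
  with agemo_iter_pow[OF assms normal_carrier[OF chain_normal], of p n] show ?thesis by simp
qed

end

section \<open>Nilpotency of finite p-groups\<close>

text \<open>The class equation: were the identity the only central element, all other conjugacy
  classes would have size divisible by \<open>p\<close>, and the order would be 1 modulo
  \<open>p\<close>.\<close>

lemma (in group) prime_power_order_center:
  assumes p: "Factorial_Ring.prime p" and ord: "order G = p ^ k" and nontriv: "carrier G \<noteq> {\<one>}"
  shows "\<exists>z\<in>carrier G. z \<noteq> \<one> \<and> (\<forall>y\<in>carrier G. z \<otimes> y = y \<otimes> z)"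
proof (rule ccontr)
  assume no: "\<not> ?thesis"
  let ?\<phi> = "\<lambda>g. \<lambda>h\<in>carrier G. g \<otimes> h \<otimes> inv g"
  interpret act: group_action G "carrier G" ?\<phi> by (rule action_by_conjugation)
  let ?O = "orbits G (carrier G) ?\<phi>"
  have p0: "p > 0" using p prime_gt_0_nat by simp
  have fin: "finite (carrier G)"
    using ord p0 by (metis order_gt_0_iff_finite zero_less_power)
  have "1 < order G"
  proof -
    have "{\<one>} \<subset> carrier G" using nontriv by auto
    from psubset_card_mono[OF fin this] show ?thesis by (simp add: order_def)
  qed
  then have k: "k > 0" using ord by (cases k) auto
  interpret part: partition "carrier G" ?O by (rule act.orbit_partition)
  have orbit_dvd: "p dvd card c" if c: "c \<in> ?O" "c \<noteq> {\<one>}" for c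
  proof -
    obtain x where x: "x \<in> carrier G" "c = orbit G ?\<phi> x" using c by (auto simp: orbits_def)
    have "card c dvd p ^ k"
      using dvd_triv_left[of "card c"] unfolding act.orbit_stabilizer_theorem[OF x(1), folded x(2), unfolded ord, symmetric] .
    then obtain i where i: "card c = p ^ i" using divides_primepow_nat[OF p] by blast
    have "i \<noteq> 0"
    proof
      assume "i = 0"
      then obtain a where a: "c = {a}" using i by (auto simp: card_1_singleton_iff)
      then have "c = {x}" using act.orbit_refl[OF x(1)] x(2) by auto
      then have fix_x: "y \<otimes> x \<otimes> inv y = x" if "y \<in> carrier G" for y
        using that x by (auto simp: orbit_def)
      have comm: "x \<otimes> y = y \<otimes> x" if y: "y \<in> carrier G" for y
      proof -
        have "x \<otimes> y = y \<otimes> x \<otimes> inv y \<otimes> y" using fix_x[OF y] by simp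
        then show ?thesis using y x by (simp add: m_assoc)
      qed
      moreover have "x \<noteq> \<one>" using c(2) \<open>c = {x}\<close> by simp
      ultimately show False using no x(1) by blast
    qed
    then show ?thesis using i by (simp add: dvd_power)
  qed
  have one_orbit: "{\<one>} \<in> ?O"
  proof -
    have "orbit G ?\<phi> \<one> = {\<one>}" using one_closed by (force simp: orbit_def)
    then show ?thesis using one_closed by (auto simp: orbits_def)
  qed
  have finO: "finite ?O" by (simp add: orbits_def fin)
  have "order G = sum card ?O"
  proof -
    have "card (\<Union>?O) = sum card ?O"
    proof (rule card_Union_disjoint)
      show "pairwise disjnt ?O"
        unfolding pairwise_def disjnt_def using part.disjoint_union by blast
      show "finite c" if "c \<in> ?O" for c
      proof (rule finite_subset[OF _ fin])
        show "c \<subseteq> carrier G" using Union_upper[OF that] part.partition_coverture by simp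
      qed
    qed
    then show ?thesis by (simp add: order_def part.partition_coverture)
  qed
  also have "\<dots> = 1 + sum card (?O - {{\<one>}})"
    using sum.remove[OF finO one_orbit, of card] by simp
  finally have eq: "1 + sum card (?O - {{\<one>}}) = p ^ k" using ord by simp
  have dvd: "p dvd sum card (?O - {{\<one>}})"
    by (rule dvd_sum) (use orbit_dvd in blast)
  have "p dvd p ^ k" using k by (simp add: dvd_power)
  then have "p dvd 1" unfolding eq[symmetric] using dvd_add_left_iff[OF dvd, of 1] by blast
  with p show False by (simp add: prime_nat_iff)
qed

text \<open>The upper central series, climbed from an arbitrary \<open>R\<close> so that the
  induction can enlarge \<open>R\<close>; nilpotency is the case of trivial
  \<open>R\<close>.\<close>

lemma (in group) prime_power_order_gcomm:
  assumes p: "Factorial_Ring.prime p" and ord: "order G = p ^ k" and R: "R \<lhd> G"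
  shows "\<exists>c. (gcomm ^^ c) (carrier G) \<subseteq> R"
  using R
proof (induction "card (carrier G) - card R" arbitrary: R rule: less_induct)
  case less
  note R = less.prems
  have p0: "p > 0" using p prime_gt_0_nat by simp
  have fin: "finite (carrier G)"
    using ord p0 by (metis order_gt_0_iff_finite zero_less_power)
  show ?case
  proof (cases "R = carrier G")
    case True
    then show ?thesis by (intro exI[of _ 0]) simp
  next
    case False
    interpret R: normal R G by (rule R)
    interpret Q: group "G Mod R" by (rule R.factorgroup_is_group)
    have "order (G Mod R) * card R = order G"
      by (simp add: FactGroup_def lagrange order_def R.subgroup_axioms)
    then have "order (G Mod R) dvd p ^ k" using ord by (metis dvd_triv_left)
    then obtain i where "order (G Mod R) = p ^ i" using divides_primepow_nat[OF p] by blast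
    from Q.prime_power_order_center[OF p this] obtain z
      where z: "z \<in> carrier (G Mod R)" "z \<noteq> \<one>\<^bsub>G Mod R\<^esub>"
        "\<And>y. y \<in> carrier (G Mod R) \<Longrightarrow> z \<otimes>\<^bsub>G Mod R\<^esub> y = y \<otimes>\<^bsub>G Mod R\<^esub> z"
      using False R.fact_group_trivial_iff[OF fin] by blast
    then obtain x where x: "x \<in> carrier G" "z = R #> x"
      by (auto simp: FactGroup_def RCOSETS_def)
    have xR: "x \<notin> R" using z(2) x R.rcos_const[OF is_group] by (auto simp: FactGroup_def)
    have xz: "commutator x y \<in> R" if y: "y \<in> carrier G" for y
    proof -
      have "R #> y \<in> carrier (G Mod R)" using y by (auto simp: FactGroup_def RCOSETS_def)
      from z(3)[OF this] have "R #> (x \<otimes> y) = R #> (y \<otimes> x)"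
        using x y by (simp add: R.rcos_sum)
      then have "x \<otimes> y \<in> R #> (y \<otimes> x)"
        using x y by (metis m_closed rcos_self R.subgroup_axioms)
      then obtain r where r: "r \<in> R" "x \<otimes> y = r \<otimes> (y \<otimes> x)" by (auto simp: r_coset_def)
      then have "commutator x y = r"
        using x y R.mem_carrier[OF r(1)] unfolding commutator_def r(2)
        by (simp add: group_word_simps)
      then show ?thesis using r by simp
    qed
    \<comment> \<open>The preimage of the centre of \<open>G Mod R\<close>, which contains
      \<open>R\<close> and also the element \<open>x\<close> outside it.\<close>
    let ?X = "{x \<in> carrier G. \<forall>y\<in>carrier G. commutator x y \<in> R}"
    let ?Z = "generate G ?X"
    have Z: "?Z \<lhd> G"
    proof (rule normal_generateI)
      fix h g assume h: "h \<in> ?X" and g: "g \<in> carrier G"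
      have "commutator (g \<otimes> h \<otimes> inv g) y \<in> R" if y: "y \<in> carrier G" for y
      proof -
        have "g \<otimes> commutator h (inv g \<otimes> y \<otimes> g) \<otimes> inv g \<in> R"
          using h g y by (intro normal_conj[OF R]) auto
        also have "g \<otimes> commutator h (inv g \<otimes> y \<otimes> g) \<otimes> inv g = commutator (g \<otimes> h \<otimes> inv g) y"
          using h g y by (simp add: commutator_def group_word_simps)
        finally show ?thesis .
      qed
      then show "g \<otimes> h \<otimes> inv g \<in> ?X" using h g by simp
    qed auto
    have RZ: "R \<subset> ?Z"
    proof
      have "R \<subseteq> ?X" using gcommI(2)[OF normal_carrier[OF R]] gcomm_subset[OF R] normal_carrier[OF R] by auto
      then show "R \<subseteq> ?Z" by (auto intro: generate.incl)
      have "x \<in> ?Z" using x xz by (intro generate.incl) auto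
      then show "R \<noteq> ?Z" using xR by auto
    qed
    have Zc: "?Z \<subseteq> carrier G" by (rule normal_carrier[OF Z])
    have "card R < card ?Z" "card ?Z \<le> card (carrier G)"
      using RZ Zc fin by (auto intro: psubset_card_mono card_mono finite_subset)
    then obtain c where c: "(gcomm ^^ c) (carrier G) \<subseteq> ?Z"
      using less.hyps[OF _ Z] by fastforce
    have "gcomm ?Z \<subseteq> R" by (rule gcomm_generate_subsetI[OF R]) auto
    with gcomm_mono[OF c] show ?thesis by (intro exI[of _ "Suc c"]) auto
  qed
qed


section \<open>Homomorphisms from presented groups\<close>

primrec word_eval :: "('b, 'c) monoid_scheme \<Rightarrow> ('s \<Rightarrow> 'b) \<Rightarrow> 's word \<Rightarrow> 'b" where
  "word_eval H f [] = \<one>\<^bsub>H\<^esub>"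
| "word_eval H f (a # w) = (if fst a then f (snd a) else inv\<^bsub>H\<^esub> f (snd a)) \<otimes>\<^bsub>H\<^esub> word_eval H f w"

lemma (in group) word_eval_closed:
  "\<lbrakk>\<And>s. s \<in> S \<Longrightarrow> f s \<in> carrier G; w \<in> lists (UNIV \<times> S)\<rbrakk> \<Longrightarrow> word_eval G f w \<in> carrier G"
  by (induction w) auto

lemma (in group) word_eval_append:
  "\<lbrakk>\<And>s. s \<in> S \<Longrightarrow> f s \<in> carrier G; u \<in> lists (UNIV \<times> S); v \<in> lists (UNIV \<times> S)\<rbrakk>
    \<Longrightarrow> word_eval G f (u @ v) = word_eval G f u \<otimes> word_eval G f v"
proof (induction u)
  case Nil
  then show ?case using word_eval_closed[of S f v] by simp
next
  case (Cons a u)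
  then have "snd a \<in> S" "u \<in> lists (UNIV \<times> S)" by auto
  with Cons word_eval_closed[of S f u] word_eval_closed[of S f v] show ?case
    by (auto simp: m_assoc)
qed

lemma (in group) word_eval_eq:
  assumes f: "\<And>s. s \<in> S \<Longrightarrow> f s \<in> carrier G"
    and rel: "\<And>u v. \<lbrakk>(u, v) \<in> R; u \<in> lists (UNIV \<times> S); v \<in> lists (UNIV \<times> S)\<rbrakk>
      \<Longrightarrow> word_eval G f u = word_eval G f v"
  shows "word_eq S R u v \<Longrightarrow> word_eval G f u = word_eval G f v"
proof (induction rule: word_eq.induct)
  case (append u v u' v')
  then have "u \<in> lists (UNIV \<times> S)" "v \<in> lists (UNIV \<times> S)"
    "u' \<in> lists (UNIV \<times> S)" "v' \<in> lists (UNIV \<times> S)"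
    using word_eq_lists by blast+
  with append.IH show ?case
    by (simp only: word_eval_append[of S f, OF f])
next
  case (cancel s b)
  then show ?case using f by simp
qed (auto dest: rel)

lemma (in group) presented_group_lift:
  assumes f: "\<And>s. s \<in> S \<Longrightarrow> f s \<in> carrier G"
    and rel: "\<And>u v. \<lbrakk>(u, v) \<in> R; u \<in> lists (UNIV \<times> S); v \<in> lists (UNIV \<times> S)\<rbrakk>
      \<Longrightarrow> word_eval G f u = word_eval G f v"
  shows "\<exists>\<phi>\<in>hom (presented_group S R) G. \<forall>s\<in>S. \<phi> (word_rel S R `` {[(True, s)]}) = f s"
proof -
  \<comment> \<open>Any representative may be evaluated, by \<open>word_eval_eq\<close>.\<close>
  define \<phi> where "\<phi> A = word_eval G f (SOME w. w \<in> A)" for A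
  have \<phi>: "\<phi> (word_rel S R `` {u}) = word_eval G f u" if "u \<in> lists (UNIV \<times> S)" for u
  proof -
    have "u \<in> word_rel S R `` {u}" using that by (auto simp: word_rel_def intro: word_eq.refl)
    then have "(SOME w. w \<in> word_rel S R `` {u}) \<in> word_rel S R `` {u}" by (rule someI)
    then have "word_eq S R u (SOME w. w \<in> word_rel S R `` {u})" by (simp add: word_rel_def)
    from word_eval_eq[OF f rel this] show ?thesis by (simp add: \<phi>_def)
  qed
  have "\<phi> \<in> hom (presented_group S R) G"
  proof (rule homI)
    fix x assume "x \<in> carrier (presented_group S R)"
    then obtain u where u: "u \<in> lists (UNIV \<times> S)" "x = word_rel S R `` {u}"
      unfolding carrier_presented_group by (rule imageE)
    then show "\<phi> x \<in> carrier G" using \<phi> word_eval_closed[of S f, OF f] by metis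
    fix y assume "y \<in> carrier (presented_group S R)"
    then obtain v where v: "v \<in> lists (UNIV \<times> S)" "y = word_rel S R `` {v}"
      unfolding carrier_presented_group by (rule imageE)
    have "u @ v \<in> lists (UNIV \<times> S)"
      using u(1) v(1) by (simp only: append_in_lists_conv)
    then show "\<phi> (x \<otimes>\<^bsub>presented_group S R\<^esub> y) = \<phi> x \<otimes> \<phi> y"
      unfolding u(2) v(2) presented_group_mult[OF u(1) v(1)]
      using \<phi> u v word_eval_append[of S f, OF f] by metis
  qed
  moreover have "\<phi> (word_rel S R `` {[(True, s)]}) = f s" if "s \<in> S" for s
    using \<phi>[of "[(True, s)]"] that f by simp
  ultimately show ?thesis by blast
qed

lemma presented_group_generate:
  "carrier (presented_group S R)
    = generate (presented_group S R) ((\<lambda>s. word_rel S R `` {[(True, s)]}) ` S)"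
  (is "carrier ?P = generate ?P ?X")
proof
  interpret P: group ?P by (rule group_presented_group)
  let ?q = "\<lambda>w. word_rel S R `` {w}"
  have cl: "?q w \<in> carrier ?P" if "w \<in> lists (UNIV \<times> S)" for w
    unfolding carrier_presented_group using that by (rule imageI)
  have X: "?X \<subseteq> carrier ?P" using cl by auto
  show "generate ?P ?X \<subseteq> carrier ?P" using P.generate_incl[OF X] .
  have letter: "?q [(b, s)] \<in> generate ?P ?X" if s: "s \<in> S" for b s
  proof (cases b)
    case True
    then show ?thesis using s by (auto intro: generate.incl)
  next
    case False
    have l: "[(False, s)] \<in> lists (UNIV \<times> S)" "[(True, s)] \<in> lists (UNIV \<times> S)" using s by auto
    have "word_eq S R [(False, s), (True, s)] []"
      using word_eq.cancel[OF s, of R False] by simp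
    then have "?q ([(False, s)] @ [(True, s)]) = ?q []"
      by (intro equiv_class_eq[OF equiv_word_rel]) (simp add: word_rel_def)
    then have "?q [(False, s)] \<otimes>\<^bsub>?P\<^esub> ?q [(True, s)] = \<one>\<^bsub>?P\<^esub>"
      by (simp only: presented_group_mult[OF l] one_presented_group)
    then have "inv\<^bsub>?P\<^esub> ?q [(True, s)] = ?q [(False, s)]"
      by (intro P.inv_equality cl l)
    then show ?thesis using False s generate.inv[of "?q [(True, s)]" ?X ?P] by auto
  qed
  have "?q w \<in> generate ?P ?X" if "w \<in> lists (UNIV \<times> S)" for w
    using that
  proof (induction w)
    case Nil
    then show ?case using generate.one[of ?P ?X] by (simp only: one_presented_group)
  next
    case (Cons a w)
    obtain b s where a: "a = (b, s)" by force
    have l: "[(b, s)] \<in> lists (UNIV \<times> S)" and s: "s \<in> S" using Cons.hyps a by auto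
    have "?q (a # w) = ?q [(b, s)] \<otimes>\<^bsub>?P\<^esub> ?q w"
      unfolding presented_group_mult[OF l Cons.hyps(2)] a by simp
    then show ?case using generate.eng[OF letter[OF s] Cons.IH] by (simp only:)
  qed
  then show "carrier ?P \<subseteq> generate ?P ?X"
    unfolding carrier_presented_group by blast
qed


section \<open>The action and the boundary on the tensor square\<close>

context group
begin

text \<open>The equations \<open>left\<close> and \<open>right\<close> define a crossed pairing.
  This universal property yields the boundary, the action and, later, the commutator pairing of a
  central extension.\<close>

lemma tensor_square_lift:
  assumes H: "group H" and \<beta>: "\<And>g h. \<lbrakk>g \<in> carrier G; h \<in> carrier G\<rbrakk> \<Longrightarrow> \<beta> g h \<in> carrier H"
    and left: "\<And>g g' h. \<lbrakk>g \<in> carrier G; g' \<in> carrier G; h \<in> carrier G\<rbrakk>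
      \<Longrightarrow> \<beta> (g \<otimes> g') h = \<beta> (conj_act G g g') (conj_act G g h) \<otimes>\<^bsub>H\<^esub> \<beta> g h"
    and right: "\<And>g h h'. \<lbrakk>g \<in> carrier G; h \<in> carrier G; h' \<in> carrier G\<rbrakk>
      \<Longrightarrow> \<beta> g (h \<otimes> h') = \<beta> g h \<otimes>\<^bsub>H\<^esub> \<beta> (conj_act G h g) (conj_act G h h')"
  shows "\<exists>\<phi>. \<phi> \<in> hom (tensor_square G) H \<and> (\<forall>g\<in>carrier G. \<forall>h\<in>carrier G. \<phi> (tensor G g h) = \<beta> g h)"
proof -
  interpret H: group H by (rule H)
  have "\<exists>\<phi>\<in>hom (presented_group (carrier G \<times> carrier G) (tensor_relations G)) H.
      \<forall>s\<in>carrier G \<times> carrier G.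
        \<phi> (word_rel (carrier G \<times> carrier G) (tensor_relations G) `` {[(True, s)]}) = case_prod \<beta> s"
  proof (rule H.presented_group_lift)
    fix u v assume "(u, v) \<in> tensor_relations G"
    then show "word_eval H (case_prod \<beta>) u = word_eval H (case_prod \<beta>) v"
      unfolding tensor_relations_def
      by (auto simp: \<beta> left right)
  qed (auto simp: \<beta>)
  then show ?thesis
    unfolding tensor_square_def[symmetric] tensor_def[symmetric] by (auto simp: tensor_def)
qed

lemma tensor_square_generate:
  "carrier (tensor_square G)
    = generate (tensor_square G) {tensor G g h | g h. g \<in> carrier G \<and> h \<in> carrier G}"
proof -
  have "{tensor G g h | g h. g \<in> carrier G \<and> h \<in> carrier G}
    = (\<lambda>s. word_rel (carrier G \<times> carrier G) (tensor_relations G) `` {[(True, s)]}) ` (carrier G \<times> carrier G)"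
    by (auto simp: tensor_def)
  then show ?thesis
    unfolding tensor_square_def using presented_group_generate by metis
qed

lemma tensor_square_induct [consumes 1, case_names one tensor inv mult]:
  assumes "t \<in> carrier (tensor_square G)"
    and "P \<one>\<^bsub>tensor_square G\<^esub>"
    and tensor: "\<And>g h. \<lbrakk>g \<in> carrier G; h \<in> carrier G\<rbrakk> \<Longrightarrow> P (tensor G g h)"
    and "\<And>s. \<lbrakk>s \<in> carrier (tensor_square G); P s\<rbrakk> \<Longrightarrow> P (inv\<^bsub>tensor_square G\<^esub> s)"
    and "\<And>s t. \<lbrakk>s \<in> carrier (tensor_square G); t \<in> carrier (tensor_square G); P s; P t\<rbrakk>
      \<Longrightarrow> P (s \<otimes>\<^bsub>tensor_square G\<^esub> t)"
  shows "P t"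
proof -
  have "t \<in> generate (tensor_square G) {tensor G g h | g h. g \<in> carrier G \<and> h \<in> carrier G}"
    using assms(1) tensor_square_generate by simp
  then show ?thesis
  proof (induction rule: generate.induct)
    case (inv h)
    then obtain g k where "h = tensor G g k" "g \<in> carrier G" "k \<in> carrier G" by auto
    then show ?case using assms(4)[of h] tensor tensor_closed by metis
  next
    case (eng s t)
    then have "s \<in> carrier (tensor_square G)" "t \<in> carrier (tensor_square G)"
      unfolding tensor_square_generate by simp_all
    then show ?case using eng.IH by (rule assms(5))
  qed (use assms(2,3) in auto)
qed

lemma tensor_square_hom_eqI:
  assumes K: "group K" and \<phi>: "\<phi> \<in> hom (tensor_square G) K" and \<psi>: "\<psi> \<in> hom (tensor_square G) K"
    and eq: "\<And>g h. \<lbrakk>g \<in> carrier G; h \<in> carrier G\<rbrakk> \<Longrightarrow> \<phi> (tensor G g h) = \<psi> (tensor G g h)"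
    and t: "t \<in> carrier (tensor_square G)"
  shows "\<phi> t = \<psi> t"
proof -
  interpret \<phi>: group_hom "tensor_square G" K \<phi>
    using K \<phi> group_tensor_square by (simp add: group_hom_def group_hom_axioms_def)
  interpret \<psi>: group_hom "tensor_square G" K \<psi>
    using K \<psi> group_tensor_square by (simp add: group_hom_def group_hom_axioms_def)
  from t show ?thesis
    by (induction rule: tensor_square_induct) (simp_all add: eq)
qed

text \<open>On the carrier the choice is unique, since tensors generate.\<close>

definition tensor_boundary :: "('a \<times> 'a) word set \<Rightarrow> 'a" where
  "tensor_boundary = (SOME \<phi>. \<phi> \<in> hom (tensor_square G) G \<and>
     (\<forall>g\<in>carrier G. \<forall>h\<in>carrier G. \<phi> (tensor G g h) = commutator g h))"

definition tensor_act :: "'a \<Rightarrow> ('a \<times> 'a) word set \<Rightarrow> ('a \<times> 'a) word set" where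
  "tensor_act k = (SOME \<phi>. \<phi> \<in> hom (tensor_square G) (tensor_square G) \<and>
     (\<forall>g\<in>carrier G. \<forall>h\<in>carrier G. \<phi> (tensor G g h) = tensor G (conj_act G k g) (conj_act G k h)))"

lemma tensor_boundary:
  shows tensor_boundary_hom: "tensor_boundary \<in> hom (tensor_square G) G"
    and tensor_boundary_tensor:
      "\<lbrakk>g \<in> carrier G; h \<in> carrier G\<rbrakk> \<Longrightarrow> tensor_boundary (tensor G g h) = commutator g h"
proof -
  have "\<exists>\<phi>. \<phi> \<in> hom (tensor_square G) G \<and>
     (\<forall>g\<in>carrier G. \<forall>h\<in>carrier G. \<phi> (tensor G g h) = commutator g h)"
    by (rule tensor_square_lift) (simp_all add: is_group commutator_def conj_act_def group_word_simps)
  from someI_ex[OF this] show "tensor_boundary \<in> hom (tensor_square G) G"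
    "\<lbrakk>g \<in> carrier G; h \<in> carrier G\<rbrakk> \<Longrightarrow> tensor_boundary (tensor G g h) = commutator g h"
    unfolding tensor_boundary_def by blast+
qed

lemma conj_act_conj_act_swap:
  "\<lbrakk>k \<in> carrier G; g \<in> carrier G; h \<in> carrier G\<rbrakk>
    \<Longrightarrow> conj_act G k (conj_act G g h) = conj_act G (conj_act G k g) (conj_act G k h)"
  by (simp add: conj_act_def group_word_simps)

lemma tensor_act:
  assumes k: "k \<in> carrier G"
  shows tensor_act_hom: "tensor_act k \<in> hom (tensor_square G) (tensor_square G)"
    and tensor_act_tensor: "\<lbrakk>g \<in> carrier G; h \<in> carrier G\<rbrakk>
      \<Longrightarrow> tensor_act k (tensor G g h) = tensor G (conj_act G k g) (conj_act G k h)"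
proof -
  have "\<exists>\<phi>. \<phi> \<in> hom (tensor_square G) (tensor_square G) \<and>
     (\<forall>g\<in>carrier G. \<forall>h\<in>carrier G. \<phi> (tensor G g h) = tensor G (conj_act G k g) (conj_act G k h))"
    by (rule tensor_square_lift)
      (use k in \<open>simp_all add: group_tensor_square tensor_closed conj_act_mult tensor_mult_left
        tensor_mult_right conj_act_conj_act_swap[of k]\<close>)
  from someI_ex[OF this] show "tensor_act k \<in> hom (tensor_square G) (tensor_square G)"
    "\<lbrakk>g \<in> carrier G; h \<in> carrier G\<rbrakk>
      \<Longrightarrow> tensor_act k (tensor G g h) = tensor G (conj_act G k g) (conj_act G k h)"
    unfolding tensor_act_def by blast+
qed

lemma tensor_one_left:
  assumes "h \<in> carrier G" shows "tensor G \<one> h = \<one>\<^bsub>tensor_square G\<^esub>"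
proof -
  interpret T: group "tensor_square G" by (rule group_tensor_square)
  have "tensor G \<one> h \<otimes>\<^bsub>tensor_square G\<^esub> tensor G \<one> h = tensor G \<one> h"
    using tensor_mult_left[of \<one> \<one> h] assms by (simp add: conj_act_def)
  then show ?thesis using tensor_closed[OF one_closed assms] by (simp add: T.r_cancel_one)
qed

section \<open>Rules for the action and the boundary\<close>

lemma tensor_act_closed:
  "\<lbrakk>k \<in> carrier G; t \<in> carrier (tensor_square G)\<rbrakk> \<Longrightarrow> tensor_act k t \<in> carrier (tensor_square G)"
  using tensor_act_hom by (auto simp: hom_def)

lemma tensor_boundary_closed: "t \<in> carrier (tensor_square G) \<Longrightarrow> tensor_boundary t \<in> carrier G"
  using tensor_boundary_hom by (auto simp: hom_def)

lemma tensor_act_mult: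
  "\<lbrakk>k \<in> carrier G; s \<in> carrier (tensor_square G); t \<in> carrier (tensor_square G)\<rbrakk> \<Longrightarrow>
    tensor_act k (s \<otimes>\<^bsub>tensor_square G\<^esub> t) = tensor_act k s \<otimes>\<^bsub>tensor_square G\<^esub> tensor_act k t"
  using tensor_act_hom by (auto simp: hom_def)

lemma tensor_boundary_mult:
  "\<lbrakk>s \<in> carrier (tensor_square G); t \<in> carrier (tensor_square G)\<rbrakk> \<Longrightarrow>
    tensor_boundary (s \<otimes>\<^bsub>tensor_square G\<^esub> t) = tensor_boundary s \<otimes> tensor_boundary t"
  using tensor_boundary_hom by (auto simp: hom_def)

lemma tensor_act_one_right: "k \<in> carrier G \<Longrightarrow> tensor_act k \<one>\<^bsub>tensor_square G\<^esub> = \<one>\<^bsub>tensor_square G\<^esub>"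
  using hom_one[OF tensor_act_hom group_tensor_square group_tensor_square] .

lemma tensor_boundary_one: "tensor_boundary \<one>\<^bsub>tensor_square G\<^esub> = \<one>"
  using hom_one[OF tensor_boundary_hom group_tensor_square is_group] .

lemma tensor_act_inv:
  assumes "k \<in> carrier G" "t \<in> carrier (tensor_square G)"
  shows "tensor_act k (inv\<^bsub>tensor_square G\<^esub> t) = inv\<^bsub>tensor_square G\<^esub> tensor_act k t"
proof -
  interpret act: group_hom "tensor_square G" "tensor_square G" "tensor_act k"
    using tensor_act_hom[OF assms(1)] group_tensor_square by (simp add: group_hom_def group_hom_axioms_def)
  show ?thesis using assms(2) by (rule act.hom_inv)
qed

lemma tensor_boundary_inv:
  assumes "t \<in> carrier (tensor_square G)"
  shows "tensor_boundary (inv\<^bsub>tensor_square G\<^esub> t) = inv tensor_boundary t"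
proof -
  interpret bd: group_hom "tensor_square G" G tensor_boundary
    using tensor_boundary_hom group_tensor_square by (simp add: group_hom_def group_hom_axioms_def is_group)
  show ?thesis using assms by (rule bd.hom_inv)
qed

lemma tensor_act_act:
  assumes "k \<in> carrier G" "l \<in> carrier G" "t \<in> carrier (tensor_square G)"
  shows "tensor_act k (tensor_act l t) = tensor_act (k \<otimes> l) t"
proof -
  have "(tensor_act k \<circ> tensor_act l) t = tensor_act (k \<otimes> l) t"
  proof (rule tensor_square_hom_eqI[OF group_tensor_square _ _ _ assms(3)])
    show "tensor_act k \<circ> tensor_act l \<in> hom (tensor_square G) (tensor_square G)"
      by (rule Group.hom_compose[OF tensor_act_hom[OF assms(2)] tensor_act_hom[OF assms(1)]])
  qed (use assms in \<open>simp_all add: tensor_act_hom tensor_act_tensor conj_act_conj_act\<close>)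
  then show ?thesis by simp
qed

lemma tensor_act_one_left:
  assumes "t \<in> carrier (tensor_square G)" shows "tensor_act \<one> t = t"
proof (rule tensor_square_hom_eqI[OF group_tensor_square _ _ _ assms])
  show "(\<lambda>t. t) \<in> hom (tensor_square G) (tensor_square G)" by (simp add: hom_def)
qed (simp_all add: tensor_act_hom tensor_act_tensor conj_act_def)

text \<open>The Peiffer identity of the crossed module \<open>G \<otimes> G \<rightarrow> G\<close>.\<close>

lemma tensor_act_boundary:
  assumes s: "s \<in> carrier (tensor_square G)" and t: "t \<in> carrier (tensor_square G)"
  shows "tensor_act (tensor_boundary s) t = s \<otimes>\<^bsub>tensor_square G\<^esub> t \<otimes>\<^bsub>tensor_square G\<^esub> inv\<^bsub>tensor_square G\<^esub> s"
proof -
  let ?T = "tensor_square G"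
  interpret T: group ?T by (rule group_tensor_square)
  from s have "\<forall>t\<in>carrier ?T. tensor_act (tensor_boundary s) t = s \<otimes>\<^bsub>?T\<^esub> t \<otimes>\<^bsub>?T\<^esub> inv\<^bsub>?T\<^esub> s"
  proof (induction rule: tensor_square_induct)
    case one
    then show ?case by (simp add: tensor_boundary_one tensor_act_one_left)
  next
    case (tensor x y)
    show ?case
    proof
      fix t assume t: "t \<in> carrier ?T"
      note s = tensor_closed[OF tensor]
      show "tensor_act (tensor_boundary (tensor G x y)) t = tensor G x y \<otimes>\<^bsub>?T\<^esub> t \<otimes>\<^bsub>?T\<^esub> inv\<^bsub>?T\<^esub> tensor G x y"
      proof (rule tensor_square_hom_eqI[OF group_tensor_square _ _ _ t])
        show "tensor_act (tensor_boundary (tensor G x y)) \<in> hom ?T ?T"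
          using s by (intro tensor_act_hom tensor_boundary_closed)
        show "(\<lambda>t. tensor G x y \<otimes>\<^bsub>?T\<^esub> t \<otimes>\<^bsub>?T\<^esub> inv\<^bsub>?T\<^esub> tensor G x y) \<in> hom ?T ?T"
          using s by (auto simp: hom_def T.group_word_simps)
        fix g h assume gh: "g \<in> carrier G" "h \<in> carrier G"
        \<comment> \<open>Undoing conjugation by \<open>y x\<close> beforehand makes
          \<open>tensor_conj\<close> speak about \<open>tensor G g h\<close> itself and leaves
          \<open>x y (y x)^-1 = [x, y]\<close> as the acting element.\<close>
        let ?g = "conj_act G (inv (y \<otimes> x)) g" and ?h = "conj_act G (inv (y \<otimes> x)) h"
        have "tensor G (conj_act G (x \<otimes> y) ?g) (conj_act G (x \<otimes> y) ?h) \<otimes>\<^bsub>?T\<^esub> tensor G x y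
          = tensor G x y \<otimes>\<^bsub>?T\<^esub> tensor G (conj_act G (y \<otimes> x) ?g) (conj_act G (y \<otimes> x) ?h)"
          using tensor gh by (intro tensor_conj) auto
        moreover have "conj_act G (y \<otimes> x) ?g = g" "conj_act G (y \<otimes> x) ?h = h"
          "conj_act G (x \<otimes> y) ?g = conj_act G (commutator x y) g"
          "conj_act G (x \<otimes> y) ?h = conj_act G (commutator x y) h"
          using tensor gh by (simp_all add: conj_act_def commutator_def group_word_simps)
        ultimately have "tensor_act (commutator x y) (tensor G g h) \<otimes>\<^bsub>?T\<^esub> tensor G x y
            = tensor G x y \<otimes>\<^bsub>?T\<^esub> tensor G g h"
          using tensor gh by (simp add: tensor_act_tensor)
        moreover have "tensor_act (commutator x y) (tensor G g h) \<in> carrier ?T"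
          using tensor gh by (intro tensor_act_closed tensor_closed) auto
        ultimately show "tensor_act (tensor_boundary (tensor G x y)) (tensor G g h)
            = tensor G x y \<otimes>\<^bsub>?T\<^esub> tensor G g h \<otimes>\<^bsub>?T\<^esub> inv\<^bsub>?T\<^esub> tensor G x y"
          using tensor s by (simp add: tensor_boundary_tensor T.m_assoc flip: \<open>_ = tensor G x y \<otimes>\<^bsub>?T\<^esub> tensor G g h\<close>)
      qed
    qed
  next
    case (inv s)
    show ?case
    proof
      fix t assume t: "t \<in> carrier ?T"
      let ?u = "inv\<^bsub>?T\<^esub> s \<otimes>\<^bsub>?T\<^esub> t \<otimes>\<^bsub>?T\<^esub> s"
      have u: "?u \<in> carrier ?T" using inv t by simp
      then have "tensor_act (tensor_boundary s) ?u = s \<otimes>\<^bsub>?T\<^esub> ?u \<otimes>\<^bsub>?T\<^esub> inv\<^bsub>?T\<^esub> s"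
        using inv.IH by blast
      then have t_eq: "tensor_act (tensor_boundary s) ?u = t"
        using inv t by (simp add: T.group_word_simps)
      have "tensor_act (inv tensor_boundary s) (tensor_act (tensor_boundary s) ?u) = ?u"
        using inv(1) u tensor_boundary_closed[OF inv(1)]
        by (simp add: tensor_act_act tensor_act_one_left)
      then show "tensor_act (tensor_boundary (inv\<^bsub>?T\<^esub> s)) t
          = inv\<^bsub>?T\<^esub> s \<otimes>\<^bsub>?T\<^esub> t \<otimes>\<^bsub>?T\<^esub> inv\<^bsub>?T\<^esub> (inv\<^bsub>?T\<^esub> s)"
        using inv(1) t_eq by (simp add: tensor_boundary_inv)
    qed
  next
    case (mult s1 s2)
    then show ?case
      by (simp add: tensor_boundary_mult tensor_boundary_closed T.group_word_simps flip: tensor_act_act)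
  qed
  with t show ?thesis by blast
qed

lemma tensor_inv_left:
  assumes "x \<in> carrier G" "h \<in> carrier G"
  shows "tensor G (inv x) h = inv\<^bsub>tensor_square G\<^esub> tensor_act (inv x) (tensor G x h)"
proof -
  let ?T = "tensor_square G"
  interpret T: group ?T by (rule group_tensor_square)
  have "tensor_act (inv x) (tensor G x h) \<otimes>\<^bsub>?T\<^esub> tensor G (inv x) h = \<one>\<^bsub>?T\<^esub>"
    using tensor_mult_left[of "inv x" x h] assms by (simp add: tensor_one_left tensor_act_tensor)
  then show ?thesis
    using assms by (metis T.inv_equality T.inv_inv inv_closed tensor_act_closed tensor_closed)
qed

text \<open>The right side is the commutator of \<open>t\<close> and \<open>k\<close> in the
  semidirect product, so commutation becomes a tensor with first entry in the derived subgroup. The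
  Peiffer identity turns the action of boundaries into conjugation throughout the induction.\<close>

lemma tensor_boundary_left:
  assumes t: "t \<in> carrier (tensor_square G)" and k: "k \<in> carrier G"
  shows "tensor G (tensor_boundary t) k = t \<otimes>\<^bsub>tensor_square G\<^esub> inv\<^bsub>tensor_square G\<^esub> tensor_act k t"
  using t
proof (induction rule: tensor_square_induct)
  case one
  interpret T: group "tensor_square G" by (rule group_tensor_square)
  show ?case using k by (simp add: tensor_boundary_one tensor_one_left tensor_act_one_right)
next
  let ?T = "tensor_square G"
  interpret T: group ?T by (rule group_tensor_square)
  case (tensor x y)
  let ?s = "tensor G x y" and ?w = "tensor G (conj_act G y x) k"
  have c: "?s \<in> carrier ?T" "?w \<in> carrier ?T" "tensor G x k \<in> carrier ?T"
    "tensor_act k ?s \<in> carrier ?T"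
    using tensor k by (auto intro: tensor_closed tensor_act_closed)
  \<comment> \<open>Two expansions of \<open>tensor G x (k \<otimes> y)\<close>, the second using
    \<open>k y = y (y^-1 k y)\<close>.\<close>
  have 1: "?s \<otimes>\<^bsub>?T\<^esub> ?w = tensor G x k \<otimes>\<^bsub>?T\<^esub> tensor_act k ?s"
  proof -
    have "tensor G x (y \<otimes> conj_act G (inv y) k) = ?s \<otimes>\<^bsub>?T\<^esub> ?w"
      using tensor k by (simp add: tensor_mult_right conj_act_conj_act) (simp add: conj_act_def)
    moreover have "y \<otimes> conj_act G (inv y) k = k \<otimes> y"
      using tensor k by (simp add: conj_act_def group_word_simps)
    ultimately show ?thesis
      using tensor k by (simp add: tensor_mult_right tensor_act_tensor)
  qed
  have xy: "commutator x y = x \<otimes> inv (conj_act G y x)"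
    using tensor by (simp add: commutator_def conj_act_def group_word_simps)
  have "tensor G (commutator x y) k
      = tensor_act x (tensor G (inv (conj_act G y x)) k) \<otimes>\<^bsub>?T\<^esub> tensor G x k"
    unfolding xy using tensor k by (simp add: tensor_mult_left tensor_act_tensor)
  also have "tensor_act x (tensor G (inv (conj_act G y x)) k) = inv\<^bsub>?T\<^esub> tensor_act (commutator x y) ?w"
    using tensor k c unfolding xy
    by (simp add: tensor_inv_left tensor_act_inv tensor_act_act tensor_act_closed)
  also have "tensor_act (commutator x y) ?w = ?s \<otimes>\<^bsub>?T\<^esub> ?w \<otimes>\<^bsub>?T\<^esub> inv\<^bsub>?T\<^esub> ?s"
    using tensor_act_boundary[OF c(1,2)] tensor by (simp add: tensor_boundary_tensor)
  also have "\<dots> = tensor G x k \<otimes>\<^bsub>?T\<^esub> tensor_act k ?s \<otimes>\<^bsub>?T\<^esub> inv\<^bsub>?T\<^esub> ?s"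
    unfolding 1 ..
  finally show ?case
    using tensor c by (simp add: tensor_boundary_tensor T.group_word_simps)
next
  let ?T = "tensor_square G"
  interpret T: group ?T by (rule group_tensor_square)
  case (inv s)
  let ?s' = "inv\<^bsub>?T\<^esub> s"
  have c: "tensor_boundary s \<in> carrier G" "s \<in> carrier ?T" "tensor_act k s \<in> carrier ?T"
    "tensor G (inv tensor_boundary s) k \<in> carrier ?T"
    using inv k by (auto intro: tensor_boundary_closed tensor_act_closed tensor_closed)
  have "tensor G (inv tensor_boundary s) k
      = inv\<^bsub>?T\<^esub> tensor_act (inv tensor_boundary s) (s \<otimes>\<^bsub>?T\<^esub> inv\<^bsub>?T\<^esub> tensor_act k s)"
    using tensor_inv_left[OF c(1) k] inv.IH by simp
  also have "tensor_act (inv tensor_boundary s) (s \<otimes>\<^bsub>?T\<^esub> inv\<^bsub>?T\<^esub> tensor_act k s)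
      = ?s' \<otimes>\<^bsub>?T\<^esub> (s \<otimes>\<^bsub>?T\<^esub> inv\<^bsub>?T\<^esub> tensor_act k s) \<otimes>\<^bsub>?T\<^esub> s"
    using tensor_act_boundary[of ?s' "s \<otimes>\<^bsub>?T\<^esub> inv\<^bsub>?T\<^esub> tensor_act k s"] c
    by (simp add: tensor_boundary_inv)
  finally show ?case
    using c k by (simp add: tensor_boundary_inv tensor_act_inv T.group_word_simps)
next
  let ?T = "tensor_square G"
  interpret T: group ?T by (rule group_tensor_square)
  case (mult s t)
  have c: "tensor_boundary s \<in> carrier G" "tensor_boundary t \<in> carrier G"
    "tensor_act k s \<in> carrier ?T" "tensor_act k t \<in> carrier ?T"
    "tensor G (tensor_boundary t) k \<in> carrier ?T"
    using mult k by (auto intro: tensor_boundary_closed tensor_act_closed tensor_closed)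
  have "tensor G (tensor_boundary s \<otimes> tensor_boundary t) k
      = tensor_act (tensor_boundary s) (tensor G (tensor_boundary t) k)
        \<otimes>\<^bsub>?T\<^esub> tensor G (tensor_boundary s) k"
    using c k by (simp add: tensor_mult_left tensor_act_tensor)
  also have "tensor_act (tensor_boundary s) (tensor G (tensor_boundary t) k)
      = s \<otimes>\<^bsub>?T\<^esub> tensor G (tensor_boundary t) k \<otimes>\<^bsub>?T\<^esub> inv\<^bsub>?T\<^esub> s"
    using mult c by (intro tensor_act_boundary)
  finally show ?case
    using mult c k by (simp add: tensor_boundary_mult tensor_act_mult T.group_word_simps)
qed

end

section \<open>The exponent of the tensor square\<close>

definition semidirect ::
    "('t, 'x) monoid_scheme \<Rightarrow> ('g, 'y) monoid_scheme \<Rightarrow> ('g \<Rightarrow> 't \<Rightarrow> 't) \<Rightarrow> ('t \<times> 'g) monoid" where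
  "semidirect T G a = \<lparr>carrier = carrier T \<times> carrier G,
     monoid.mult = (\<lambda>(t, g) (s, h). (t \<otimes>\<^bsub>T\<^esub> a g s, g \<otimes>\<^bsub>G\<^esub> h)), one = (\<one>\<^bsub>T\<^esub>, \<one>\<^bsub>G\<^esub>)\<rparr>"

lemma semidirect_simps [simp]:
  "carrier (semidirect T G a) = carrier T \<times> carrier G"
  "(t, g) \<otimes>\<^bsub>semidirect T G a\<^esub> (s, h) = (t \<otimes>\<^bsub>T\<^esub> a g s, g \<otimes>\<^bsub>G\<^esub> h)"
  "\<one>\<^bsub>semidirect T G a\<^esub> = (\<one>\<^bsub>T\<^esub>, \<one>\<^bsub>G\<^esub>)"
  by (simp_all add: semidirect_def)

context group
begin

section \<open>The semidirect product of the tensor square with \<open>G\<close>\<close>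

abbreviation TG where "TG \<equiv> tensor_square G"
abbreviation SG where "SG \<equiv> semidirect TG G tensor_act"

lemma conj_act_one: "x \<in> carrier G \<Longrightarrow> conj_act G \<one> x = x"
  by (simp add: conj_act_def)

lemma group_tensor_semidirect: "group SG"
proof (rule groupI)
  interpret T: group TG by (rule group_tensor_square)
  fix x y z assume "x \<in> carrier SG" "y \<in> carrier SG"
  then show "x \<otimes>\<^bsub>SG\<^esub> y \<in> carrier SG" by (auto simp: tensor_act_closed)
  assume "z \<in> carrier SG"
  with \<open>x \<in> carrier SG\<close> \<open>y \<in> carrier SG\<close> show "x \<otimes>\<^bsub>SG\<^esub> y \<otimes>\<^bsub>SG\<^esub> z = x \<otimes>\<^bsub>SG\<^esub> (y \<otimes>\<^bsub>SG\<^esub> z)"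
    by (auto simp: m_assoc T.m_assoc tensor_act_mult tensor_act_act tensor_act_closed)
next
  interpret T: group TG by (rule group_tensor_square)
  show "\<one>\<^bsub>SG\<^esub> \<in> carrier SG" by simp
  fix x assume "x \<in> carrier SG"
  then obtain t g where x: "x = (t, g)" "t \<in> carrier TG" "g \<in> carrier G" by auto
  show "\<one>\<^bsub>SG\<^esub> \<otimes>\<^bsub>SG\<^esub> x = x" using x by (simp add: tensor_act_one_left)
  have "(inv\<^bsub>TG\<^esub> tensor_act (inv g) t, inv g) \<otimes>\<^bsub>SG\<^esub> x = \<one>\<^bsub>SG\<^esub>"
    using x by (simp add: tensor_act_closed)
  moreover have "(inv\<^bsub>TG\<^esub> tensor_act (inv g) t, inv g) \<in> carrier SG"
    using x by (simp add: tensor_act_closed)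
  ultimately show "\<exists>y\<in>carrier SG. y \<otimes>\<^bsub>SG\<^esub> x = \<one>\<^bsub>SG\<^esub>" by (intro bexI)
qed

abbreviation \<iota> where "\<iota> t \<equiv> (t, \<one>)"

lemma iota_hom: "\<iota> \<in> hom TG SG"
  by (auto simp: hom_def tensor_act_one_left)

lemma iota_group_hom: "group_hom TG SG \<iota>"
  by (simp add: group_hom_def group_hom_axioms_def iota_hom group_tensor_square group_tensor_semidirect)

lemmas iota_generate = group_hom.generate_img[OF iota_group_hom]

text \<open>By the Peiffer identity the tensor part of \<open>z\<close> acts like its boundary, so
  \<open>z\<close> acts on the tensor square through a single element of \<open>G\<close>.\<close>

lemma iota_conj:
  assumes z: "z \<in> carrier SG" and t: "t \<in> carrier TG"
  shows "z \<otimes>\<^bsub>SG\<^esub> \<iota> t \<otimes>\<^bsub>SG\<^esub> inv\<^bsub>SG\<^esub> z = \<iota> (tensor_act (tensor_boundary (fst z) \<otimes> snd z) t)"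
proof -
  interpret T: group TG by (rule group_tensor_square)
  interpret S: group SG by (rule group_tensor_semidirect)
  obtain s g where sg: "z = (s, g)" "s \<in> carrier TG" "g \<in> carrier G" using z by auto
  let ?u = "tensor_act (tensor_boundary s \<otimes> g) t"
  have u: "?u = s \<otimes>\<^bsub>TG\<^esub> tensor_act g t \<otimes>\<^bsub>TG\<^esub> inv\<^bsub>TG\<^esub> s"
    using sg t tensor_act_boundary[of s "tensor_act g t"]
    by (simp add: tensor_act_act tensor_act_closed tensor_boundary_closed)
  have uc: "?u \<in> carrier TG" using sg t by (simp add: tensor_act_closed tensor_boundary_closed)
  have "z \<otimes>\<^bsub>SG\<^esub> \<iota> t = \<iota> ?u \<otimes>\<^bsub>SG\<^esub> z"
    using sg t u by (simp add: tensor_act_closed tensor_act_one_left T.m_assoc)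
  moreover have "\<iota> ?u \<in> carrier SG" "\<iota> t \<in> carrier SG" using uc t by auto
  ultimately show ?thesis
    using z sg by (simp only: S.m_assoc S.r_inv S.r_one S.inv_closed fst_conv snd_conv)
qed

lemma iota_commutator:
  assumes z: "z \<in> carrier SG" and t: "t \<in> carrier TG"
  shows "group.commutator SG (\<iota> t) z
    = \<iota> (tensor G (tensor_boundary t) (tensor_boundary (fst z) \<otimes> snd z))"
proof -
  interpret T: group TG by (rule group_tensor_square)
  interpret S: group SG by (rule group_tensor_semidirect)
  let ?k = "tensor_boundary (fst z) \<otimes> snd z"
  have k: "?k \<in> carrier G" using z by (auto simp: tensor_boundary_closed)
  have it: "\<iota> t \<in> carrier SG" "\<iota> (inv\<^bsub>TG\<^esub> t) \<in> carrier SG" using t by auto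
  have inv_iota: "inv\<^bsub>SG\<^esub> \<iota> t = \<iota> (inv\<^bsub>TG\<^esub> t)"
    by (rule S.inv_equality) (use t in \<open>auto simp: tensor_act_one_left\<close>)
  have "S.commutator (\<iota> t) z = \<iota> t \<otimes>\<^bsub>SG\<^esub> (z \<otimes>\<^bsub>SG\<^esub> \<iota> (inv\<^bsub>TG\<^esub> t) \<otimes>\<^bsub>SG\<^esub> inv\<^bsub>SG\<^esub> z)"
    unfolding S.commutator_def inv_iota using it z by (simp only: S.m_assoc S.m_closed S.inv_closed)
  also have "\<dots> = \<iota> (t \<otimes>\<^bsub>TG\<^esub> inv\<^bsub>TG\<^esub> tensor_act ?k t)"
    using iota_conj[OF z, of "inv\<^bsub>TG\<^esub> t"] t k
    by (simp add: tensor_act_inv tensor_act_one_left tensor_act_closed)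
  finally show ?thesis using tensor_boundary_left[OF t k] by simp
qed

text \<open>Only generators, since the twisted power formula holds for single symbols. With
  \<open>N\<close> the set of \<open>p^k\<close>-th powers they generate \<open>H k\<close>.\<close>

definition tensors_over :: "'a set \<Rightarrow> (('a \<times> 'a) word set \<times> 'a) set" where
  "tensors_over N = {\<iota> (tensor G w y) | w y. w \<in> N \<and> y \<in> carrier G}"

lemma tensors_over_carrier: "N \<subseteq> carrier G \<Longrightarrow> tensors_over N \<subseteq> carrier SG"
  by (auto simp: tensors_over_def tensor_closed)

lemma tensors_over_whole: "generate SG (tensors_over (carrier G)) = \<iota> ` carrier TG"
proof -
  have "tensors_over (carrier G) = \<iota> ` {tensor G g h | g h. g \<in> carrier G \<and> h \<in> carrier G}"
    by (auto simp: tensors_over_def)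
  moreover have "{tensor G g h | g h. g \<in> carrier G \<and> h \<in> carrier G} \<subseteq> carrier TG"
    by (auto simp: tensor_closed)
  ultimately show ?thesis by (simp only: iota_generate tensor_square_generate)
qed

lemma tensors_over_normal:
  assumes N: "N \<subseteq> carrier G" and conj: "\<And>g w. \<lbrakk>g \<in> carrier G; w \<in> N\<rbrakk> \<Longrightarrow> conj_act G g w \<in> N"
  shows "generate SG (tensors_over N) \<lhd> SG"
proof (rule group.normal_generateI[OF group_tensor_semidirect tensors_over_carrier[OF N]])
  fix h z assume "h \<in> tensors_over N" and z: "z \<in> carrier SG"
  then obtain w y where h: "h = \<iota> (tensor G w y)" "w \<in> N" "y \<in> carrier G" by (auto simp: tensors_over_def)
  let ?k = "tensor_boundary (fst z) \<otimes> snd z"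
  have k: "?k \<in> carrier G" using z by (auto simp: tensor_boundary_closed)
  have w: "w \<in> carrier G" using h N by auto
  have "z \<otimes>\<^bsub>SG\<^esub> h \<otimes>\<^bsub>SG\<^esub> inv\<^bsub>SG\<^esub> z = \<iota> (tensor G (conj_act G ?k w) (conj_act G ?k y))"
    using iota_conj[OF z tensor_closed[OF w h(3)]] k w h by (simp add: tensor_act_tensor)
  then show "z \<otimes>\<^bsub>SG\<^esub> h \<otimes>\<^bsub>SG\<^esub> inv\<^bsub>SG\<^esub> z \<in> tensors_over N"
    using conj[OF k h(2)] conj_act_closed[OF k h(3)] unfolding tensors_over_def by blast
qed

text \<open>The hypotheses on \<open>G\<close> concern subgroups generated by powers, the chain
  \<open>B k\<close> the powers themselves. The expansion of
  \<open>tensor G (u \<otimes> v) y\<close> bridges the two, normality absorbing its conjugated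
  factor.\<close>

lemma tensors_over_generate_subset:
  assumes X: "X \<subseteq> carrier G" and conj: "\<And>g w. \<lbrakk>g \<in> carrier G; w \<in> X\<rbrakk> \<Longrightarrow> conj_act G g w \<in> X"
    and inv: "\<And>w. w \<in> X \<Longrightarrow> inv w \<in> X"
  shows "generate SG (tensors_over (generate G X)) \<subseteq> generate SG (tensors_over X)"
proof -
  interpret S: group SG by (rule group_tensor_semidirect)
  let ?R = "generate SG (tensors_over X)"
  have R: "?R \<lhd> SG" by (rule tensors_over_normal[OF X conj])
  have "\<forall>y\<in>carrier G. \<iota> (tensor G w y) \<in> ?R" if "w \<in> generate G X" for w
    using that
  proof (induction rule: generate.induct)
    case one
    then show ?case using S.normal_one[OF R] by (simp add: tensor_one_left)
  next
    case (incl h)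
    then show ?case by (auto simp: tensors_over_def intro!: generate.incl)
  next
    case (inv h)
    then show ?case using assms(3) by (auto simp: tensors_over_def intro!: generate.incl)
  next
    case (eng u v)
    then have uv: "u \<in> carrier G" "v \<in> carrier G" using generate_in_carrier[OF X] by auto
    show ?case
    proof
      fix y assume y: "y \<in> carrier G"
      have z: "(\<one>\<^bsub>TG\<^esub>, u) \<in> carrier SG"
        using uv group.is_monoid[OF group_tensor_square] monoid.one_closed by auto
      have "(\<one>\<^bsub>TG\<^esub>, u) \<otimes>\<^bsub>SG\<^esub> \<iota> (tensor G v y) \<otimes>\<^bsub>SG\<^esub> inv\<^bsub>SG\<^esub> (\<one>\<^bsub>TG\<^esub>, u) \<in> ?R"
        using eng.IH(2) y by (intro S.normal_conj[OF R z]) auto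
      then have "\<iota> (tensor_act u (tensor G v y)) \<in> ?R"
        using iota_conj[OF z tensor_closed[OF uv(2) y]] uv by (simp add: tensor_boundary_one)
      then have "\<iota> (tensor_act u (tensor G v y)) \<otimes>\<^bsub>SG\<^esub> \<iota> (tensor G u y) \<in> ?R"
        using eng.IH(1) y by (intro S.normal_mult[OF R]) auto
      also have "\<iota> (tensor_act u (tensor G v y)) \<otimes>\<^bsub>SG\<^esub> \<iota> (tensor G u y) = \<iota> (tensor G (u \<otimes> v) y)"
        using uv y by (simp add: tensor_mult_left tensor_act_tensor conj_act_one)
      finally show "\<iota> (tensor G (u \<otimes> v) y) \<in> ?R" .
    qed
  qed
  then have "tensors_over (generate G X) \<subseteq> ?R" unfolding tensors_over_def by auto
  then show ?thesis by (rule S.generate_subgroup_incl[OF _ normal_imp_subgroup[OF R]])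
qed

section \<open>Iterated commutators and the lower central series\<close>

lemma lower_central_Suc: "lower_central G (Suc i) = (gcomm ^^ i) (carrier G)"
  by (induction i) simp_all

lemma lower_central_normal: "lower_central G (Suc i) \<lhd> G"
  unfolding lower_central_Suc by (rule gcomm_iter_normal[OF normal_self])

text \<open>The boundary of \<open>[t, z]\<close> is a commutator with the boundary of
  \<open>t\<close>. The index starts at 2 because the boundary maps the whole tensor square into the
  derived subgroup.\<close>

lemma gcomm_iter_tensor_square:
  "(group.gcomm SG ^^ j) (\<iota> ` carrier TG)
    \<subseteq> \<iota> ` {t \<in> carrier TG. tensor_boundary t \<in> lower_central G (Suc (Suc j))}" (is "_ \<subseteq> ?D j")
proof (induction j)
  case 0
  have "tensor_boundary t \<in> gcomm (carrier G)" if "t \<in> carrier TG" for t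
    using that
  proof (induction rule: tensor_square_induct)
    case (tensor g h)
    then show ?case using gcommI[of "carrier G"] by (simp add: tensor_boundary_tensor)
  qed (use normal_one normal_inv normal_mult gcomm_normal[OF normal_self] in
      \<open>auto simp: tensor_boundary_one tensor_boundary_inv tensor_boundary_mult\<close>)
  then show ?case by auto
next
  case (Suc j)
  interpret T: group TG by (rule group_tensor_square)
  interpret S: group SG by (rule group_tensor_semidirect)
  note N = lower_central_normal[of "Suc (Suc j)"]
  have sub: "subgroup {t \<in> carrier TG. tensor_boundary t \<in> lower_central G (Suc (Suc (Suc j)))} TG"
    by (rule T.subgroupI)
      (use normal_one[OF N] normal_inv[OF N] normal_mult[OF N] in
        \<open>auto simp: tensor_boundary_one tensor_boundary_inv tensor_boundary_mult intro: exI[of _ "\<one>\<^bsub>TG\<^esub>"]\<close>)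
  have D: "subgroup (?D (Suc j)) SG"
    using iota_group_hom sub by (rule group_hom.subgroup_img_is_subgroup)
  have "S.gcomm (?D j) \<subseteq> ?D (Suc j)"
  proof (rule S.gcomm_subsetI[OF D])
    show "?D j \<subseteq> carrier SG" by auto
    fix x z assume "x \<in> ?D j" and z: "z \<in> carrier SG"
    then obtain t where t: "x = \<iota> t" "t \<in> carrier TG" "tensor_boundary t \<in> lower_central G (Suc (Suc j))"
      by auto
    let ?k = "tensor_boundary (fst z) \<otimes> snd z"
    have k: "?k \<in> carrier G" using z by (auto simp: tensor_boundary_closed)
    have "commutator (tensor_boundary t) ?k \<in> lower_central G (Suc (Suc (Suc j)))"
      using gcommI(2)[OF normal_carrier[OF lower_central_normal] t(3) k] by simp
    then show "S.commutator x z \<in> ?D (Suc j)"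
      unfolding t(1) iota_commutator[OF z t(2)] using t k
      by (auto simp: tensor_boundary_tensor tensor_boundary_closed tensor_closed)
  qed
  with S.gcomm_mono[OF Suc] show ?case by auto
qed

text \<open>\<open>[t, g] = \<partial>t \<otimes> g\<close>, which is where the lower central series of \<open>G\<close> enters.\<close>

lemma gcomm_iter_tensors_over:
  "(group.gcomm SG ^^ Suc j) (\<iota> ` carrier TG) \<subseteq> generate SG (tensors_over (lower_central G (Suc (Suc j))))"
proof -
  interpret S: group SG by (rule group_tensor_semidirect)
  let ?N = "lower_central G (Suc (Suc j))"
  note Nc = normal_carrier[OF lower_central_normal]
  have "S.gcomm (\<iota> ` {t \<in> carrier TG. tensor_boundary t \<in> ?N}) \<subseteq> generate SG (tensors_over ?N)"
  proof (rule S.gcomm_subsetI)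
    show "subgroup (generate SG (tensors_over ?N)) SG"
      by (rule S.generate_is_subgroup[OF tensors_over_carrier[OF Nc]])
    fix x z assume "x \<in> \<iota> ` {t \<in> carrier TG. tensor_boundary t \<in> ?N}" and z: "z \<in> carrier SG"
    then obtain t where t: "x = \<iota> t" "t \<in> carrier TG" "tensor_boundary t \<in> ?N" by auto
    have k: "tensor_boundary (fst z) \<otimes> snd z \<in> carrier G" using z by (auto simp: tensor_boundary_closed)
    show "S.commutator x z \<in> generate SG (tensors_over ?N)"
      unfolding t(1) iota_commutator[OF z t(2)] using t k
      by (intro generate.incl) (auto simp: tensors_over_def)
  qed auto
  with S.gcomm_mono[OF gcomm_iter_tensor_square[of j]] show ?thesis by auto
qed

text \<open>\<open>(\<one>, v)\<close> acts as conjugation by \<open>v\<close>, so the induction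
  step is the expansion of \<open>tensor G (v [^] n \<otimes> v) y\<close>. Symbols thus obey the
  rule of \<open>twisted_pow_commutator\<close>, though in general not commutators of
  \<open>(\<one>, v)\<close> and \<open>(\<one>, y)\<close>.\<close>

lemma twisted_pow_tensor:
  assumes v: "v \<in> carrier G" and y: "y \<in> carrier G"
  shows "(\<one>\<^bsub>TG\<^esub>, v) [^]\<^bsub>SG\<^esub> n \<otimes>\<^bsub>SG\<^esub> (inv\<^bsub>SG\<^esub> (\<one>\<^bsub>TG\<^esub>, v) \<otimes>\<^bsub>SG\<^esub> \<iota> (tensor G v y)) [^]\<^bsub>SG\<^esub> n
    = \<iota> (tensor G (v [^] (n::nat)) y)"
proof (induction n)
  case 0
  interpret T: group TG by (rule group_tensor_square)
  show ?case using y by (simp add: tensor_one_left tensor_act_one_left)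
next
  case (Suc n)
  interpret T: group TG by (rule group_tensor_square)
  interpret S: group SG by (rule group_tensor_semidirect)
  let ?g = "(\<one>\<^bsub>TG\<^esub>, v)" and ?b = "\<iota> (tensor G v y)"
  let ?a = "inv\<^bsub>SG\<^esub> ?g \<otimes>\<^bsub>SG\<^esub> ?b"
  have c: "?g \<in> carrier SG" "?b \<in> carrier SG" using v y by (auto simp: tensor_closed)
  then have ac: "?a \<in> carrier SG" by (intro S.m_closed S.inv_closed)
  have gn: "?g [^]\<^bsub>SG\<^esub> m = (\<one>\<^bsub>TG\<^esub>, v [^] m)" for m :: nat
    using v by (induction m) (auto simp: tensor_act_one_right)
  note cl = S.nat_pow_closed[OF c(1), of n] S.nat_pow_closed[OF ac, of n]
  have "?g [^]\<^bsub>SG\<^esub> Suc n \<otimes>\<^bsub>SG\<^esub> ?a [^]\<^bsub>SG\<^esub> Suc n = ?g [^]\<^bsub>SG\<^esub> n \<otimes>\<^bsub>SG\<^esub> ?b \<otimes>\<^bsub>SG\<^esub> ?a [^]\<^bsub>SG\<^esub> n"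
    by (subst S.nat_pow_Suc2[OF ac], subst S.nat_pow_Suc)
      (use c cl in \<open>simp only: S.m_assoc S.m_closed S.inv_closed S.mult_inv_cancel\<close>)
  also have "\<dots> = (?g [^]\<^bsub>SG\<^esub> n \<otimes>\<^bsub>SG\<^esub> ?b \<otimes>\<^bsub>SG\<^esub> inv\<^bsub>SG\<^esub> (?g [^]\<^bsub>SG\<^esub> n)) \<otimes>\<^bsub>SG\<^esub> (?g [^]\<^bsub>SG\<^esub> n \<otimes>\<^bsub>SG\<^esub> ?a [^]\<^bsub>SG\<^esub> n)"
    using c cl by (simp only: S.m_assoc S.m_closed S.inv_closed S.inv_mult_cancel)
  also have "?g [^]\<^bsub>SG\<^esub> n \<otimes>\<^bsub>SG\<^esub> ?b \<otimes>\<^bsub>SG\<^esub> inv\<^bsub>SG\<^esub> (?g [^]\<^bsub>SG\<^esub> n) = \<iota> (tensor_act (v [^] n) (tensor G v y))"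
    using iota_conj[OF cl(1) tensor_closed[OF v y]] v unfolding gn by (simp add: tensor_boundary_one)
  finally have "?g [^]\<^bsub>SG\<^esub> Suc n \<otimes>\<^bsub>SG\<^esub> ?a [^]\<^bsub>SG\<^esub> Suc n
      = \<iota> (tensor_act (v [^] n) (tensor G v y)) \<otimes>\<^bsub>SG\<^esub> \<iota> (tensor G (v [^] n) y)"
    unfolding Suc .
  then show ?case
    using v y by (simp only: semidirect_simps) (simp add: tensor_act_tensor conj_act_one tensor_mult_left)
qed

lemma conj_act_pow:
  "\<lbrakk>g \<in> carrier G; x \<in> carrier G\<rbrakk> \<Longrightarrow> conj_act G g (x [^] (n::nat)) = conj_act G g x [^] n"
  by (simp add: conj_act_def conj_pow)

theorem tensor_square_pow_eq_one:
  fixes p :: nat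
  assumes p: "Factorial_Ring.prime p" "odd p" and ord: "order G = p ^ k"
    and potent: "(\<exists>m. 2 \<le> m \<and> m \<le> p - 1 \<and> lower_central G m \<subseteq> power_subgroup G p)
         \<or> lower_central G p \<subseteq> power_subgroup G (p ^ 2)"
    and exp: "\<And>x. x \<in> carrier G \<Longrightarrow> x [^] (p ^ n) = \<one>"
    and t: "t \<in> carrier TG"
  shows "t [^]\<^bsub>TG\<^esub> (p ^ n) = \<one>\<^bsub>TG\<^esub>"
proof -
  interpret T: group TG by (rule group_tensor_square)
  interpret S: group SG by (rule group_tensor_semidirect)
  \<comment> \<open>Oddness makes \<open>p - 2\<close> positive:
    \<open>gcomm_iter_tensors_over\<close> starts with one commutation.\<close>
  have p3: "3 \<le> p"
    using p prime_ge_2_nat[OF p(1)] by (cases "p = 2") auto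
  define X where "X q = {x [^] q | x. x \<in> carrier G}" for q :: nat
  have X: "X q \<subseteq> carrier G" for q by (auto simp: X_def)
  have X_conj: "conj_act G g w \<in> X q" if "g \<in> carrier G" "w \<in> X q" for g w q
    using that by (auto simp: X_def conj_act_pow)
  have X_inv: "inv w \<in> X q" if w: "w \<in> X q" for w q
  proof -
    obtain x where x: "x \<in> carrier G" "w = x [^] q" using w by (auto simp: X_def)
    then have "inv w = (inv x) [^] q" by (simp add: nat_pow_inv)
    then show ?thesis using x by (auto simp: X_def)
  qed
  define B where "B k = tensors_over (X (p ^ k))" for k
  have B0: "generate SG (B 0) = \<iota> ` carrier TG"
  proof -
    have "X (p ^ 0) = carrier G" by (force simp: X_def)
    then show ?thesis unfolding B_def tensors_over_whole[symmetric] by simp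
  qed
  have power_B: "generate SG (tensors_over N) \<subseteq> generate SG (B k)" if "N \<subseteq> power_subgroup G (p ^ k)" for N k
  proof -
    have "tensors_over N \<subseteq> tensors_over (generate G (X (p ^ k)))"
      using that unfolding tensors_over_def power_subgroup_def X_def by blast
    from S.mono_generate[OF this] tensors_over_generate_subset[OF X X_conj X_inv, of "p ^ k"]
    show ?thesis unfolding B_def by blast
  qed
  have lc_anti: "lower_central G j \<subseteq> lower_central G i" if "1 \<le> i" "i \<le> j" for i j
  proof -
    have "(gcomm ^^ (j - 1)) (carrier G) \<subseteq> (gcomm ^^ (i - 1)) (carrier G)"
      using that by (intro gcomm_iter_antimono normal_self) auto
    then show ?thesis using that lower_central_Suc[of "j - 1"] lower_central_Suc[of "i - 1"] by simp
  qed
  obtain c where c: "(gcomm ^^ c) (carrier G) \<subseteq> {\<one>}"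
    using prime_power_order_gcomm[OF p(1) ord one_is_normal] by blast
  have triv: "generate SG (tensors_over {\<one>}) = {\<one>\<^bsub>SG\<^esub>}"
  proof -
    have "tensors_over {\<one>} = {\<one>\<^bsub>SG\<^esub>}"
      using one_closed unfolding tensors_over_def by (auto simp: tensor_one_left intro!: exI[of _ \<one>])
    then show ?thesis by (simp only: S.generate_one)
  qed
  interpret twisted_power_chain SG p B n "Suc c"
  proof (rule twisted_power_chain.intro, rule group_prime.intro[OF group_tensor_semidirect], rule group_prime_axioms.intro,
      rule p(1), rule twisted_power_chain_axioms.intro)
    show "generate SG (B k) \<lhd> SG" for k
      unfolding B_def by (rule tensors_over_normal[OF X X_conj])
    fix b k assume "b \<in> B k"
    then obtain x y where b: "x \<in> carrier G" "y \<in> carrier G" "b = \<iota> (tensor G (x [^] (p ^ k)) y)"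
      unfolding B_def tensors_over_def X_def by auto
    let ?g = "(\<one>\<^bsub>TG\<^esub>, x [^] (p ^ k))"
    have "?g [^]\<^bsub>SG\<^esub> p \<otimes>\<^bsub>SG\<^esub> (inv\<^bsub>SG\<^esub> ?g \<otimes>\<^bsub>SG\<^esub> b) [^]\<^bsub>SG\<^esub> p = \<iota> (tensor G (x [^] (p ^ Suc k)) y)"
      using twisted_pow_tensor[of "x [^] (p ^ k)" y p] b by (simp add: nat_pow_pow mult.commute)
    moreover have "\<iota> (tensor G (x [^] (p ^ Suc k)) y) \<in> B (Suc k)"
      unfolding B_def tensors_over_def X_def using b(1,2) by blast
    moreover have "?g \<in> carrier SG" using b by simp
    ultimately show "\<exists>g\<in>carrier SG. g [^]\<^bsub>SG\<^esub> p \<otimes>\<^bsub>SG\<^esub> (inv\<^bsub>SG\<^esub> g \<otimes>\<^bsub>SG\<^esub> b) [^]\<^bsub>SG\<^esub> p \<in> B (Suc k)"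
      by (intro bexI[of _ ?g]) simp_all
  next
    fix b k assume "b \<in> B (Suc k)"
    then obtain x y where b: "x \<in> carrier G" "y \<in> carrier G" "b = \<iota> (tensor G (x [^] (p ^ Suc k)) y)"
      unfolding B_def tensors_over_def X_def by auto
    let ?g = "(\<one>\<^bsub>TG\<^esub>, x [^] (p ^ k))" and ?t = "\<iota> (tensor G (x [^] (p ^ k)) y)"
    have "b = ?g [^]\<^bsub>SG\<^esub> p \<otimes>\<^bsub>SG\<^esub> (inv\<^bsub>SG\<^esub> ?g \<otimes>\<^bsub>SG\<^esub> ?t) [^]\<^bsub>SG\<^esub> p"
      using twisted_pow_tensor[of "x [^] (p ^ k)" y p] b by (simp add: nat_pow_pow mult.commute)
    moreover have "?t \<in> B k"
      unfolding B_def tensors_over_def X_def using b(1,2) by blast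
    moreover have "?g \<in> carrier SG" using b by simp
    ultimately show "\<exists>t\<in>B k. \<exists>g\<in>carrier SG. b = g [^]\<^bsub>SG\<^esub> p \<otimes>\<^bsub>SG\<^esub> (inv\<^bsub>SG\<^esub> g \<otimes>\<^bsub>SG\<^esub> t) [^]\<^bsub>SG\<^esub> p"
      by blast
  next
    have "lower_central G (Suc (Suc c)) \<subseteq> {\<one>}"
      using lc_anti[of "Suc c" "Suc (Suc c)"] c by (auto simp: lower_central_Suc)
    then have "tensors_over (lower_central G (Suc (Suc c))) \<subseteq> tensors_over {\<one>}"
      unfolding tensors_over_def by blast
    from S.mono_generate[OF this] gcomm_iter_tensors_over[of c] triv
    have "(S.gcomm ^^ Suc c) (\<iota> ` carrier TG) \<subseteq> {\<one>\<^bsub>SG\<^esub>}" by blast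
    moreover have "\<iota> ` carrier TG \<lhd> SG"
      using tensors_over_normal[of "carrier G"] tensors_over_whole by simp
    ultimately show "(S.gcomm ^^ Suc c) (generate SG (B 0)) = {\<one>\<^bsub>SG\<^esub>}"
      unfolding B0 using S.normal_one[OF S.gcomm_iter_normal] by blast
  next
    have "X (p ^ n) = {\<one>}" using exp unfolding X_def by (auto intro!: exI[of _ \<one>])
    then show "generate SG (B n) = {\<one>\<^bsub>SG\<^esub>}" unfolding B_def using triv by simp
  next
    from potent show "(S.gcomm ^^ (p - 2)) (generate SG (B 0)) \<subseteq> generate SG (B 1) \<or>
      (S.gcomm ^^ (p - 1)) (generate SG (B 0)) \<subseteq> generate SG (B 2)"
    proof
      assume "\<exists>m. 2 \<le> m \<and> m \<le> p - 1 \<and> lower_central G m \<subseteq> power_subgroup G p"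
      then obtain m where m: "2 \<le> m" "m \<le> p - 1" "lower_central G m \<subseteq> power_subgroup G p" by blast
      then have "lower_central G (p - 1) \<subseteq> power_subgroup G (p ^ 1)"
        using lc_anti[of m "p - 1"] by auto
      \<comment> \<open>One commutation reaches tensors over the second lower central term, so
        \<open>p - 2\<close> of them reach the term \<open>p - 1\<close>.\<close>
      from power_B[OF this] gcomm_iter_tensors_over[of "p - 3"]
      have "(S.gcomm ^^ Suc (p - 3)) (\<iota> ` carrier TG) \<subseteq> generate SG (B 1)"
        using p3 by (simp add: numeral_3_eq_3 Suc_diff_Suc)
      moreover have "Suc (p - 3) = p - 2" using p3 by simp
      ultimately show ?thesis unfolding B0 by simp
    next
      assume "lower_central G p \<subseteq> power_subgroup G (p ^ 2)"
      from power_B[OF this] have "generate SG (tensors_over (lower_central G p)) \<subseteq> generate SG (B 2)" .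
      moreover have e: "Suc (p - 2) = p - 1" "Suc (p - 1) = p" using p3 by simp_all
      note gcomm_iter_tensors_over[of "p - 2", unfolded e]
      ultimately show ?thesis unfolding B0 by blast
    qed
  qed
  have "\<iota> t [^]\<^bsub>SG\<^esub> (p ^ n) = \<one>\<^bsub>SG\<^esub>"
    using t by (intro chain_pow_eq_one) (auto simp: B0)
  moreover have "\<iota> t [^]\<^bsub>SG\<^esub> m = \<iota> (t [^]\<^bsub>TG\<^esub> m)" for m :: nat
    using t by (induction m) (auto simp: tensor_act_one_left)
  ultimately show ?thesis by simp
qed

end

section \<open>Central extensions and the Schur multiplier\<close>

text \<open>Elements with the same image differ by a central factor, which cancels in
  commutators.\<close>

lemma central_extension_commutator_eq:
  assumes "group E" "group G" and \<pi>: "\<pi> \<in> hom E G"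
    and central: "\<And>z x. \<lbrakk>z \<in> carrier E; \<pi> z = \<one>\<^bsub>G\<^esub>; x \<in> carrier E\<rbrakk> \<Longrightarrow> z \<otimes>\<^bsub>E\<^esub> x = x \<otimes>\<^bsub>E\<^esub> z"
    and x: "x \<in> carrier E" "x' \<in> carrier E" "\<pi> x = \<pi> x'"
    and y: "y \<in> carrier E" "y' \<in> carrier E" "\<pi> y = \<pi> y'"
  shows "group.commutator E x y = group.commutator E x' y'"
proof -
  interpret E: group E by (rule assms(1))
  interpret \<pi>: group_hom E G \<pi>
    using assms by (simp add: group_hom_def group_hom_axioms_def)
  have left: "E.commutator u w = E.commutator v w"
    if u: "u \<in> carrier E" "v \<in> carrier E" "\<pi> u = \<pi> v" and w: "w \<in> carrier E" for u v w
  proof -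
    let ?z = "inv\<^bsub>E\<^esub> v \<otimes>\<^bsub>E\<^esub> u"
    have z: "?z \<in> carrier E" "\<pi> ?z = \<one>\<^bsub>G\<^esub>" using u by auto
    have "E.commutator u w = E.commutator (v \<otimes>\<^bsub>E\<^esub> ?z) w"
      using u by (simp add: E.mult_inv_cancel)
    also have "\<dots> = v \<otimes>\<^bsub>E\<^esub> (?z \<otimes>\<^bsub>E\<^esub> w) \<otimes>\<^bsub>E\<^esub> inv\<^bsub>E\<^esub> (v \<otimes>\<^bsub>E\<^esub> ?z) \<otimes>\<^bsub>E\<^esub> inv\<^bsub>E\<^esub> w"
      using u w z(1) by (simp only: E.commutator_def E.m_assoc E.m_closed E.inv_closed)
    also have "\<dots> = E.commutator v w"
      unfolding central[OF z w] using u w by (simp add: E.commutator_def E.group_word_simps)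
    finally show ?thesis .
  qed
  have "E.commutator x y = E.commutator x' y" by (rule left[OF x y(1)])
  also have "\<dots> = inv\<^bsub>E\<^esub> E.commutator y x'" using x y by (simp add: E.inv_commutator)
  also have "\<dots> = inv\<^bsub>E\<^esub> E.commutator y' x'" using left[OF y x(2)] by simp
  also have "\<dots> = E.commutator x' y'" using x y by (simp add: E.inv_commutator)
  finally show ?thesis .
qed

text \<open>The commutator pairing of a central extension of \<open>G\<close> factors through the tensor square.\<close>

lemma central_extension_derived_pow:
  assumes E: "group E" and G: "group G" and \<pi>: "\<pi> \<in> hom E G" and surj: "\<pi> ` carrier E = carrier G"
    and central: "\<And>z x. \<lbrakk>z \<in> carrier E; \<pi> z = \<one>\<^bsub>G\<^esub>; x \<in> carrier E\<rbrakk> \<Longrightarrow> z \<otimes>\<^bsub>E\<^esub> x = x \<otimes>\<^bsub>E\<^esub> z"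
    and pow: "\<And>t. t \<in> carrier (tensor_square G) \<Longrightarrow> t [^]\<^bsub>tensor_square G\<^esub> (q::nat) = \<one>\<^bsub>tensor_square G\<^esub>"
    and x: "x \<in> derived E (carrier E)"
  shows "x [^]\<^bsub>E\<^esub> q = \<one>\<^bsub>E\<^esub>"
proof -
  interpret E: group E by (rule E)
  interpret G: group G by (rule G)
  interpret \<pi>: group_hom E G \<pi>
    using assms by (simp add: group_hom_def group_hom_axioms_def)
  \<comment> \<open>An arbitrary section; inside commutators \<open>comm_eq\<close> makes its
    failure to be multiplicative harmless.\<close>
  define \<sigma> where "\<sigma> g = (SOME y. y \<in> carrier E \<and> \<pi> y = g)" for g
  have \<sigma>: "\<sigma> g \<in> carrier E" "\<pi> (\<sigma> g) = g" if "g \<in> carrier G" for g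
  proof -
    have "\<exists>y. y \<in> carrier E \<and> \<pi> y = g" using that unfolding surj[symmetric] by auto
    from someI_ex[OF this] show "\<sigma> g \<in> carrier E" "\<pi> (\<sigma> g) = g" unfolding \<sigma>_def by auto
  qed
  note comm_eq = central_extension_commutator_eq[OF E G \<pi> central]
  have "\<exists>\<phi>. \<phi> \<in> hom (tensor_square G) E \<and>
    (\<forall>g\<in>carrier G. \<forall>h\<in>carrier G. \<phi> (tensor G g h) = E.commutator (\<sigma> g) (\<sigma> h))"
  proof (rule G.tensor_square_lift[OF E])
    fix g g' h assume g: "g \<in> carrier G" "g' \<in> carrier G" "h \<in> carrier G"
    note s = g[THEN \<sigma>(1)]
    have "E.commutator (\<sigma> (g \<otimes>\<^bsub>G\<^esub> g')) (\<sigma> h) = E.commutator (\<sigma> g \<otimes>\<^bsub>E\<^esub> \<sigma> g') (\<sigma> h)"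
      using g s by (intro comm_eq) (auto simp: \<sigma>)
    also have "\<dots> = E.commutator (\<sigma> g \<otimes>\<^bsub>E\<^esub> \<sigma> g' \<otimes>\<^bsub>E\<^esub> inv\<^bsub>E\<^esub> \<sigma> g) (\<sigma> g \<otimes>\<^bsub>E\<^esub> \<sigma> h \<otimes>\<^bsub>E\<^esub> inv\<^bsub>E\<^esub> \<sigma> g)
        \<otimes>\<^bsub>E\<^esub> E.commutator (\<sigma> g) (\<sigma> h)"
      using s by (simp add: E.commutator_def E.group_word_simps)
    also have "E.commutator (\<sigma> g \<otimes>\<^bsub>E\<^esub> \<sigma> g' \<otimes>\<^bsub>E\<^esub> inv\<^bsub>E\<^esub> \<sigma> g) (\<sigma> g \<otimes>\<^bsub>E\<^esub> \<sigma> h \<otimes>\<^bsub>E\<^esub> inv\<^bsub>E\<^esub> \<sigma> g)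
        = E.commutator (\<sigma> (conj_act G g g')) (\<sigma> (conj_act G g h))"
      using g s by (intro comm_eq) (auto simp: \<sigma> conj_act_def)
    finally show "E.commutator (\<sigma> (g \<otimes>\<^bsub>G\<^esub> g')) (\<sigma> h)
      = E.commutator (\<sigma> (conj_act G g g')) (\<sigma> (conj_act G g h)) \<otimes>\<^bsub>E\<^esub> E.commutator (\<sigma> g) (\<sigma> h)" .
  next
    fix g h h' assume g: "g \<in> carrier G" "h \<in> carrier G" "h' \<in> carrier G"
    note s = g[THEN \<sigma>(1)]
    have "E.commutator (\<sigma> g) (\<sigma> (h \<otimes>\<^bsub>G\<^esub> h')) = E.commutator (\<sigma> g) (\<sigma> h \<otimes>\<^bsub>E\<^esub> \<sigma> h')"
      using g s by (intro comm_eq) (auto simp: \<sigma>)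
    also have "\<dots> = E.commutator (\<sigma> g) (\<sigma> h) \<otimes>\<^bsub>E\<^esub>
        E.commutator (\<sigma> h \<otimes>\<^bsub>E\<^esub> \<sigma> g \<otimes>\<^bsub>E\<^esub> inv\<^bsub>E\<^esub> \<sigma> h) (\<sigma> h \<otimes>\<^bsub>E\<^esub> \<sigma> h' \<otimes>\<^bsub>E\<^esub> inv\<^bsub>E\<^esub> \<sigma> h)"
      using s by (simp add: E.commutator_def E.group_word_simps)
    also have "E.commutator (\<sigma> h \<otimes>\<^bsub>E\<^esub> \<sigma> g \<otimes>\<^bsub>E\<^esub> inv\<^bsub>E\<^esub> \<sigma> h) (\<sigma> h \<otimes>\<^bsub>E\<^esub> \<sigma> h' \<otimes>\<^bsub>E\<^esub> inv\<^bsub>E\<^esub> \<sigma> h)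
        = E.commutator (\<sigma> (conj_act G h g)) (\<sigma> (conj_act G h h'))"
      using g s by (intro comm_eq) (auto simp: \<sigma> conj_act_def)
    finally show "E.commutator (\<sigma> g) (\<sigma> (h \<otimes>\<^bsub>G\<^esub> h'))
      = E.commutator (\<sigma> g) (\<sigma> h) \<otimes>\<^bsub>E\<^esub> E.commutator (\<sigma> (conj_act G h g)) (\<sigma> (conj_act G h h'))" .
  qed (auto simp: \<sigma>)
  then obtain \<phi> where \<phi>: "\<phi> \<in> hom (tensor_square G) E"
    "\<And>g h. \<lbrakk>g \<in> carrier G; h \<in> carrier G\<rbrakk> \<Longrightarrow> \<phi> (tensor G g h) = E.commutator (\<sigma> g) (\<sigma> h)"
    by blast
  interpret \<phi>: group_hom "tensor_square G" E \<phi>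
    using E \<phi>(1) group_tensor_square by (simp add: group_hom_def group_hom_axioms_def)
  have "derived E (carrier E) \<subseteq> \<phi> ` carrier (tensor_square G)"
    unfolding derived_def
  proof (rule E.generate_subgroup_incl[OF _ \<phi>.subgroup_img_is_subgroup[OF \<phi>.G.subgroup_self]])
    show "derived_set E (carrier E) \<subseteq> \<phi> ` carrier (tensor_square G)"
    proof
      fix w assume "w \<in> derived_set E (carrier E)"
      then obtain a b where ab: "a \<in> carrier E" "b \<in> carrier E" "w = E.commutator a b"
        by (auto simp: E.commutator_def)
      have "w = E.commutator (\<sigma> (\<pi> a)) (\<sigma> (\<pi> b))"
        unfolding ab(3) using ab by (intro comm_eq) (auto simp: \<sigma>)
      also have "\<dots> = \<phi> (tensor G (\<pi> a) (\<pi> b))" using ab \<phi>(2) by simp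
      finally show "w \<in> \<phi> ` carrier (tensor_square G)"
        using ab by (auto simp: tensor_closed)
    qed
  qed
  then obtain t where "t \<in> carrier (tensor_square G)" "x = \<phi> t" using x by auto
  then show ?thesis using pow \<phi>.hom_nat_pow[of t q] by simp
qed

text \<open>The bar complex is unnormalised, so \<open>f\<close> need not be normalised either; this
  forces the correction in the identity element.\<close>

definition cocycle_extension ::
    "('c, 'd) monoid_scheme \<Rightarrow> ('a, 'b) monoid_scheme \<Rightarrow> ('a \<Rightarrow> 'a \<Rightarrow> 'c) \<Rightarrow> ('c \<times> 'a) monoid" where
  "cocycle_extension A G f = \<lparr>carrier = carrier A \<times> carrier G,
     monoid.mult = (\<lambda>(a, g) (b, h). (a \<otimes>\<^bsub>A\<^esub> b \<otimes>\<^bsub>A\<^esub> f g h, g \<otimes>\<^bsub>G\<^esub> h)),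
     one = (inv\<^bsub>A\<^esub> f \<one>\<^bsub>G\<^esub> \<one>\<^bsub>G\<^esub>, \<one>\<^bsub>G\<^esub>)\<rparr>"

lemma cocycle_extension_simps [simp]:
  "carrier (cocycle_extension A G f) = carrier A \<times> carrier G"
  "(a, g) \<otimes>\<^bsub>cocycle_extension A G f\<^esub> (b, h) = (a \<otimes>\<^bsub>A\<^esub> b \<otimes>\<^bsub>A\<^esub> f g h, g \<otimes>\<^bsub>G\<^esub> h)"
  "\<one>\<^bsub>cocycle_extension A G f\<^esub> = (inv\<^bsub>A\<^esub> f \<one>\<^bsub>G\<^esub> \<one>\<^bsub>G\<^esub>, \<one>\<^bsub>G\<^esub>)"
  by (simp_all add: cocycle_extension_def)

text \<open>The sides of \<open>cocycle\<close> collect the positive and the negative terms of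
  \<open>bar_boundary3\<close> at \<open>(g, h, k)\<close>.\<close>

locale group_cocycle = A: comm_group A + G: group G for A (structure) and G (structure) +
  fixes f
  assumes f_closed [simp]: "\<lbrakk>g \<in> carrier G; h \<in> carrier G\<rbrakk> \<Longrightarrow> f g h \<in> carrier A"
    and cocycle: "\<lbrakk>g \<in> carrier G; h \<in> carrier G; k \<in> carrier G\<rbrakk> \<Longrightarrow>
      f h k \<otimes>\<^bsub>A\<^esub> f g (h \<otimes>\<^bsub>G\<^esub> k) = f (g \<otimes>\<^bsub>G\<^esub> h) k \<otimes>\<^bsub>A\<^esub> f g h"
begin

abbreviation E where "E \<equiv> cocycle_extension A G f"

lemma cocycle_one_left: "h \<in> carrier G \<Longrightarrow> f \<one>\<^bsub>G\<^esub> h = f \<one>\<^bsub>G\<^esub> \<one>\<^bsub>G\<^esub>"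
  using cocycle[of "\<one>\<^bsub>G\<^esub>" "\<one>\<^bsub>G\<^esub>" h] by simp

lemma cocycle_one_right: "h \<in> carrier G \<Longrightarrow> f h \<one>\<^bsub>G\<^esub> = f \<one>\<^bsub>G\<^esub> \<one>\<^bsub>G\<^esub>"
  using cocycle[of h "\<one>\<^bsub>G\<^esub>" "\<one>\<^bsub>G\<^esub>"] by simp

lemma group_E: "group E"
proof (rule groupI)
  fix x y z assume "x \<in> carrier E" "y \<in> carrier E" "z \<in> carrier E"
  then obtain a b c g h k where x: "x = (a, g)" "a \<in> carrier A" "g \<in> carrier G"
    and y: "y = (b, h)" "b \<in> carrier A" "h \<in> carrier G"
    and z: "z = (c, k)" "c \<in> carrier A" "k \<in> carrier G"
    by auto
  have "a \<otimes>\<^bsub>A\<^esub> b \<otimes>\<^bsub>A\<^esub> f g h \<otimes>\<^bsub>A\<^esub> c \<otimes>\<^bsub>A\<^esub> f (g \<otimes>\<^bsub>G\<^esub> h) k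
      = a \<otimes>\<^bsub>A\<^esub> b \<otimes>\<^bsub>A\<^esub> c \<otimes>\<^bsub>A\<^esub> (f (g \<otimes>\<^bsub>G\<^esub> h) k \<otimes>\<^bsub>A\<^esub> f g h)"
    using x y z by (simp add: A.m_ac)
  also have "\<dots> = a \<otimes>\<^bsub>A\<^esub> (b \<otimes>\<^bsub>A\<^esub> c \<otimes>\<^bsub>A\<^esub> f h k) \<otimes>\<^bsub>A\<^esub> f g (h \<otimes>\<^bsub>G\<^esub> k)"
    using x y z cocycle[of g h k, symmetric] by (simp add: A.m_ac)
  finally show "x \<otimes>\<^bsub>E\<^esub> y \<otimes>\<^bsub>E\<^esub> z = x \<otimes>\<^bsub>E\<^esub> (y \<otimes>\<^bsub>E\<^esub> z)"
    using x y z by (simp add: G.m_assoc)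
next
  fix x assume "x \<in> carrier E"
  then obtain a g where x: "x = (a, g)" "a \<in> carrier A" "g \<in> carrier G" by auto
  have "inv\<^bsub>A\<^esub> f \<one>\<^bsub>G\<^esub> \<one>\<^bsub>G\<^esub> \<otimes>\<^bsub>A\<^esub> a = a \<otimes>\<^bsub>A\<^esub> inv\<^bsub>A\<^esub> f \<one>\<^bsub>G\<^esub> \<one>\<^bsub>G\<^esub>"
    using x by (intro A.m_comm) auto
  then show "\<one>\<^bsub>E\<^esub> \<otimes>\<^bsub>E\<^esub> x = x"
    using x by (simp add: cocycle_one_left[of g] A.m_assoc)
  let ?y = "(inv\<^bsub>A\<^esub> f \<one>\<^bsub>G\<^esub> \<one>\<^bsub>G\<^esub> \<otimes>\<^bsub>A\<^esub> inv\<^bsub>A\<^esub> f (inv\<^bsub>G\<^esub> g) g \<otimes>\<^bsub>A\<^esub> inv\<^bsub>A\<^esub> a, inv\<^bsub>G\<^esub> g)"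
  have "?y \<otimes>\<^bsub>E\<^esub> x = \<one>\<^bsub>E\<^esub>" using x by (simp add: A.m_assoc)
  moreover have "?y \<in> carrier E" using x by simp
  ultimately show "\<exists>y\<in>carrier E. y \<otimes>\<^bsub>E\<^esub> x = \<one>\<^bsub>E\<^esub>" by (intro bexI)
qed auto

lemma snd_hom: "snd \<in> hom E G"
  by (auto simp: hom_def)

lemma kernel_snd_central:
  assumes "z \<in> carrier E" "snd z = \<one>\<^bsub>G\<^esub>" "x \<in> carrier E"
  shows "z \<otimes>\<^bsub>E\<^esub> x = x \<otimes>\<^bsub>E\<^esub> z"
proof -
  obtain a b h where z: "z = (a, \<one>\<^bsub>G\<^esub>)" "a \<in> carrier A"
    and x: "x = (b, h)" "b \<in> carrier A" "h \<in> carrier G"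
    using assms by (cases z, cases x) auto
  then show ?thesis
    using A.m_comm[OF z(2) x(2)] by (simp add: cocycle_one_left[of h] cocycle_one_right[of h])
qed

text \<open>The correction offsets the value of \<open>f\<close> at the identity that each product
  contributes.\<close>

definition incl :: "'a \<Rightarrow> 'a \<times> 'c" where
  "incl a = (a \<otimes>\<^bsub>A\<^esub> inv\<^bsub>A\<^esub> f \<one>\<^bsub>G\<^esub> \<one>\<^bsub>G\<^esub>, \<one>\<^bsub>G\<^esub>)"

lemma incl_hom: "incl \<in> hom A E"
proof (rule homI)
  fix a b assume ab: "a \<in> carrier A" "b \<in> carrier A"
  let ?u = "inv\<^bsub>A\<^esub> f \<one>\<^bsub>G\<^esub> \<one>\<^bsub>G\<^esub>"
  have "a \<otimes>\<^bsub>A\<^esub> ?u \<otimes>\<^bsub>A\<^esub> (b \<otimes>\<^bsub>A\<^esub> ?u) \<otimes>\<^bsub>A\<^esub> f \<one>\<^bsub>G\<^esub> \<one>\<^bsub>G\<^esub> = a \<otimes>\<^bsub>A\<^esub> ?u \<otimes>\<^bsub>A\<^esub> b"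
    using ab by (simp add: A.m_assoc)
  also have "\<dots> = a \<otimes>\<^bsub>A\<^esub> b \<otimes>\<^bsub>A\<^esub> ?u" using ab by (simp add: A.m_ac)
  finally show "incl (a \<otimes>\<^bsub>A\<^esub> b) = incl a \<otimes>\<^bsub>E\<^esub> incl b"
    by (simp add: incl_def)
qed (simp add: incl_def)

lemma incl_mult_section:
  assumes "a \<in> carrier A" "h \<in> carrier G"
  shows "incl a \<otimes>\<^bsub>E\<^esub> (\<one>\<^bsub>A\<^esub>, h) = (a, h)"
  using assms by (simp add: incl_def cocycle_one_left[of h] A.m_assoc)

lemma incl_eq_one_iff:
  assumes "a \<in> carrier A" shows "incl a = \<one>\<^bsub>E\<^esub> \<longleftrightarrow> a = \<one>\<^bsub>A\<^esub>"
  using assms by (simp add: incl_def)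

end

section \<open>From bar cycles to the derived subgroup of a central extension\<close>

lemma (in group) subgroup_bar_boundaries2:
  "subgroup (bar_boundaries2 G) (free_Abelian_group (carrier G \<times> carrier G))"
proof -
  let ?F3 = "free_Abelian_group (carrier G \<times> carrier G \<times> carrier G)"
  let ?F2 = "free_Abelian_group (carrier G \<times> carrier G)"
  have "bar_boundary3 G \<in> hom ?F3 ?F2"
  proof (rule homI)
    fix c assume "c \<in> carrier ?F3"
    then have "bar_boundary3 G c \<in> bar_boundaries2 G" by (simp only: bar_boundaries2_def imageI)
    with bar_boundaries2_subset show "bar_boundary3 G c \<in> carrier ?F2"
      by (auto simp: bar_cycles2_def)
  qed (simp add: bar_boundary3_def frag_extend_add)
  then have "group_hom ?F3 ?F2 (bar_boundary3 G)"
    by (simp add: group_hom_def group_hom_axioms_def)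
  then show ?thesis
    unfolding bar_boundaries2_def
    by (rule group_hom.subgroup_img_is_subgroup) (rule group.subgroup_self[OF group_free_Abelian_group])
qed

text \<open>In the abelianisation of \<open>E\<close> the class of a chain depends only on its bar
  boundary. So cycles become trivial there, hence lie in the derived subgroup, where
  \<open>q\<close>-th powers vanish; injectivity of \<open>incl\<close> carries this back to chains
  modulo boundaries.\<close>

lemma (in group) bar_cycle_pow_mem_boundaries:
  assumes pow: "\<And>t. t \<in> carrier (tensor_square G) \<Longrightarrow> t [^]\<^bsub>tensor_square G\<^esub> (q::nat) = \<one>\<^bsub>tensor_square G\<^esub>"
    and c: "c \<in> bar_cycles2 G"
  shows "c [^]\<^bsub>free_Abelian_group (carrier G \<times> carrier G)\<^esub> q \<in> bar_boundaries2 G"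
proof -
  let ?F = "free_Abelian_group (carrier G \<times> carrier G)" and ?B = "bar_boundaries2 G"
  let ?A = "?F Mod ?B"
  interpret F: comm_group ?F by (rule abelian_free_Abelian_group)
  have B: "?B \<lhd> ?F" using subgroup_bar_boundaries2 by (simp add: F.normal_iff_subgroup)
  interpret B: normal ?B ?F by (rule B)
  interpret A: comm_group ?A by (rule F.abelian_FactGroup[OF subgroup_bar_boundaries2])
  define cls where "cls c = ?B #>\<^bsub>?F\<^esub> c" for c
  have cls_hom: "cls \<in> hom ?F ?A" unfolding cls_def by (rule B.r_coset_hom_Mod)
  interpret cls: group_hom ?F ?A cls
    by (simp add: group_hom_def group_hom_axioms_def cls_hom F.is_group A.is_group)
  have cls_one: "cls c = \<one>\<^bsub>?A\<^esub> \<longleftrightarrow> c \<in> ?B" if "c \<in> carrier ?F" for c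
    using that F.coset_join1[of ?B c] F.coset_join2[OF that B.subgroup_axioms] B.subset B.subgroup_axioms
    by (auto simp: cls_def FactGroup_def)
  \<comment> \<open>With all 2-chains as coefficients, not only cycles, each pair has a class, and
    dividing by boundaries imposes exactly the cocycle identity.\<close>
  define f where "f g h = cls (frag_of (g, h))" for g h
  interpret group_cocycle ?A G f
  proof (unfold_locales)
    show "f g h \<in> carrier ?A" if "g \<in> carrier G" "h \<in> carrier G" for g h
      unfolding f_def using that by (intro cls.hom_closed) simp
    fix g h k assume g: "g \<in> carrier G" "h \<in> carrier G" "k \<in> carrier G"
    let ?a = "frag_of (h, k) + frag_of (g, h \<otimes> k)" and ?b = "frag_of (g \<otimes> h, k) + frag_of (g, h)"
    have ab: "?a \<in> carrier ?F" "?b \<in> carrier ?F"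
      using g by (auto dest!: subsetD[OF keys_add])
    have "bar_boundary3 G (frag_of (g, h, k)) \<in> ?B"
      unfolding bar_boundaries2_def by (rule imageI) (use g in simp)
    moreover have "bar_boundary3 G (frag_of (g, h, k)) = ?a - ?b"
      by (simp add: bar_boundary3_def)
    moreover have "?a \<otimes>\<^bsub>?F\<^esub> inv\<^bsub>?F\<^esub> ?b = ?a - ?b"
      using ab(2)[unfolded carrier_free_Abelian_group_iff] by simp
    ultimately have "?a \<otimes>\<^bsub>?F\<^esub> inv\<^bsub>?F\<^esub> ?b \<in> ?B" by (simp only:)
    then have "cls (?a \<otimes>\<^bsub>?F\<^esub> inv\<^bsub>?F\<^esub> ?b) = \<one>\<^bsub>?A\<^esub>"
      by (rule iffD2[OF cls_one[OF F.m_closed[OF ab(1) F.inv_closed[OF ab(2)]]]])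
    then have "cls ?a \<otimes>\<^bsub>?A\<^esub> inv\<^bsub>?A\<^esub> cls ?b = \<one>\<^bsub>?A\<^esub>"
      by (simp only: cls.hom_mult cls.hom_inv ab F.inv_closed)
    then have "cls ?a = \<one>\<^bsub>?A\<^esub> \<otimes>\<^bsub>?A\<^esub> cls ?b"
      by (rule iffD1[OF A.inv_solve_right'[OF A.one_closed cls.hom_closed[OF ab(1)] cls.hom_closed[OF ab(2)]]])
    then have "cls ?a = cls ?b"
      by (simp only: A.l_one cls.hom_closed ab)
    moreover have "cls ?a = f h k \<otimes>\<^bsub>?A\<^esub> f g (h \<otimes> k)" "cls ?b = f (g \<otimes> h) k \<otimes>\<^bsub>?A\<^esub> f g h"
      unfolding f_def using cls.hom_mult[of "frag_of (h, k)" "frag_of (g, h \<otimes> k)"]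
        cls.hom_mult[of "frag_of (g \<otimes> h, k)" "frag_of (g, h)"] g
      by (simp_all only: mult_free_Abelian_group frag_of_in_free_Abelian_group mem_Sigma_iff m_closed simp_thms)
    ultimately show "f h k \<otimes>\<^bsub>?A\<^esub> f g (h \<otimes> k) = f (g \<otimes> h) k \<otimes>\<^bsub>?A\<^esub> f g h" by simp
  qed
  interpret E: group E by (rule group_E)
  let ?D = "derived E (carrier E)"
  have D: "?D \<lhd> E" by (rule E.derived_is_normal[OF E.normal_self])
  interpret D: normal ?D E by (rule D)
  interpret Q: comm_group "E Mod ?D" by (rule E.derived_quot_is_comm_group)
  define r where "r x = ?D #>\<^bsub>E\<^esub> x" for x
  interpret r: group_hom E "E Mod ?D" r
    unfolding r_def
    by (intro group_hom.intro group_hom_axioms.intro E.is_group Q.is_group D.r_coset_hom_Mod)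
  interpret i: group_hom ?A E incl
    by (simp add: group_hom_def group_hom_axioms_def A.is_group E.is_group incl_hom)
  let ?F1 = "free_Abelian_group (carrier G)"
  have s: "(\<one>\<^bsub>?A\<^esub>, x) \<in> carrier E" if "x \<in> carrier G" for x
    unfolding cocycle_extension_simps using A.one_closed that by (rule SigmaI)
  then have "(\<lambda>g. r (\<one>\<^bsub>?A\<^esub>, g)) ` carrier G \<subseteq> carrier (E Mod ?D)"
    by (intro image_subsetI r.hom_closed)
  \<comment> \<open>The section is in general no homomorphism on \<open>G\<close>, but it extends to
    one on 1-chains because the quotient is commutative.\<close>
  from Q.free_Abelian_group_universal[OF this] obtain l
    where l: "l \<in> hom ?F1 (E Mod ?D)" "\<And>g. g \<in> carrier G \<Longrightarrow> l (frag_of g) = r (\<one>\<^bsub>?A\<^esub>, g)" by metis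
  interpret l: group_hom ?F1 "E Mod ?D" l
    by (intro group_hom.intro group_hom_axioms.intro group_free_Abelian_group Q.is_group l(1))
  have key: "bar_boundary2 G c \<in> carrier ?F1 \<and> r (incl (cls c)) = l (bar_boundary2 G c)"
    if "Poly_Mapping.keys c \<subseteq> carrier G \<times> carrier G" for c
  proof (rule free_Abelian_group_induct[OF that])
    show "bar_boundary2 G 0 \<in> carrier ?F1 \<and> r (incl (cls 0)) = l (bar_boundary2 G 0)"
      using cls.hom_one i.hom_one r.hom_one l.hom_one by (simp add: bar_boundary2_def)
  next
    fix x y
    assume k: "Poly_Mapping.keys x \<subseteq> carrier G \<times> carrier G" "Poly_Mapping.keys y \<subseteq> carrier G \<times> carrier G"
      and x: "bar_boundary2 G x \<in> carrier ?F1 \<and> r (incl (cls x)) = l (bar_boundary2 G x)"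
      and y: "bar_boundary2 G y \<in> carrier ?F1 \<and> r (incl (cls y)) = l (bar_boundary2 G y)"
    have d: "bar_boundary2 G (x - y) = bar_boundary2 G x \<otimes>\<^bsub>?F1\<^esub> inv\<^bsub>?F1\<^esub> bar_boundary2 G y"
      using y by (simp add: bar_boundary2_def frag_extend_diff)
    have xy: "x - y = x \<otimes>\<^bsub>?F\<^esub> inv\<^bsub>?F\<^esub> y" using k by simp
    have kc: "x \<in> carrier ?F" "y \<in> carrier ?F" using k by simp_all
    note bc = conjunct1[OF x] conjunct1[OF y]
    have "r (incl (cls (x - y))) = r (incl (cls x)) \<otimes>\<^bsub>E Mod ?D\<^esub> inv\<^bsub>E Mod ?D\<^esub> r (incl (cls y))"
      unfolding xy using kc
      by (simp only: cls.hom_mult cls.hom_inv cls.hom_closed F.inv_closed i.hom_mult i.hom_inv i.hom_closed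
          A.inv_closed r.hom_mult r.hom_inv E.inv_closed)
    also have "\<dots> = l (bar_boundary2 G (x - y))"
      unfolding d using x y
      by (simp only: l.hom_mult l.hom_inv l.G.inv_closed)
    finally show "bar_boundary2 G (x - y) \<in> carrier ?F1 \<and> r (incl (cls (x - y))) = l (bar_boundary2 G (x - y))"
      unfolding d using bc by (simp only: l.G.m_closed l.G.inv_closed)
  next
    fix a assume "a \<in> carrier G \<times> carrier G"
    then obtain g h where a: "a = (g, h)" "g \<in> carrier G" "h \<in> carrier G" by auto
    have F1: "frag_of x \<in> carrier ?F1" if "x \<in> carrier G" for x using that by simp
    have bd: "bar_boundary2 G (frag_of a)
        = frag_of g \<otimes>\<^bsub>?F1\<^esub> frag_of h \<otimes>\<^bsub>?F1\<^esub> inv\<^bsub>?F1\<^esub> frag_of (g \<otimes> h)"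
      using a by (simp add: bar_boundary2_def)
    have ic: "incl (f g h) \<in> carrier E" using a by (intro i.hom_closed f_closed)
    \<comment> \<open>The cocycle measures the failure of the section to be multiplicative.\<close>
    have "incl (f g h) \<otimes>\<^bsub>E\<^esub> (\<one>\<^bsub>?A\<^esub>, g \<otimes> h) = (\<one>\<^bsub>?A\<^esub>, g) \<otimes>\<^bsub>E\<^esub> (\<one>\<^bsub>?A\<^esub>, h)"
      unfolding incl_mult_section[OF f_closed[OF a(2,3)] m_closed[OF a(2,3)]]
      by (simp only: cocycle_extension_simps A.l_one A.one_closed f_closed[OF a(2,3)])
    then have "r (incl (f g h)) \<otimes>\<^bsub>E Mod ?D\<^esub> r (\<one>\<^bsub>?A\<^esub>, g \<otimes> h) = r (\<one>\<^bsub>?A\<^esub>, g) \<otimes>\<^bsub>E Mod ?D\<^esub> r (\<one>\<^bsub>?A\<^esub>, h)"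
      using ic s a by (metis m_closed r.hom_mult)
    then have "r (incl (f g h)) = r (\<one>\<^bsub>?A\<^esub>, g) \<otimes>\<^bsub>E Mod ?D\<^esub> r (\<one>\<^bsub>?A\<^esub>, h) \<otimes>\<^bsub>E Mod ?D\<^esub> inv\<^bsub>E Mod ?D\<^esub> r (\<one>\<^bsub>?A\<^esub>, g \<otimes> h)"
      by (intro iffD2[OF Q.inv_solve_right[OF r.hom_closed[OF ic] Q.m_closed]] r.hom_closed s a m_closed)
        (erule HOL.sym)
    also have "\<dots> = l (bar_boundary2 G (frag_of a))"
      unfolding bd using a F1 by (simp only: l.hom_mult l.hom_inv l.G.m_closed l.G.inv_closed l(2) m_closed)
    finally show "bar_boundary2 G (frag_of a) \<in> carrier ?F1 \<and> r (incl (cls (frag_of a))) = l (bar_boundary2 G (frag_of a))"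
      unfolding bd using a F1 by (simp only: l.G.m_closed l.G.inv_closed m_closed f_def)
  qed
  have cF: "c \<in> carrier ?F" and c0: "bar_boundary2 G c = 0"
    using c by (auto simp: bar_cycles2_def)
  have ic: "incl (cls c) \<in> carrier E" using cF by (intro i.hom_closed cls.hom_closed)
  have "r (incl (cls c)) = \<one>\<^bsub>E Mod ?D\<^esub>"
    using key[of c] cF l.hom_one unfolding c0 by simp
  then have "incl (cls c) \<in> ?D"
    using E.coset_join1[OF _ ic D.subgroup_axioms] D.subset by (auto simp: r_def FactGroup_def)
  then have "incl (cls c) [^]\<^bsub>E\<^esub> q = \<one>\<^bsub>E\<^esub>"
    by (intro central_extension_derived_pow[OF group_E is_group snd_hom _ kernel_snd_central pow])
      (auto simp: image_iff intro: A.one_closed)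
  then have "incl (cls (c [^]\<^bsub>?F\<^esub> q)) = \<one>\<^bsub>E\<^esub>"
    using cF by (simp only: cls.hom_nat_pow i.hom_nat_pow cls.hom_closed)
  then show ?thesis
    using cF incl_eq_one_iff cls_one by (metis F.nat_pow_closed cls.hom_closed)
qed


section \<open>Exponents\<close>

lemma (in group) group_exponent_dvd:
  assumes q: "0 < q" "\<And>x. x \<in> carrier G \<Longrightarrow> x [^] (q::nat) = \<one>"
  shows "group_exponent G dvd q" "0 < group_exponent G"
    "\<And>x. x \<in> carrier G \<Longrightarrow> x [^] group_exponent G = \<one>"
proof -
  let ?P = "\<lambda>n::nat. n > 0 \<and> (\<forall>x\<in>carrier G. x [^] n = \<one>)"
  have ex: "?P q" using q by simp
  then have d: "group_exponent G = (LEAST n. ?P n)"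
    unfolding group_exponent_def by (intro if_P) blast
  have P: "?P (group_exponent G)" unfolding d using ex by (rule LeastI)
  then show pow: "x [^] group_exponent G = \<one>" if "x \<in> carrier G" for x
    using that by blast
  show "0 < group_exponent G" using P by simp
  let ?r = "q mod group_exponent G"
  have "x [^] ?r = \<one>" if x: "x \<in> carrier G" for x
  proof -
    have "x [^] q = (x [^] group_exponent G) [^] (q div group_exponent G) \<otimes> x [^] ?r"
      using x by (simp add: nat_pow_pow nat_pow_mult)
    then show ?thesis using q(2)[OF x] pow[OF x] x by simp
  qed
  then have "?r = 0"
    using not_less_Least[of ?r ?P] P d by (metis gr0I mod_less_divisor)
  then show "group_exponent G dvd q" by auto
qed

lemma (in normal) FactGroup_pow:
  assumes "\<And>x. x \<in> carrier G \<Longrightarrow> x [^] (q::nat) \<in> H" and X: "X \<in> carrier (G Mod H)"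
  shows "X [^]\<^bsub>G Mod H\<^esub> q = \<one>\<^bsub>G Mod H\<^esub>"
proof -
  interpret r: group_hom G "G Mod H" "\<lambda>a. H #> a"
    by (simp add: group_hom_def group_hom_axioms_def is_group factorgroup_is_group r_coset_hom_Mod)
  obtain x where x: "x \<in> carrier G" "X = H #> x"
    using X by (auto simp: FactGroup_def RCOSETS_def)
  then show ?thesis
    using r.hom_nat_pow[of x q] assms(1) rcos_const[OF is_group] by (simp add: FactGroup_def)
qed

theorem theorem5p5:
  fixes G :: "('a, 'b) monoid_scheme" (structure) and p :: nat
  assumes "group G" and "finite (carrier G)"
    and "Factorial_Ring.prime p" and "odd p"
    and "\<exists>n. order G = p ^ n"
    and "(\<exists>m. 2 \<le> m \<and> m \<le> p - 1 \<and> lower_central G m \<subseteq> power_subgroup G p)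
         \<or> lower_central G p \<subseteq> power_subgroup G (p ^ 2)"
  shows "group_exponent (exterior_square G) dvd group_exponent G
         \<and> group_exponent (schur_multiplier G) dvd group_exponent G"
proof -
  interpret group G by fact
  obtain k where k: "order G = p ^ k" using assms(5) by blast
  have "0 < order G" using assms(2) order_gt_0_iff_finite by simp
  \<comment> \<open>The order annihilates \<open>G\<close>, so its exponent is positive and the
    value 0, which encodes an infinite exponent, does not make the divisibility vacuous.\<close>
  note exponent = group_exponent_dvd[OF this pow_order_eq_1]
  obtain n where n: "group_exponent G = p ^ n"
    using exponent(1) divides_primepow_nat[OF assms(3)] unfolding k by blast
  have pow: "t [^]\<^bsub>tensor_square G\<^esub> group_exponent G = \<one>\<^bsub>tensor_square G\<^esub>"
    if "t \<in> carrier (tensor_square G)" for t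
    unfolding n by (rule tensor_square_pow_eq_one[OF assms(3,4) k assms(6) exponent(3)[unfolded n] that])
  interpret nab: normal "nabla G" "tensor_square G" by (rule nabla_normal)
  have "group_exponent (exterior_square G) dvd group_exponent G"
  proof (rule group.group_exponent_dvd(1)[OF group_exterior_square exponent(2)])
    fix X assume "X \<in> carrier (exterior_square G)"
    then show "X [^]\<^bsub>exterior_square G\<^esub> group_exponent G = \<one>\<^bsub>exterior_square G\<^esub>"
      unfolding exterior_square_def by (rule nab.FactGroup_pow[rotated]) (simp add: pow)
  qed
  moreover have "group_exponent (schur_multiplier G) dvd group_exponent G"
  proof (rule group.group_exponent_dvd(1)[OF _ exponent(2)])
    show "group (schur_multiplier G)" using comm_group_schur_multiplier by (rule comm_group.axioms)
    let ?F = "free_Abelian_group (carrier G \<times> carrier G)"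
    let ?Z = "subgroup_generated ?F (bar_cycles2 G)"
    have Z: "comm_group ?Z"
      by (rule group.abelian_subgroup_generated[OF group_free_Abelian_group abelian_free_Abelian_group])
    have "subgroup (bar_boundaries2 G) ?Z"
      using subgroup_bar_boundaries2 bar_boundaries2_subset subgroup_bar_cycles2
      by (simp add: group.subgroup_subgroup_generated_iff carrier_bar_cycles2)
    then interpret B: normal "bar_boundaries2 G" ?Z by (simp add: comm_group.normal_iff_subgroup[OF Z])
    fix X assume "X \<in> carrier (schur_multiplier G)"
    then show "X [^]\<^bsub>schur_multiplier G\<^esub> group_exponent G = \<one>\<^bsub>schur_multiplier G\<^esub>"
      unfolding schur_multiplier_def
    proof (rule B.FactGroup_pow[rotated])
      fix c assume "c \<in> carrier ?Z"
      then have "c \<in> bar_cycles2 G" by (simp add: carrier_bar_cycles2)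
      from bar_cycle_pow_mem_boundaries[OF pow this]
      show "c [^]\<^bsub>?Z\<^esub> group_exponent G \<in> bar_boundaries2 G" by (simp only: pow_subgroup_generated)
    qed
  qed
  ultimately show ?thesis ..
qed

end
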